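(* Let $T=T_0+T_1e_1+T_2e_2\in\mathcal{BC}(X)$ and assume that the operators $T_\ell$, $\ell=0,1,2$, have real spectrum. Let $\sigma_S(T)=\sigma_1\cup\sigma_2$ with $\operatorname{dist}(\sigma_1,\sigma_2)>0$. Let $G_1,G_2\subset\mathbb H$ be two bounded slice Cauchy domains such that $\sigma_1\subset G_1$, $\overline G_1\subset G_2$ and $\operatorname{dist}(G_2,\sigma_2)>0$, and let $J\in\mathbb S$. Then the operator $$\breve P_0:=\frac1{8\pi}\int_{\partial(G_2\cap\mathbb C_J)}s\,ds_J\,\mathcal P^R_2(s,T)=\frac1{8\pi}\int_{\partial(G_1\cap\mathbb C_J)}\mathcal P^L_2(p,T)\,dp_J\,p$$ is a projection, i.e. $\breve P_0^2=\breve P_0$. Moreover, $T\breve P_0=\breve P_0T$.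
   Context: $\mathbb H$: quaternions with units $e_1,e_2,e_3$. $\mathbb S$: imaginary units ($J^2=-1$). $\mathbb C_J=\mathbb R+J\mathbb R$, $ds_J=ds(-J)$. A set $U\subseteq\mathbb H$ is axially symmetric if $u+Iv\in U$ implies $u+Jv\in U$ for all $J\in\mathbb S$. A slice Cauchy domain is an axially symmetric open $U$ such that for every $J\in\mathbb S$ the boundary of $U\cap\mathbb C_J$ is a finite union of nonintersecting piecewise $C^1$ Jordan curves. $X=X_{\mathbb R}\otimes\mathbb H$ is a two-sided quaternionic Banach module, $X_{\mathbb R}$ a real Banach space; $\mathcal B(X)$ is the space of bounded right linear operators; $(aT)(x)=aT(x)$, $(Ta)(x)=T(ax)$ for $a\in\mathbb H$. $\mathcal{BC}(X)$: operators $T=T_0+T_1e_1+T_2e_2+T_3e_3$ with pairwise commuting $T_i\in\mathcal B(X_{\mathbb R})$; $\overline T=T_0-T_1e_1-T_2e_2-T_3e_3$. $\rho_S(T)=\{s\in\mathbb H:(T^2-2\mathrm{Re}(s)T+|s|^2\mathcal I)^{-1}\in\mathcal B(X)\}$, $\sigma_S(T)=\mathbb H\setminus\rho_S(T)$; for $T\in\mathcal{BC}(X)$, $\rho_S(T)$ is also the set of $s$ with $\mathcal Q_{c,s}(T):=s^2-s(T+\overline T)+T\overline T$ invertible in $\mathcal B(X)$. For $s\in\rho_S(T)$: $F_L(s,T)=-4(s\mathcal I-\overline T)\mathcal Q_{c,s}(T)^{-2}$, $F_R(s,T)=-4\mathcal Q_{c,s}(T)^{-2}(s\mathcal I-\overline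 T)$, $\mathcal P^L_2(s,T)=-F_L(s,T)s+T_0F_L(s,T)$, $\mathcal P^R_2(s,T)=-sF_R(s,T)+T_0F_R(s,T)$. *)

theory Defs
  imports "HOL-Complex_Analysis.Complex_Analysis"
begin

section \<open>Quaternions\<close>

codatatype quat = Quat (qRe: real) (qIm1: real) (qIm2: real) (qIm3: real)

lemma quat_eqI:
  "\<lbrakk>qRe x = qRe y; qIm1 x = qIm1 y; qIm2 x = qIm2 y; qIm3 x = qIm3 y\<rbrakk> \<Longrightarrow> x = y"
  by (rule quat.expand) simp

lemma quat_eq_iff:
  "x = y \<longleftrightarrow> qRe x = qRe y \<and> qIm1 x = qIm1 y \<and> qIm2 x = qIm2 y \<and> qIm3 x = qIm3 y"
  by (auto intro: quat_eqI)

instantiation quat :: real_vector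
begin

definition zero_quat :: quat where "0 = Quat 0 0 0 0"
definition plus_quat :: "quat \<Rightarrow> quat \<Rightarrow> quat" where
  "x + y = Quat (qRe x + qRe y) (qIm1 x + qIm1 y) (qIm2 x + qIm2 y) (qIm3 x + qIm3 y)"
definition uminus_quat :: "quat \<Rightarrow> quat" where
  "- x = Quat (- qRe x) (- qIm1 x) (- qIm2 x) (- qIm3 x)"
definition minus_quat :: "quat \<Rightarrow> quat \<Rightarrow> quat" where
  "x - y = Quat (qRe x - qRe y) (qIm1 x - qIm1 y) (qIm2 x - qIm2 y) (qIm3 x - qIm3 y)"
definition scaleR_quat :: "real \<Rightarrow> quat \<Rightarrow> quat" where
  "r *\<^sub>R x = Quat (r * qRe x) (r * qIm1 x) (r * qIm2 x) (r * qIm3 x)"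

instance
  by standard (simp_all add: quat_eq_iff zero_quat_def plus_quat_def uminus_quat_def
      minus_quat_def scaleR_quat_def algebra_simps)

end

lemma quat_sel_linear [simp]:
  "qRe 0 = 0" "qIm1 0 = 0" "qIm2 0 = 0" "qIm3 0 = 0"
  "qRe (x + y) = qRe x + qRe y" "qIm1 (x + y) = qIm1 x + qIm1 y"
  "qIm2 (x + y) = qIm2 x + qIm2 y" "qIm3 (x + y) = qIm3 x + qIm3 y"
  "qRe (- x) = - qRe x" "qIm1 (- x) = - qIm1 x" "qIm2 (- x) = - qIm2 x" "qIm3 (- x) = - qIm3 x"
  "qRe (x - y) = qRe x - qRe y" "qIm1 (x - y) = qIm1 x - qIm1 y"
  "qIm2 (x - y) = qIm2 x - qIm2 y" "qIm3 (x - y) = qIm3 x - qIm3 y"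
  "qRe (r *\<^sub>R x) = r * qRe x" "qIm1 (r *\<^sub>R x) = r * qIm1 x"
  "qIm2 (r *\<^sub>R x) = r * qIm2 x" "qIm3 (r *\<^sub>R x) = r * qIm3 x"
  by (simp_all add: zero_quat_def plus_quat_def uminus_quat_def minus_quat_def scaleR_quat_def)

instantiation quat :: real_algebra_1
begin

definition one_quat :: quat where "1 = Quat 1 0 0 0"
definition times_quat :: "quat \<Rightarrow> quat \<Rightarrow> quat" where
  "x * y = Quat
     (qRe x * qRe y - qIm1 x * qIm1 y - qIm2 x * qIm2 y - qIm3 x * qIm3 y)
     (qRe x * qIm1 y + qIm1 x * qRe y + qIm2 x * qIm3 y - qIm3 x * qIm2 y)
     (qRe x * qIm2 y - qIm1 x * qIm3 y + qIm2 x * qRe y + qIm3 x * qIm1 y)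
     (qRe x * qIm3 y + qIm1 x * qIm2 y - qIm2 x * qIm1 y + qIm3 x * qRe y)"

instance
  by standard (simp_all add: quat_eq_iff one_quat_def times_quat_def algebra_simps)

end

lemma quat_sel_algebra [simp]:
  "qRe 1 = 1" "qIm1 1 = 0" "qIm2 1 = 0" "qIm3 1 = 0"
  "qRe (x * y) = qRe x * qRe y - qIm1 x * qIm1 y - qIm2 x * qIm2 y - qIm3 x * qIm3 y"
  "qIm1 (x * y) = qRe x * qIm1 y + qIm1 x * qRe y + qIm2 x * qIm3 y - qIm3 x * qIm2 y"
  "qIm2 (x * y) = qRe x * qIm2 y - qIm1 x * qIm3 y + qIm2 x * qRe y + qIm3 x * qIm1 y"
  "qIm3 (x * y) = qRe x * qIm3 y + qIm1 x * qIm2 y - qIm2 x * qIm1 y + qIm3 x * qRe y"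
  by (simp_all add: one_quat_def times_quat_def)

instantiation quat :: real_inner
begin

definition inner_quat :: "quat \<Rightarrow> quat \<Rightarrow> real" where
  "inner_quat x y = qRe x * qRe y + qIm1 x * qIm1 y + qIm2 x * qIm2 y + qIm3 x * qIm3 y"
definition norm_quat :: "quat \<Rightarrow> real" where
  "norm_quat x = sqrt (inner x x)"
definition sgn_quat :: "quat \<Rightarrow> quat" where
  "sgn_quat x = x /\<^sub>R norm x"
definition dist_quat :: "quat \<Rightarrow> quat \<Rightarrow> real" where
  "dist_quat x y = norm (x - y)"
definition uniformity_quat :: "(quat \<times> quat) filter" where
  "uniformity_quat = (INF e\<in>{0 <..}. principal {(x, y). dist x y < e})"
definition open_quat :: "quat set \<Rightarrow> bool" where
  "open_quat U \<longleftrightarrow> (\<forall>x\<in>U. eventually (\<lambda>(x', y). x' = x \<longrightarrow> y \<in> U) uniformity)"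

instance
proof
  fix x y z :: quat and r :: real and U :: "quat set"
  show "inner x x = 0 \<longleftrightarrow> x = 0"
  proof
    assume "inner x x = 0"
    then have "(qRe x)\<^sup>2 + (qIm1 x)\<^sup>2 + (qIm2 x)\<^sup>2 + (qIm3 x)\<^sup>2 = 0"
      by (simp add: inner_quat_def power2_eq_square)
    then show "x = 0"
      by (simp add: quat_eq_iff add_nonneg_eq_0_iff)
  qed (simp add: inner_quat_def)
qed (auto simp: inner_quat_def norm_quat_def sgn_quat_def dist_quat_def uniformity_quat_def
      open_quat_def algebra_simps intro: add_nonneg_nonneg)

end

instantiation quat :: real_normed_div_algebra
begin

definition inverse_quat :: "quat \<Rightarrow> quat" where
  "inverse_quat x = Quat (qRe x) (- qIm1 x) (- qIm2 x) (- qIm3 x) /\<^sub>R (norm x)\<^sup>2"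
definition divide_quat :: "quat \<Rightarrow> quat \<Rightarrow> quat" where
  "divide_quat x y = x * inverse y"

instance
proof
  fix x y :: quat
  show "inverse (0::quat) = 0"
    by (simp add: inverse_quat_def quat_eq_iff)
  show "x div y = x * inverse y"
    by (simp add: divide_quat_def)
  have n: "(norm x)\<^sup>2 = qRe x * qRe x + qIm1 x * qIm1 x + qIm2 x * qIm2 x + qIm3 x * qIm3 x"
    by (simp add: power2_norm_eq_inner inner_quat_def)
  assume "x \<noteq> 0"
  then have n0: "qRe x * qRe x + qIm1 x * qIm1 x + qIm2 x * qIm2 x + qIm3 x * qIm3 x \<noteq> 0"
    using n by (metis norm_eq_zero zero_eq_power2)
  show "inverse x * x = 1" "x * inverse x = 1"
    using n0 unfolding quat_eq_iff
    by (simp_all add: inverse_quat_def n flip: distrib_left right_diff_distrib)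
next
  fix x y :: quat
  have "(norm (x * y))\<^sup>2 = (norm x * norm y)\<^sup>2"
    unfolding power_mult_distrib power2_norm_eq_inner
    by (simp add: inner_quat_def algebra_simps)
  then show "norm (x * y) = norm x * norm y"
    by (meson mult_nonneg_nonneg norm_ge_zero power2_eq_imp_eq)
qed

end

definition e1 :: quat where "e1 = Quat 0 1 0 0"
definition e2 :: quat where "e2 = Quat 0 0 1 0"
definition e3 :: quat where "e3 = Quat 0 0 0 1"

lemma e_mult_table:
  "e1 * e1 = -1" "e2 * e2 = -1" "e3 * e3 = -1"
  "e1 * e2 = e3" "e2 * e3 = e1" "e3 * e1 = e2"
  "e2 * e1 = - e3" "e3 * e2 = - e1" "e1 * e3 = - e2"
  by (simp_all add: quat_eq_iff e1_def e2_def e3_def)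

definition imag_units :: "quat set" where
  "imag_units = {J. J\<^sup>2 = -1}"

definition slice_emb :: "quat \<Rightarrow> complex \<Rightarrow> quat" where
  "slice_emb J z = of_real (Re z) + J * of_real (Im z)"

text \<open>The set \<open>U \<inter> \<complex>\<^sub>J\<close>, transported to the complex plane along
  \<open>u + iv \<mapsto> u + Jv\<close>.\<close>

definition slice :: "quat \<Rightarrow> quat set \<Rightarrow> complex set" where
  "slice J U = {z. slice_emb J z \<in> U}"

definition axially_symmetric :: "quat set \<Rightarrow> bool" where
  "axially_symmetric U \<longleftrightarrow>
     (\<forall>I\<in>imag_units. \<forall>J\<in>imag_units. \<forall>u v :: real.
        of_real u + I * of_real v \<in> U \<longrightarrow> of_real u + J * of_real v \<in> U)"

text \<open>The distance of two sets, with value \<open>\<infinity>\<close> if one of them is empty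
  (the library's \<^const>\<open>setdist\<close> is \<open>0\<close> in that case).\<close>

definition set_distance :: "'a::metric_space set \<Rightarrow> 'a set \<Rightarrow> ereal" where
  "set_distance A B = (INF x\<in>A. INF y\<in>B. ereal (dist x y))"

lemma set_distance_pos_iff:
  "set_distance A B > 0 \<longleftrightarrow> (\<exists>d>0. \<forall>x\<in>A. \<forall>y\<in>B. d \<le> dist x y)"
proof
  assume "set_distance A B > 0"
  then obtain d where d: "0 < ereal d" "ereal d < set_distance A B"
    using ereal_dense2 by blast
  have "d \<le> dist x y" if "x \<in> A" "y \<in> B" for x y
  proof -
    have "set_distance A B \<le> ereal (dist x y)"
      unfolding set_distance_def using that by (meson INF_lower2 order_refl)
    with d(2) show ?thesis
      by (metis ereal_less_eq(3) less_imp_le order_less_le_trans)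
  qed
  with d(1) show "\<exists>d>0. \<forall>x\<in>A. \<forall>y\<in>B. d \<le> dist x y" by auto
next
  assume "\<exists>d>0. \<forall>x\<in>A. \<forall>y\<in>B. d \<le> dist x y"
  then obtain d where "d > 0" "\<forall>x\<in>A. \<forall>y\<in>B. d \<le> dist x y" by blast
  then have "ereal d \<le> set_distance A B"
    unfolding set_distance_def by (auto intro!: INF_greatest)
  with \<open>d > 0\<close> show "set_distance A B > 0"
    by (metis ereal_less(2) order_less_le_trans)
qed


section \<open>Slice Cauchy domains and their oriented boundaries\<close>

definition Jordan_boundary :: "(real \<Rightarrow> complex) set \<Rightarrow> complex set \<Rightarrow> bool" where
  "Jordan_boundary \<Gamma> D \<longleftrightarrow>
     finite \<Gamma> \<and>
     (\<forall>\<gamma>\<in>\<Gamma>. valid_path \<gamma> \<and> simple_path \<gamma> \<and> pathfinish \<gamma> = pathstart \<gamma>) \<and>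
     pairwise (\<lambda>\<gamma> \<delta>. disjnt (path_image \<gamma>) (path_image \<delta>)) \<Gamma> \<and>
     frontier D = (\<Union>\<gamma>\<in>\<Gamma>. path_image \<gamma>)"

definition slice_Cauchy_domain :: "quat set \<Rightarrow> bool" where
  "slice_Cauchy_domain U \<longleftrightarrow>
     open U \<and> axially_symmetric U \<and>
     (\<forall>J\<in>imag_units. \<exists>\<Gamma>. Jordan_boundary \<Gamma> (slice J U))"

text \<open>The boundary curves of a bounded open set are positively oriented if the boundary cycle
  winds once around each point of the set and does not wind around the points outside its
  closure, i.e. the set lies to the left of each curve. This determines the orientation of
  every curve, because the total winding number jumps by one across it.\<close>

definition positively_oriented_boundary :: "(real \<Rightarrow> complex) set \<Rightarrow> complex set \<Rightarrow> bool" where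
  "positively_oriented_boundary \<Gamma> D \<longleftrightarrow>
     Jordan_boundary \<Gamma> D \<and>
     (\<forall>z\<in>D. (\<Sum>\<gamma>\<in>\<Gamma>. winding_number \<gamma> z) = 1) \<and>
     (\<forall>z. z \<notin> closure D \<longrightarrow> (\<Sum>\<gamma>\<in>\<Gamma>. winding_number \<gamma> z) = 0)"


section \<open>The quaternionic Banach module \<open>X\<^sub>\<real> \<otimes> \<H>\<close> and its operators\<close>

text \<open>The tuple \<open>(x\<^sub>0, x\<^sub>1, x\<^sub>2, x\<^sub>3)\<close> stands for
  \<open>x\<^sub>0 + x\<^sub>1 e\<^sub>1 + x\<^sub>2 e\<^sub>2 + x\<^sub>3 e\<^sub>3\<close>, where vectors of
  \<open>X\<^sub>\<real>\<close> commute with the units. The product norm is equivalent to every other usual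
  norm on \<open>X\<^sub>\<real> \<otimes> \<H>\<close>.\<close>

type_synonym 'a hmod = "'a \<times> 'a \<times> 'a \<times> 'a"

fun hmod_lmult :: "quat \<Rightarrow> 'a::real_vector hmod \<Rightarrow> 'a hmod" where
  "hmod_lmult a (x0, x1, x2, x3) =
    (qRe a *\<^sub>R x0 - qIm1 a *\<^sub>R x1 - qIm2 a *\<^sub>R x2 - qIm3 a *\<^sub>R x3,
     qRe a *\<^sub>R x1 + qIm1 a *\<^sub>R x0 + qIm2 a *\<^sub>R x3 - qIm3 a *\<^sub>R x2,
     qRe a *\<^sub>R x2 - qIm1 a *\<^sub>R x3 + qIm2 a *\<^sub>R x0 + qIm3 a *\<^sub>R x1,
     qRe a *\<^sub>R x3 + qIm1 a *\<^sub>R x2 - qIm2 a *\<^sub>R x1 + qIm3 a *\<^sub>R x0)"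

fun hmod_rmult :: "'a::real_vector hmod \<Rightarrow> quat \<Rightarrow> 'a hmod" where
  "hmod_rmult (x0, x1, x2, x3) a =
    (qRe a *\<^sub>R x0 - qIm1 a *\<^sub>R x1 - qIm2 a *\<^sub>R x2 - qIm3 a *\<^sub>R x3,
     qIm1 a *\<^sub>R x0 + qRe a *\<^sub>R x1 + qIm3 a *\<^sub>R x2 - qIm2 a *\<^sub>R x3,
     qIm2 a *\<^sub>R x0 - qIm3 a *\<^sub>R x1 + qRe a *\<^sub>R x2 + qIm1 a *\<^sub>R x3,
     qIm3 a *\<^sub>R x0 + qIm2 a *\<^sub>R x1 - qIm1 a *\<^sub>R x2 + qRe a *\<^sub>R x3)"

lemma hmod_mult_laws:
  "hmod_lmult 1 x = x" "hmod_rmult x 1 = x"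
  "hmod_lmult a (hmod_lmult b x) = hmod_lmult (a * b) x"
  "hmod_rmult (hmod_rmult x a) b = hmod_rmult x (a * b)"
  "hmod_lmult a (hmod_rmult x b) = hmod_rmult (hmod_lmult a x) b"
  by (cases x; simp add: algebra_simps)+

lemma hmod_proj_bounded_linear:
  "bounded_linear (\<lambda>x :: 'a::real_normed_vector hmod. fst x)"
  "bounded_linear (\<lambda>x :: 'a::real_normed_vector hmod. fst (snd x))"
  "bounded_linear (\<lambda>x :: 'a::real_normed_vector hmod. fst (snd (snd x)))"
  "bounded_linear (\<lambda>x :: 'a::real_normed_vector hmod. snd (snd (snd x)))"
  using bounded_linear_fst bounded_linear_snd
  by (auto intro!: bounded_linear_fst_comp bounded_linear_snd_comp bounded_linear_ident)

lemma hmod_inj_bounded_linear: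
  "bounded_linear (\<lambda>x :: 'a::real_normed_vector. (x, 0, 0, 0) :: 'a hmod)"
  by (intro bounded_linear_Pair bounded_linear_ident bounded_linear_zero)

text \<open>Operators on the module are bounded \<open>\<real>\<close>-linear maps; right linearity is imposed
  through the set \<open>\<B>(X)\<close>.\<close>

type_synonym 'a hop = "'a hmod \<Rightarrow>\<^sub>L 'a hmod"

definition BX :: "'a::real_normed_vector hop set" where
  "BX = {T. \<forall>x a. blinfun_apply T (hmod_rmult x a) = hmod_rmult (blinfun_apply T x) a}"

text \<open>The operator \<open>a\<I>\<close>, so that \<open>aT\<close> is \<open>qop a o\<^sub>L T\<close> and \<open>Ta\<close> is
  \<open>T o\<^sub>L qop a\<close>.\<close>

lift_definition qop :: "quat \<Rightarrow> 'a::real_normed_vector hop" is hmod_lmult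
proof -
  fix a :: quat
  have lin: "bounded_linear (\<lambda>x :: 'a hmod. p *\<^sub>R fst x + q *\<^sub>R fst (snd x)
      + r *\<^sub>R fst (snd (snd x)) + s *\<^sub>R snd (snd (snd x)))" for p q r s :: real
    by (rule bounded_linear_add[OF bounded_linear_add[OF bounded_linear_add]];
        rule bounded_linear_const_scaleR; rule hmod_proj_bounded_linear)
  have eq: "hmod_lmult a = (\<lambda>x :: 'a hmod.
    (qRe a *\<^sub>R fst x + (- qIm1 a) *\<^sub>R fst (snd x)
       + (- qIm2 a) *\<^sub>R fst (snd (snd x)) + (- qIm3 a) *\<^sub>R snd (snd (snd x)),
     qIm1 a *\<^sub>R fst x + qRe a *\<^sub>R fst (snd x)
       + (- qIm3 a) *\<^sub>R fst (snd (snd x)) + qIm2 a *\<^sub>R snd (snd (snd x)),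
     qIm2 a *\<^sub>R fst x + qIm3 a *\<^sub>R fst (snd x)
       + qRe a *\<^sub>R fst (snd (snd x)) + (- qIm1 a) *\<^sub>R snd (snd (snd x)),
     qIm3 a *\<^sub>R fst x + (- qIm2 a) *\<^sub>R fst (snd x)
       + qIm1 a *\<^sub>R fst (snd (snd x)) + qRe a *\<^sub>R snd (snd (snd x))))"
    by (auto simp: fun_eq_iff)
  show "bounded_linear (hmod_lmult a :: 'a hmod \<Rightarrow> 'a hmod)"
    unfolding eq by (rule bounded_linear_Pair[OF lin bounded_linear_Pair[OF lin
        bounded_linear_Pair[OF lin lin]]])
qed

text \<open>An operator on \<open>X\<^sub>\<real>\<close>, acting componentwise on \<open>X\<^sub>\<real> \<otimes> \<H>\<close>.\<close>

lift_definition real_op :: "('a::real_normed_vector \<Rightarrow>\<^sub>L 'a) \<Rightarrow> 'a hop" is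
  "\<lambda>A x. (A (fst x), A (fst (snd x)), A (fst (snd (snd x))), A (snd (snd (snd x))))"
  by (intro bounded_linear_Pair; rule bounded_linear_compose, assumption,
      rule hmod_proj_bounded_linear)

definition hop_of ::
  "('a::real_normed_vector \<Rightarrow>\<^sub>L 'a) \<Rightarrow> ('a \<Rightarrow>\<^sub>L 'a) \<Rightarrow> ('a \<Rightarrow>\<^sub>L 'a) \<Rightarrow> ('a \<Rightarrow>\<^sub>L 'a) \<Rightarrow> 'a hop" where
  "hop_of T0 T1 T2 T3 =
     real_op T0 + (real_op T1 o\<^sub>L qop e1) + (real_op T2 o\<^sub>L qop e2) + (real_op T3 o\<^sub>L qop e3)"

text \<open>The components \<open>T\<^sub>0, \<dots>, T\<^sub>3\<close> of \<open>T\<close> are read off from its values on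
  \<open>X\<^sub>\<real>\<close>; see \<open>hop_of_components\<close> below.\<close>

lift_definition comp0 :: "'a::real_normed_vector hop \<Rightarrow> ('a \<Rightarrow>\<^sub>L 'a)" is
  "\<lambda>T x. fst (T (x, 0, 0, 0))"
  by (rule bounded_linear_compose[OF hmod_proj_bounded_linear(1)
        bounded_linear_compose[OF _ hmod_inj_bounded_linear]])

lift_definition comp1 :: "'a::real_normed_vector hop \<Rightarrow> ('a \<Rightarrow>\<^sub>L 'a)" is
  "\<lambda>T x. fst (snd (T (x, 0, 0, 0)))"
  by (rule bounded_linear_compose[OF hmod_proj_bounded_linear(2)
        bounded_linear_compose[OF _ hmod_inj_bounded_linear]])

lift_definition comp2 :: "'a::real_normed_vector hop \<Rightarrow> ('a \<Rightarrow>\<^sub>L 'a)" is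
  "\<lambda>T x. fst (snd (snd (T (x, 0, 0, 0))))"
  by (rule bounded_linear_compose[OF hmod_proj_bounded_linear(3)
        bounded_linear_compose[OF _ hmod_inj_bounded_linear]])

lift_definition comp3 :: "'a::real_normed_vector hop \<Rightarrow> ('a \<Rightarrow>\<^sub>L 'a)" is
  "\<lambda>T x. snd (snd (snd (T (x, 0, 0, 0))))"
  by (rule bounded_linear_compose[OF hmod_proj_bounded_linear(4)
        bounded_linear_compose[OF _ hmod_inj_bounded_linear]])

lemma comp_hop_of [simp]:
  "comp0 (hop_of T0 T1 T2 T3) = T0" "comp1 (hop_of T0 T1 T2 T3) = T1"
  "comp2 (hop_of T0 T1 T2 T3) = T2" "comp3 (hop_of T0 T1 T2 T3) = T3"
  by (rule blinfun_eqI; simp add: hop_of_def comp0.rep_eq comp1.rep_eq comp2.rep_eq comp3.rep_eq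
      real_op.rep_eq qop.rep_eq blinfun.add_left blinfun.zero_right e1_def e2_def e3_def)+

lemma hop_of_in_BX: "hop_of T0 T1 T2 T3 \<in> BX"
  by (auto simp: BX_def hop_of_def real_op.rep_eq qop.rep_eq blinfun.bilinear_simps
      e1_def e2_def e3_def algebra_simps)

lemma hop_of_components:
  assumes "T \<in> BX"
  shows "T = hop_of (comp0 T) (comp1 T) (comp2 T) (comp3 T)"
proof (rule blinfun_eqI)
  fix x :: "'a hmod"
  obtain x0 x1 x2 x3 where x: "x = (x0, x1, x2, x3)" by (cases x)
  have *: "blinfun_apply T (hmod_rmult y a) = hmod_rmult (blinfun_apply T y) a" for y a
    using assms unfolding BX_def by blast
  have minus: "blinfun_apply T (- y, 0, 0, 0) = - blinfun_apply T (y, 0, 0, 0)" for y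
    by (simp flip: blinfun.minus_right)
  have "x = (x0, 0, 0, 0) + hmod_rmult (x1, 0, 0, 0) e1 + hmod_rmult (x2, 0, 0, 0) e2
      + hmod_rmult (x3, 0, 0, 0) e3"
    by (simp add: x e1_def e2_def e3_def)
  then have "blinfun_apply T x = blinfun_apply T (x0, 0, 0, 0)
      + hmod_rmult (blinfun_apply T (x1, 0, 0, 0)) e1
      + hmod_rmult (blinfun_apply T (x2, 0, 0, 0)) e2
      + hmod_rmult (blinfun_apply T (x3, 0, 0, 0)) e3"
    by (metis * blinfun.add_right)
  also have "\<dots> = blinfun_apply (hop_of (comp0 T) (comp1 T) (comp2 T) (comp3 T)) x"
    by (cases "blinfun_apply T (x0, 0, 0, 0)"; cases "blinfun_apply T (x1, 0, 0, 0)";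
        cases "blinfun_apply T (x2, 0, 0, 0)"; cases "blinfun_apply T (x3, 0, 0, 0)")
       (simp add: x minus hop_of_def comp0.rep_eq comp1.rep_eq comp2.rep_eq comp3.rep_eq
         real_op.rep_eq qop.rep_eq blinfun.bilinear_simps e1_def e2_def e3_def algebra_simps)
  finally show "blinfun_apply T x = \<dots>" .
qed

definition BC :: "'a::real_normed_vector hop set" where
  "BC = {hop_of T0 T1 T2 T3 | T0 T1 T2 T3.
           \<forall>A\<in>{T0, T1, T2, T3}. \<forall>B\<in>{T0, T1, T2, T3}. A o\<^sub>L B = B o\<^sub>L A}"

definition hop_conj :: "'a::real_normed_vector hop \<Rightarrow> 'a hop" where
  "hop_conj T = hop_of (comp0 T) (- comp1 T) (- comp2 T) (- comp3 T)"

definition BX_inverse_of :: "'a::real_normed_vector hop \<Rightarrow> 'a hop \<Rightarrow> bool" where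
  "BX_inverse_of A B \<longleftrightarrow> B \<in> BX \<and> A o\<^sub>L B = id_blinfun \<and> B o\<^sub>L A = id_blinfun"

definition BX_inv :: "'a::real_normed_vector hop \<Rightarrow> 'a hop" where
  "BX_inv A = (THE B. BX_inverse_of A B)"

lemma BX_inv_eqI: "BX_inverse_of A B \<Longrightarrow> BX_inv A = B"
  unfolding BX_inv_def BX_inverse_of_def
proof (rule the_equality)
  fix C
  assume B: "B \<in> BX \<and> A o\<^sub>L B = id_blinfun \<and> B o\<^sub>L A = id_blinfun"
    and C: "C \<in> BX \<and> A o\<^sub>L C = id_blinfun \<and> C o\<^sub>L A = id_blinfun"
  show "C = B"
  proof (rule blinfun_eqI)
    fix x
    have "blinfun_apply C (blinfun_apply (A o\<^sub>L B) x) = blinfun_apply (C o\<^sub>L A) (blinfun_apply B x)"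
      by simp
    with B C show "blinfun_apply C x = blinfun_apply B x"
      by (simp del: blinfun_apply_blinfun_compose)
  qed
qed


section \<open>Spectra\<close>

definition rho_S :: "'a::real_normed_vector hop \<Rightarrow> quat set" where
  "rho_S T = {s. \<exists>B. BX_inverse_of
      ((T o\<^sub>L T) - (2 * qRe s) *\<^sub>R T + (norm s)\<^sup>2 *\<^sub>R id_blinfun) B}"

definition sigma_S :: "'a::real_normed_vector hop \<Rightarrow> quat set" where
  "sigma_S T = - rho_S T"

text \<open>The spectrum of an operator on the real Banach space \<open>X\<^sub>\<real>\<close> is, as usual, the
  spectrum of its complexification on \<open>X\<^sub>\<real> + i X\<^sub>\<real>\<close>, here \<open>'a \<times> 'a\<close>. The
  inverse of a complex linear operator is complex linear, so that it suffices to ask for a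
  bounded \<open>\<real>\<close>-linear inverse.\<close>

lift_definition complexification ::
  "('a::real_normed_vector \<Rightarrow>\<^sub>L 'a) \<Rightarrow> (('a \<times> 'a) \<Rightarrow>\<^sub>L ('a \<times> 'a))" is
  "\<lambda>A z. (A (fst z), A (snd z))"
  by (intro bounded_linear_Pair; rule bounded_linear_compose, assumption,
      rule bounded_linear_fst bounded_linear_snd)

lift_definition complex_scalar :: "complex \<Rightarrow> (('a::real_normed_vector \<times> 'a) \<Rightarrow>\<^sub>L ('a \<times> 'a))" is
  "\<lambda>c z. (Re c *\<^sub>R fst z - Im c *\<^sub>R snd z, Re c *\<^sub>R snd z + Im c *\<^sub>R fst z)"
  by (intro bounded_linear_Pair bounded_linear_add bounded_linear_sub
      bounded_linear_const_scaleR bounded_linear_fst bounded_linear_snd)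

definition op_spectrum :: "('a::real_normed_vector \<Rightarrow>\<^sub>L 'a) \<Rightarrow> complex set" where
  "op_spectrum A = {c. \<not> (\<exists>B.
      (complexification A - complex_scalar c) o\<^sub>L B = id_blinfun \<and>
      B o\<^sub>L (complexification A - complex_scalar c) = id_blinfun)}"


section \<open>The resolvent operators and slice integrals\<close>

definition Q_c :: "quat \<Rightarrow> 'a::real_normed_vector hop \<Rightarrow> 'a hop" where
  "Q_c s T = qop (s\<^sup>2) - (qop s o\<^sub>L (T + hop_conj T)) + (T o\<^sub>L hop_conj T)"

definition F_L :: "quat \<Rightarrow> 'a::real_normed_vector hop \<Rightarrow> 'a hop" where
  "F_L s T = (-4) *\<^sub>R ((qop s - hop_conj T) o\<^sub>L (BX_inv (Q_c s T) o\<^sub>L BX_inv (Q_c s T)))"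

definition F_R :: "quat \<Rightarrow> 'a::real_normed_vector hop \<Rightarrow> 'a hop" where
  "F_R s T = (-4) *\<^sub>R ((BX_inv (Q_c s T) o\<^sub>L BX_inv (Q_c s T)) o\<^sub>L (qop s - hop_conj T))"

definition P2_L :: "quat \<Rightarrow> 'a::real_normed_vector hop \<Rightarrow> 'a hop" where
  "P2_L s T = - (F_L s T o\<^sub>L qop s) + (real_op (comp0 T) o\<^sub>L F_L s T)"

definition P2_R :: "quat \<Rightarrow> 'a::real_normed_vector hop \<Rightarrow> 'a hop" where
  "P2_R s T = - (qop s o\<^sub>L F_R s T) + (real_op (comp0 T) o\<^sub>L F_R s T)"

text \<open>The integral of \<open>f(s) ds\<^sub>J g(s)\<close>, \<open>ds\<^sub>J = ds(-J)\<close>, over the curves in \<open>\<Gamma>\<close>,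
  which are carried to \<open>\<complex>\<^sub>J\<close> by \<^const>\<open>slice_emb\<close>.\<close>

definition slice_integral ::
  "quat \<Rightarrow> (real \<Rightarrow> complex) set \<Rightarrow> (quat \<Rightarrow> 'a::real_normed_vector hop) \<Rightarrow> (quat \<Rightarrow> 'a hop) \<Rightarrow> 'a hop" where
  "slice_integral J \<Gamma> f g =
     (\<Sum>\<gamma>\<in>\<Gamma>. integral {0..1} (\<lambda>t.
        f (slice_emb J (\<gamma> t)) o\<^sub>L
        qop (slice_emb J (vector_derivative \<gamma> (at t within {0..1})) * (- J)) o\<^sub>L
        g (slice_emb J (\<gamma> t))))"

end

theory Submission
  imports Defs
begin

text \<open>
  On the slice \<open>\<complex>\<^sub>J\<close> the operator \<open>Q_c s T\<close> is the pencil \<open>Q z = W z * W z + M\<close>, where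
  \<open>W z = z - T\<^sub>0\<close> and \<open>M = T\<^sub>1\<^sup>2 + T\<^sub>2\<^sup>2\<close>, in a commutative Banach algebra over
  \<open>\<complex>\<^sub>J\<close>. Since \<open>W z / (Q z)\<^sup>2\<close> is minus half of the derivative of \<open>1 / Q z\<close>, integration by parts
  expresses both integrals of the theorem through \<open>c0\<close> and \<open>c1\<close>, the integrals of \<open>1 / Q z\<close> and
  \<open>W z / Q z\<close> divided by \<open>2\<pi>J\<close>. Multiplied by \<open>Q w\<close>, the Cauchy integral of \<open>1 / Q\<close> at \<open>w\<close> becomes
  affine in \<open>w\<close> with coefficients \<open>c0\<close> and \<open>c1\<close>. Liouville's theorem, applied to products and
  differences of such functions, therefore shows that \<open>c0\<close> and \<open>c1\<close> depend only on the winding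
  numbers around the spectrum, and that \<open>2 c1 c0 = c0\<close> and \<open>c1\<^sup>2 = c1 + M c0\<^sup>2\<close>. If \<open>c0 \<noteq> 0\<close>, its
  annihilator extends to an ideal modulo which \<open>T\<^sub>0, T\<^sub>1, T\<^sub>2\<close> are scalars, and these are real because
  the spectra are; then the two zeros of \<open>Q\<close> are conjugate, the residues of \<open>1 / Q\<close> cancel, and \<open>c0\<close>
  vanishes modulo the ideal, which contradicts \<open>(2 c1 - 1)\<^sup>2 = 1 + 4 M c0\<^sup>2\<close>. So \<open>c0 = 0\<close> and
  \<open>P = c1\<close> is idempotent. Comparing the cycle with its complex conjugate shows that \<open>c1\<close> commutes with
  all quaternions, hence with \<open>T\<close>.
\<close>

section \<open>The Hahn--Banach theorem\<close>

text \<open>Before \<open>c0 = 0\<close> is known, integration by parts gives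
  \<open>c1 + (1/2) c0 T\<close> for the normalized integral of \<open>P2_R\<close> and
  \<open>c1 + (1/2) T c0\<close> for that of \<open>P2_L\<close>, while the Riesz projection is
  \<open>c1 + c0 (T - T0)\<close>. In general these differ; \<open>c0 = 0\<close> makes them agree,
  and it also removes the conjugate of \<open>T\<close> from the integrals. The constant
  \<open>8 * pi\<close> is the 4 in \<open>F_L\<close> and \<open>F_R\<close> times the
  \<open>2 * pi\<close> of Cauchy's formula.

  The obstacle is that \<open>T\<close> need not commute with \<open>J\<close>, so it cannot itself
  enter a commutative algebra over the slice. Only the components do. The rest,
  \<open>V = T - T0\<close>, stays outside and is controlled by two facts:
  \<open>V * V = - M\<close>, and \<open>V\<close> anticommutes with \<open>e3\<close>, because
  \<open>T\<close> has no \<open>e3\<close> component. The second fact carries invertibility of the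
  polynomial that defines the S-spectrum from \<open>T\<close> to its conjugate, and the product of
  these two polynomials is the product of the pencil at conjugate points. This links the S-spectrum
  to the singular points of the pencil.\<close>

definition sublinear :: "('a::real_vector \<Rightarrow> real) \<Rightarrow> bool" where
  "sublinear p \<longleftrightarrow> (\<forall>x y. p (x + y) \<le> p x + p y) \<and> (\<forall>t\<ge>0. \<forall>x. p (t *\<^sub>R x) = t * p x)"

lemma sublinearD:
  assumes "sublinear p"
  shows "p (x + y) \<le> p x + p y" "t \<ge> 0 \<Longrightarrow> p (t *\<^sub>R x) = t * p x" "p 0 = 0" "- p (- x) \<le> p x"
proof -
  show a: "p (x + y) \<le> p x + p y" and b: "t \<ge> 0 \<Longrightarrow> p (t *\<^sub>R x) = t * p x" for x y t
    using assms unfolding sublinear_def by auto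
  show 0: "p 0 = 0" using b[of 0 0] by simp
  show "- p (- x) \<le> p x" using a[of x "- x"] 0 by simp
qed

text \<open>For sublinear \<open>q\<close> this is the largest sublinear functional below
  \<open>q\<close> whose value at \<open>- x\<close> is at most \<open>- q x\<close>.\<close>

definition directional_inf :: "('a::real_vector \<Rightarrow> real) \<Rightarrow> 'a \<Rightarrow> 'a \<Rightarrow> real" where
  "directional_inf q x y = (INF t\<in>{0..}. q (y + t *\<^sub>R x) - t * q x)"

lemma directional_inf:
  assumes q: "sublinear q"
  shows "sublinear (directional_inf q x)" "directional_inf q x y \<le> q y"
    "directional_inf q x (- x) \<le> - q x"
proof -
  note D = sublinearD[OF q]
  let ?r = "directional_inf q x"
  \<comment> \<open>As \<open>t * q x = q (t *\<^sub>R x)\<close>, subadditivity bounds all terms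
    below by \<open>- q (- y)\<close>, so the infimum is a genuine one.\<close>
  have bdd: "bdd_below ((\<lambda>t. q (y + t *\<^sub>R x) - t * q x) ` {0..})" for y
  proof (rule bdd_belowI2)
    fix t :: real assume "t \<in> {0..}"
    then show "- q (- y) \<le> q (y + t *\<^sub>R x) - t * q x"
      using D(1)[of "y + t *\<^sub>R x" "- y"] D(2)[of t x] by simp
  qed
  have low: "?r y \<le> q (y + t *\<^sub>R x) - t * q x" if "t \<ge> 0" for t y
    unfolding directional_inf_def using bdd that by (intro cINF_lower) auto
  have gr: "c \<le> ?r y" if "\<And>t. t \<ge> 0 \<Longrightarrow> c \<le> q (y + t *\<^sub>R x) - t * q x" for c y
    unfolding directional_inf_def using that by (intro cINF_greatest) auto
  show "?r y \<le> q y" using low[of 0 y] by simp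
  show "?r (- x) \<le> - q x" using low[of 1 "- x"] D(3) by simp
  have add: "?r (y + z) \<le> ?r y + ?r z" for y z
  proof -
    have "?r (y + z) - ?r z \<le> q (y + t *\<^sub>R x) - t * q x" if t: "t \<ge> 0" for t
    proof -
      have "?r (y + z) - (q (y + t *\<^sub>R x) - t * q x) \<le> q (z + s *\<^sub>R x) - s * q x" if "s \<ge> 0" for s
        using low[of "t + s" "y + z"] D(1)[of "y + t *\<^sub>R x" "z + s *\<^sub>R x"] t that
        by (simp add: algebra_simps)
      then show ?thesis using gr[of _ z] by fastforce
    qed
    then show ?thesis using gr[of _ y] by fastforce
  qed
  have le: "?r (c *\<^sub>R y) \<le> c * ?r y" if c: "c > 0" for c y
  proof -
    have "?r (c *\<^sub>R y) / c \<le> q (y + t *\<^sub>R x) - t * q x" if "t \<ge> 0" for t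
    proof -
      have "?r (c *\<^sub>R y) \<le> q (c *\<^sub>R (y + t *\<^sub>R x)) - c * t * q x"
        using low[of "c * t" "c *\<^sub>R y"] that c by (simp add: algebra_simps)
      also have "\<dots> = c * (q (y + t *\<^sub>R x) - t * q x)"
        using D(2)[of c "y + t *\<^sub>R x"] c by (simp add: algebra_simps)
      finally show ?thesis using c by (simp add: field_simps)
    qed
    then have "?r (c *\<^sub>R y) / c \<le> ?r y" by (rule gr)
    then show ?thesis using c by (simp add: field_simps)
  qed
  have "?r (c *\<^sub>R y) = c * ?r y" if c: "c \<ge> 0" for c y
  proof (cases "c = 0")
    case True
    have "?r 0 \<ge> 0" by (rule gr) (simp add: D(2))
    moreover have "?r 0 \<le> 0" using low[of 0 0] D(3) by simp
    ultimately show ?thesis using True by simp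
  next
    case False
    with c have "c > 0" by simp
    moreover from this have "c * ?r y \<le> ?r (c *\<^sub>R y)"
      using le[of "1 / c" "c *\<^sub>R y"] by (simp add: field_simps)
    ultimately show ?thesis using le[of c y] by (simp add: field_simps)
  qed
  with add show "sublinear ?r" unfolding sublinear_def by auto
qed

text \<open>A sublinear functional that is minimal below \<open>p\<close> is odd, because
  \<open>directional_inf q x\<close> cannot lie strictly below it, and an odd sublinear functional
  is linear. Zorn's lemma is used for the reversed order, with pointwise infima bounding the
  chains.\<close>

lemma exists_linear_below_sublinear:
  fixes p :: "'a::real_vector \<Rightarrow> real"
  assumes p: "sublinear p"
  shows "\<exists>q. linear q \<and> (\<forall>x. q x \<le> p x)"
proof -
  define A where "A = {q. sublinear q \<and> (\<forall>x. q x \<le> p x)}"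
  have "\<exists>m\<in>A. \<forall>a\<in>A. a \<le> m \<longrightarrow> a = m"
  proof (rule predicate_Zorn)
    show "partial_order_on A (relation_of (\<lambda>m a. a \<le> m) A)"
      by (auto simp: partial_order_on_def preorder_on_def refl_on_def trans_def antisym_def relation_of_def)
    fix C assume C: "C \<in> Chains (relation_of (\<lambda>m a. a \<le> m) A)"
    then have CA: "C \<subseteq> A" and ch: "\<And>a b. a \<in> C \<Longrightarrow> b \<in> C \<Longrightarrow> a \<le> b \<or> b \<le> a"
      by (auto simp: Chains_def relation_of_def)
    show "\<exists>u\<in>A. \<forall>a\<in>C. u \<le> a"
    proof (cases "C = {}")
      case True
      with p show ?thesis by (auto simp: A_def)
    next
      case ne: False
      have sub: "sublinear q" and qp: "q x \<le> p x" if "q \<in> C" for q x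
        using CA that by (auto simp: A_def)
      define u where "u = (\<lambda>x. INF q\<in>C. q x)"
      have bdd: "bdd_below ((\<lambda>q. q x) ` C)" for x
      proof (rule bdd_belowI2)
        fix q assume "q \<in> C"
        then show "- p (- x) \<le> q x"
          using sublinearD(4)[OF sub, of q x] qp[of q "- x"] by simp
      qed
      have low: "u x \<le> q x" if "q \<in> C" for q x
        unfolding u_def using bdd that by (intro cINF_lower) auto
      have gr: "c \<le> u x" if "\<And>q. q \<in> C \<Longrightarrow> c \<le> q x" for c x
        unfolding u_def using that ne by (intro cINF_greatest) auto
      have add: "u (x + y) \<le> u x + u y" for x y
      proof -
        have "u (x + y) \<le> a x + b y" if ab: "a \<in> C" "b \<in> C" for a b
        proof -
          \<comment> \<open>Infima of subadditive functions need not be subadditive; in a chain the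
            smaller of \<open>a\<close> and \<open>b\<close> serves both summands.\<close>
          obtain c where c: "c \<in> C" "c \<le> a" "c \<le> b" using ch[OF ab] ab by blast
          have "u (x + y) \<le> c x + c y"
            using low[OF c(1), of "x + y"] sublinearD(1)[OF sub[OF c(1)], of x y] by simp
          then show ?thesis using c(2,3) add_mono[of "c x" "a x" "c y" "b y"] by (simp add: le_fun_def)
        qed
        then have "u (x + y) - b y \<le> u x" if "b \<in> C" for b
          using gr[of "u (x + y) - b y" x] that by (simp add: diff_le_eq)
        then show ?thesis using gr[of "u (x + y) - u x" y] by (force simp: algebra_simps)
      qed
      have le: "u (c *\<^sub>R x) \<le> c * u x" if c: "c > 0" for c x
      proof -
        have "u (c *\<^sub>R x) / c \<le> u x"
        proof (rule gr)
          fix q assume q: "q \<in> C"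
          show "u (c *\<^sub>R x) / c \<le> q x"
            using low[OF q, of "c *\<^sub>R x"] sublinearD(2)[OF sub[OF q], of c x] c
            by (simp add: field_simps)
        qed
        then show ?thesis using c by (simp add: field_simps)
      qed
      have "u (c *\<^sub>R x) = c * u x" if c: "c \<ge> 0" for c x
      proof (cases "c = 0")
        case True
        have "u 0 = (INF q\<in>C. 0)"
          unfolding u_def by (rule INF_cong) (auto simp: sublinearD(3)[OF sub])
        also have "\<dots> = 0" using ne by simp
        finally show ?thesis using True by simp
      next
        case False
        with c have "c > 0" by simp
        moreover from this have "c * u x \<le> u (c *\<^sub>R x)"
          using le[of "1 / c" "c *\<^sub>R x"] by (simp add: field_simps)
        ultimately show ?thesis using le[of c x] by (simp add: field_simps)
      qed
      with add have "sublinear u" unfolding sublinear_def by auto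
      moreover have "u x \<le> p x" for x
        using ne low qp by (meson equals0I order_trans)
      ultimately show ?thesis using low by (auto simp: A_def le_fun_def intro!: bexI[of _ u])
    qed
  qed
  then obtain q where q: "sublinear q" "\<And>x. q x \<le> p x" and min: "\<And>a. a \<in> A \<Longrightarrow> a \<le> q \<Longrightarrow> a = q"
    by (auto simp: A_def)
  note D = sublinearD[OF q(1)]
  have neg: "q (- x) = - q x" for x
  proof -
    have "directional_inf q x \<in> A" "directional_inf q x \<le> q"
      using directional_inf(1,2)[OF q(1)] order_trans[OF directional_inf(2)[OF q(1)] q(2)]
      by (auto simp: A_def le_fun_def)
    then have "directional_inf q x = q" by (rule min)
    with directional_inf(3)[OF q(1), of x] D(4)[of "- x"] show ?thesis by simp
  qed
  have "linear q"
  proof (rule linearI)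
    show "q (x + y) = q x + q y" for x y
      using D(1)[of x y] D(1)[of "- x" "- y"] neg[of "x + y"] neg[of x] neg[of y] by simp
    show "q (r *\<^sub>R x) = r *\<^sub>R q x" for r x
    proof (cases "r \<ge> 0")
      case False
      then have "q (r *\<^sub>R x) = - q ((- r) *\<^sub>R x)" using neg[of "r *\<^sub>R x"] by simp
      with False show ?thesis using D(2)[of "- r" x] by simp
    qed (use D(2) in simp)
  qed
  with q(2) show ?thesis by blast
qed

text \<open>A linear functional below \<open>directional_inf p x0\<close> is at most
  \<open>- p x0\<close> at \<open>- x0\<close>; by linearity it is at least \<open>p x0\<close> at
  \<open>x0\<close>, so the majorant is attained there.\<close>

lemma Hahn_Banach_sublinear:
  fixes p :: "'a::real_vector \<Rightarrow> real"
  assumes p: "sublinear p"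
  obtains q where "linear q" "\<And>x. q x \<le> p x" "q x0 = p x0"
proof -
  obtain q where q: "linear q" "\<And>x. q x \<le> directional_inf p x0 x"
    using exists_linear_below_sublinear[OF directional_inf(1)[OF p]] by blast
  have le: "q x \<le> p x" for x using q(2) directional_inf(2)[OF p] order_trans by blast
  have "- q x0 \<le> - p x0"
    using q(2)[of "- x0"] directional_inf(3)[OF p, of x0] linear_neg[OF q(1)] by simp
  with le[of x0] have "q x0 = p x0" by simp
  with q(1) le that show ?thesis by blast
qed

lemma sublinear_infdist:
  fixes I :: "'a::real_normed_vector set"
  assumes I: "subspace I"
  shows "sublinear (\<lambda>x. infdist x I)"
proof -
  have ne: "I \<noteq> {}" using subspace_0[OF I] by auto
  have eq: "infdist x I = (INF a\<in>I. norm (x - a))" for x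
    using ne by (simp add: infdist_def dist_norm)
  have bdd: "bdd_below ((\<lambda>a. norm (x - a)) ` I)" for x by (rule bdd_belowI2[of _ 0]) simp
  have low: "infdist x I \<le> norm (x - a)" if "a \<in> I" for x a
    unfolding eq using bdd that by (intro cINF_lower) auto
  have gr: "c \<le> infdist x I" if "\<And>a. a \<in> I \<Longrightarrow> c \<le> norm (x - a)" for x c
    unfolding eq using that ne by (intro cINF_greatest) auto
  have "infdist (x + y) I \<le> infdist x I + infdist y I" for x y
  proof -
    have "infdist (x + y) I - norm (x - a) \<le> infdist y I" if a: "a \<in> I" for a
    proof (rule gr)
      fix b assume b: "b \<in> I"
      have "infdist (x + y) I \<le> norm ((x + y) - (a + b))"
        using low[OF subspace_add[OF I a b]] .
      also have "\<dots> \<le> norm (x - a) + norm (y - b)"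
        using norm_triangle_ineq[of "x - a" "y - b"] by (simp add: algebra_simps)
      finally show "infdist (x + y) I - norm (x - a) \<le> norm (y - b)" by simp
    qed
    then have "infdist (x + y) I - infdist y I \<le> infdist x I" 
      by (intro gr) (simp add: algebra_simps)
    then show ?thesis by simp
  qed
  moreover have le: "infdist (t *\<^sub>R x) I \<le> t * infdist x I" if t: "t > 0" for t x
  proof -
    have "infdist (t *\<^sub>R x) I / t \<le> infdist x I"
    proof (rule gr)
      fix a assume "a \<in> I"
      then have "infdist (t *\<^sub>R x) I \<le> norm (t *\<^sub>R x - t *\<^sub>R a)" by (intro low subspace_scale[OF I])
      also have "\<dots> = t * norm (x - a)" using t by (simp flip: scaleR_diff_right)
      finally show "infdist (t *\<^sub>R x) I / t \<le> norm (x - a)" using t by (simp add: field_simps)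
    qed
    then show ?thesis using t by (simp add: field_simps)
  qed
  moreover have "infdist (t *\<^sub>R x) I = t * infdist x I" if t: "t \<ge> 0" for t x
  proof (cases "t = 0")
    case True then show ?thesis using subspace_0[OF I] by simp
  next
    case False
    with t have "t > 0" by simp
    moreover from this have "t * infdist x I \<le> infdist (t *\<^sub>R x) I"
      using le[of "1 / t" "t *\<^sub>R x"] by (simp add: field_simps)
    ultimately show ?thesis using le[of t x] by (simp add: field_simps)
  qed
  ultimately show ?thesis unfolding sublinear_def by blast
qed

text \<open>With the distance to \<open>I\<close> as majorant, a functional is bounded by the norm
  and vanishes on \<open>I\<close>. At \<open>x0\<close> it is made to attain the distance, which is
  positive because \<open>I\<close> is closed.\<close>

lemma Hahn_Banach_separation:
  fixes I :: "'a::real_normed_vector set"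
  assumes I: "subspace I" and cl: "closed I" and x0: "x0 \<notin> I"
  obtains q :: "'a \<Rightarrow> real" where "bounded_linear q" "\<And>x. x \<in> I \<Longrightarrow> q x = 0" "q x0 \<noteq> 0"
proof -
  have 0: "0 \<in> I" using subspace_0[OF I] .
  obtain q where q: "linear q" "\<And>x. q x \<le> infdist x I" "q x0 = infdist x0 I"
    using Hahn_Banach_sublinear[OF sublinear_infdist[OF I]] by blast
  have b: "\<bar>q x\<bar> \<le> infdist x I" for x
  proof -
    have "infdist (- x) I \<le> infdist x I" for x
    proof -
      have "infdist (- x) I \<le> norm (x - a)" if "a \<in> I" for a
        using infdist_le[OF subspace_neg[OF I that], of "- x"]
        by (simp add: dist_norm norm_minus_commute)
      then show ?thesis
        using 0 unfolding infdist_def[of x] by (auto simp: dist_norm intro!: cINF_greatest)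
    qed
    then show ?thesis using q(2)[of x] q(2)[of "- x"] linear_neg[OF q(1), of x]
      by (smt (verit))
  qed
  have "bounded_linear q"
  proof (rule bounded_linear_intro[where K = 1])
    show "q (x + y) = q x + q y" "q (r *\<^sub>R x) = r *\<^sub>R q x" for x y r
      using q(1) by (auto simp: linear_add linear_scale)
    show "norm (q x) \<le> norm x * 1" for x
      using b[of x] infdist_le[OF 0, of x] by simp
  qed
  moreover have "q x = 0" if "x \<in> I" for x using b[of x] that by simp
  moreover have "q x0 \<noteq> 0"
    using q(3) in_closed_iff_infdist_zero[OF cl] 0 x0 by (metis empty_iff)
  ultimately show ?thesis using that by blast
qed

section \<open>Unital Banach algebras with a complex unit\<close>

text \<open>\<open>norm 1 = 1\<close> is not required, because the algebra of operators on a trivial space has to be an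
  instance.\<close>

class unital_banach_algebra = real_normed_algebra + banach + monoid_mult

section \<open>Invertible elements and the continuity of inversion\<close>

definition inverse_pair :: "'b::unital_banach_algebra \<Rightarrow> 'b \<Rightarrow> bool" where
  "inverse_pair x y \<longleftrightarrow> x * y = 1 \<and> y * x = 1"

lemma inverse_pair_unique:
  assumes "inverse_pair x y" "inverse_pair x z"
  shows "y = z"
proof -
  have "y = y * (x * z)" using assms(2) by (simp add: inverse_pair_def)
  also have "\<dots> = z" using assms(1) by (simp add: inverse_pair_def flip: mult.assoc)
  finally show ?thesis .
qed

lemma inverse_pair_commute:
  assumes xy: "inverse_pair x y" and s: "s * x = x * s"
  shows "s * y = y * s"
proof -
  have "s * y = y * (x * s) * y" using xy by (simp add: inverse_pair_def flip: mult.assoc)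
  also have "\<dots> = y * s * (x * y)" by (simp add: mult.assoc flip: s)
  also have "\<dots> = y * s" using xy by (simp add: inverse_pair_def)
  finally show ?thesis .
qed

lemma inverse_pair_mult:
  assumes "inverse_pair x y" "inverse_pair u v"
  shows "inverse_pair (x * u) (v * y)"
proof -
  have "x * u * (v * y) = x * (u * v) * y" "v * y * (x * u) = v * (y * x) * u"
    by (simp_all add: mult.assoc)
  then show ?thesis using assms by (simp add: inverse_pair_def)
qed

text \<open>In place of summing the Neumann series, the right inverse is the fixed point of the
  contraction \<open>y \<mapsto> 1 + x * y\<close> and the left inverse that of
  \<open>z \<mapsto> 1 + z * x\<close>; associativity identifies the two.\<close>

lemma inverse_pair_one_minus:
  fixes x :: "'b::unital_banach_algebra"
  assumes x: "norm x < 1"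
  shows "\<exists>y. inverse_pair (1 - x) y"
proof -
  have "\<exists>!y. 1 + x * y = y"
    by (rule banach_fix_type[of "norm x"])
       (use x in \<open>auto simp: dist_norm norm_mult_ineq simp flip: right_diff_distrib\<close>)
  then obtain y where y: "1 + x * y = y" by blast
  have "\<exists>!z. 1 + z * x = z"
    by (rule banach_fix_type[of "norm x"])
       (use x norm_mult_ineq[of _ x] in \<open>auto simp: dist_norm mult.commute[of "norm x"] simp flip: left_diff_distrib\<close>)
  then obtain z where z: "1 + z * x = z" by blast
  have a: "(1 - x) * y = 1" "z * (1 - x) = 1"
    using y z by (simp_all add: algebra_simps)
  then have "z = z * ((1 - x) * y)" by simp
  also have "\<dots> = y" using a(2) by (simp flip: mult.assoc)
  finally have "z = y" .
  with a show ?thesis by (auto simp: inverse_pair_def)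
qed

lemma inverse_pair_diff:
  fixes u0 :: "'b::unital_banach_algebra"
  assumes "inverse_pair u0 v0" "inverse_pair u v"
  shows "v - v0 = v * (u0 - u) * v0"
  using assms by (simp add: inverse_pair_def algebra_simps)

lemma norm_mult3_ineq:
  fixes a b c :: "'b::real_normed_algebra"
  shows "norm (a * b * c) \<le> norm a * norm b * norm c"
  using norm_mult_ineq[of "a * b" c] mult_right_mono[OF norm_mult_ineq[of a b], of "norm c"] by simp

text \<open>\<open>u\<close> is \<open>u0\<close> times \<open>1 - v0 * (u0 - u)\<close>, which lies
  within 1/2 of 1. The same margin lets half of \<open>norm v\<close> be absorbed in the identity
  for \<open>v - v0\<close>, whence the factor 2.\<close>

lemma inverse_pair_perturb:
  fixes u0 :: "'b::unital_banach_algebra"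
  assumes uv: "inverse_pair u0 v0" and d: "norm (u - u0) * norm v0 \<le> 1/2"
  shows "\<exists>v. inverse_pair u v" "inverse_pair u v \<Longrightarrow> norm v \<le> 2 * norm v0"
proof -
  have "norm (v0 * (u0 - u)) \<le> norm v0 * norm (u0 - u)" by (rule norm_mult_ineq)
  also have "\<dots> < 1" using d by (simp add: norm_minus_commute mult.commute)
  finally obtain w where w: "inverse_pair (1 - v0 * (u0 - u)) w" using inverse_pair_one_minus by blast
  have "u = u0 * (1 - v0 * (u0 - u))"
    using uv by (simp add: inverse_pair_def algebra_simps flip: mult.assoc)
  then show "\<exists>v. inverse_pair u v" using inverse_pair_mult[OF uv w] by auto
  assume v: "inverse_pair u v"
  have "v = v0 + v * (u0 - u) * v0" using inverse_pair_diff[OF uv v] by (metis add.commute diff_add_cancel)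
  then have "norm v \<le> norm v0 + norm (v * (u0 - u) * v0)" by (metis norm_triangle_ineq)
  also have "norm (v * (u0 - u) * v0) \<le> norm v * norm (u - u0) * norm v0"
    using norm_mult3_ineq[of v "u0 - u" v0] by (simp add: norm_minus_commute)
  also have "\<dots> \<le> norm v * (1/2)" using mult_left_mono[OF d, of "norm v"] by (simp add: mult.assoc)
  finally show "norm v \<le> 2 * norm v0" by simp
qed

lemma inverse_pair_tendsto:
  fixes u :: "'c \<Rightarrow> 'b::unital_banach_algebra"
  assumes u0: "inverse_pair u0 v0" and u: "(u \<longlongrightarrow> u0) F"
    and uv: "eventually (\<lambda>x. inverse_pair (u x) (v x)) F"
  shows "(v \<longlongrightarrow> v0) F"
proof -
  have lim: "((\<lambda>x. norm (u x - u0)) \<longlongrightarrow> 0) F" using u LIM_zero tendsto_norm_zero by blast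
  have "((\<lambda>x. norm (u x - u0) * norm v0) \<longlongrightarrow> 0) F"
    using tendsto_mult_left_zero[OF lim] .
  then have "eventually (\<lambda>x. norm (u x - u0) * norm v0 < 1/2) F"
    by (rule order_tendstoD) simp
  then have ev: "eventually (\<lambda>x. norm (v x - v0) \<le> norm (u x - u0) * (2 * norm v0 * norm v0)) F"
    using uv
  proof eventually_elim
    case (elim x)
    have b: "norm (v x) \<le> 2 * norm v0" using inverse_pair_perturb(2)[OF u0 _ elim(2)] elim(1) by simp
    have "norm (v x * (u0 - u x) * v0) \<le> norm (v x) * norm (u x - u0) * norm v0"
      using norm_mult3_ineq[of "v x" "u0 - u x" v0] by (simp add: norm_minus_commute)
    then have "norm (v x - v0) \<le> norm (v x) * norm (u x - u0) * norm v0"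
      by (simp add: inverse_pair_diff[OF u0 elim(2)])
    also have "\<dots> \<le> (2 * norm v0) * norm (u x - u0) * norm v0"
      using b by (intro mult_right_mono) auto
    finally show ?case by (simp add: algebra_simps)
  qed
  have "((\<lambda>x. norm (u x - u0) * (2 * norm v0 * norm v0)) \<longlongrightarrow> 0) F"
    using tendsto_mult_left_zero[OF lim] .
  from Lim_null_comparison[OF ev this] show ?thesis using LIM_zero_cancel by blast
qed

text \<open>Stated for an arbitrary filter because it is applied both at a point, to differentiate a
  resolvent, and at infinity, to see it decay.\<close>

lemma inverse_pair_near_one:
  fixes u :: "'c \<Rightarrow> 'b::unital_banach_algebra"
  assumes u: "(u \<longlongrightarrow> 1) F"
  shows "\<exists>v. eventually (\<lambda>x. inverse_pair (u x) (v x)) F \<and> (v \<longlongrightarrow> 1) F"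
proof -
  have one: "inverse_pair (1::'b) 1" by (simp add: inverse_pair_def)
  have "((\<lambda>x. norm (u x - 1) * norm (1::'b)) \<longlongrightarrow> 0) F"
    using u by (intro tendsto_mult_left_zero tendsto_norm_zero LIM_zero)
  then have "eventually (\<lambda>x. norm (u x - 1) * norm (1::'b) < 1/2) F"
    by (rule order_tendstoD) simp
  then have "eventually (\<lambda>x. \<exists>v. inverse_pair (u x) v) F"
    by eventually_elim (rule inverse_pair_perturb(1)[OF one], simp)
  then have "eventually (\<lambda>x. inverse_pair (u x) (SOME v. inverse_pair (u x) v)) F"
    by eventually_elim (rule someI_ex)
  with inverse_pair_tendsto[OF one u this] show ?thesis
    by (intro exI[of _ "\<lambda>x. SOME v. inverse_pair (u x) v"]) simp
qed

text \<open>Left multiplication by \<open>j\<close> makes the algebra a complex vector space. But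
  \<open>j\<close> need not be central: in the application the quaternions orthogonal to
  \<open>J\<close> anticommute with it. This is why commutation with \<open>j\<close> is assumed
  explicitly where scalars have to change sides.\<close>

locale complex_unit =
  fixes j :: "'b::unital_banach_algebra"
  assumes j_square: "j * j = - 1"
begin

definition cx :: "complex \<Rightarrow> 'b" where
  "cx z = Re z *\<^sub>R 1 + Im z *\<^sub>R j"

lemma cx_simps [simp]: "cx 0 = 0" "cx 1 = 1" "cx \<i> = j"
  by (simp_all add: cx_def)

lemma cx_add: "cx (z + w) = cx z + cx w"
  by (simp add: cx_def algebra_simps)

lemma cx_diff: "cx (z - w) = cx z - cx w"
  by (simp add: cx_def algebra_simps)

lemma cx_minus: "cx (- z) = - cx z"
  by (simp add: cx_def)

lemma cx_mult: "cx (z * w) = cx z * cx w"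
  by (simp add: cx_def algebra_simps j_square)

lemma cx_scaleR: "cx (r *\<^sub>R z) = r *\<^sub>R cx z"
  by (simp add: cx_def algebra_simps)

lemma cx_of_real: "cx (of_real r) = r *\<^sub>R 1"
  by (simp add: cx_def)

lemma bounded_linear_cx: "bounded_linear cx"
proof (rule bounded_linear_intro[where K = "norm (1::'b) + norm j"])
  fix z
  have "norm (cx z) \<le> \<bar>Re z\<bar> * norm (1::'b) + \<bar>Im z\<bar> * norm j"
    unfolding cx_def by (metis norm_scaleR norm_triangle_ineq)
  also have "\<dots> \<le> norm z * norm (1::'b) + norm z * norm j"
    by (intro add_mono mult_right_mono abs_Re_le_cmod abs_Im_le_cmod) auto
  finally show "norm (cx z) \<le> norm z * (norm (1::'b) + norm j)" by (simp add: algebra_simps)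
qed (auto simp: cx_add cx_scaleR)

lemma cx_commute: "x * j = j * x \<Longrightarrow> x * cx z = cx z * x"
  by (simp add: cx_def algebra_simps)

lemma cx_inverse: "z \<noteq> 0 \<Longrightarrow> inverse_pair (cx z) (cx (inverse z))"
  by (simp add: inverse_pair_def flip: cx_mult)

lemmas cx_continuous_on [continuous_intros] = bounded_linear.continuous_on[OF bounded_linear_cx]
lemmas cx_tendsto [tendsto_intros] = bounded_linear.tendsto[OF bounded_linear_cx]

section \<open>Complex linear functionals and separation\<close>

definition cfun :: "('b \<Rightarrow> complex) \<Rightarrow> bool" where
  "cfun \<phi> \<longleftrightarrow> bounded_linear \<phi> \<and> (\<forall>x. \<phi> (j * x) = \<i> * \<phi> x)"

lemma cfunD:
  assumes "cfun \<phi>"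
  shows "\<phi> (x + y) = \<phi> x + \<phi> y" "\<phi> (x - y) = \<phi> x - \<phi> y" "\<phi> (- x) = - \<phi> x" "\<phi> 0 = 0"
    "\<phi> (r *\<^sub>R x) = r *\<^sub>R \<phi> x" "\<phi> (cx z * x) = z * \<phi> x" "\<phi> (cx z) = z * \<phi> 1"
proof -
  interpret bounded_linear \<phi> using assms by (simp add: cfun_def)
  show "\<phi> (x + y) = \<phi> x + \<phi> y" "\<phi> (x - y) = \<phi> x - \<phi> y" "\<phi> (- x) = - \<phi> x" "\<phi> 0 = 0"
    "\<phi> (r *\<^sub>R x) = r *\<^sub>R \<phi> x" using diff[of 0 x] by (simp_all add: add diff zero scaleR)
  have eq: "\<phi> (cx z * x) = z * \<phi> x" for z x
  proof -
    have "\<phi> (cx z * x) = Re z *\<^sub>R \<phi> x + Im z *\<^sub>R (\<i> * \<phi> x)"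
      using assms by (simp add: cx_def cfun_def algebra_simps add scaleR)
    also have "\<dots> = (of_real (Re z) + \<i> * of_real (Im z)) * \<phi> x"
      by (simp add: scaleR_conv_of_real algebra_simps)
    also have "\<dots> = z * \<phi> x" using complex_eq[of z] by simp
    finally show ?thesis .
  qed
  from eq[of z x] eq[of z 1] show "\<phi> (cx z * x) = z * \<phi> x" "\<phi> (cx z) = z * \<phi> 1" by simp_all
qed

lemma cfun_bounded_linear: "cfun \<phi> \<Longrightarrow> bounded_linear \<phi>"
  by (simp add: cfun_def)

lemma cfun_mult_right:
  assumes "cfun \<phi>"
  shows "cfun (\<lambda>x. \<phi> (x * y))"
proof -
  have "bounded_linear (\<lambda>x. \<phi> (x * y))"
    using cfun_bounded_linear[OF assms] bounded_linear_mult_left by (rule bounded_linear_compose)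
  then show ?thesis using assms by (simp add: cfun_def mult.assoc)
qed

lemma cfun_mult_left:
  assumes "cfun \<phi>" "y * j = j * y"
  shows "cfun (\<lambda>x. \<phi> (y * x))"
proof -
  have "bounded_linear (\<lambda>x. \<phi> (y * x))"
    using cfun_bounded_linear[OF assms(1)] bounded_linear_mult_right by (rule bounded_linear_compose)
  moreover have "\<phi> (y * (j * x)) = \<i> * \<phi> (y * x)" for x
    using assms by (simp add: cfun_def flip: mult.assoc) (simp add: mult.assoc)
  ultimately show ?thesis by (simp add: cfun_def)
qed

text \<open>A real functional \<open>q\<close> is the real part of the complex linear functional
  \<open>q x - \<i> * q (j * x)\<close>; it vanishes on \<open>I\<close> because \<open>I\<close> is
  stable under \<open>j\<close>.\<close>

lemma cfun_separation:
  assumes I: "subspace I" "closed I" "\<And>x. x \<in> I \<Longrightarrow> j * x \<in> I" and x0: "x0 \<notin> I"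
  obtains \<phi> where "cfun \<phi>" "\<And>x. x \<in> I \<Longrightarrow> \<phi> x = 0" "\<phi> x0 \<noteq> 0"
proof -
  obtain q :: "'b \<Rightarrow> real" where q: "bounded_linear q" "\<And>x. x \<in> I \<Longrightarrow> q x = 0" "q x0 \<noteq> 0"
    using Hahn_Banach_separation[OF I(1,2) x0] by blast
  interpret q: bounded_linear q by (rule q(1))
  define \<phi> where "\<phi> x = of_real (q x) - \<i> * of_real (q (j * x))" for x
  have "bounded_linear (\<lambda>x. q (j * x))"
    using q(1) bounded_linear_mult_right by (rule bounded_linear_compose)
  then have "bounded_linear \<phi>"
    unfolding \<phi>_def
    by (intro bounded_linear_sub bounded_linear_const_mult bounded_linear_compose[OF bounded_linear_of_real] q(1))
  moreover have "\<phi> (j * x) = \<i> * \<phi> x" for x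
  proof -
    have "j * (j * x) = - x" by (simp add: j_square flip: mult.assoc)
    then show ?thesis using q.diff[of 0 x] by (simp add: \<phi>_def q.zero algebra_simps)
  qed
  ultimately have "cfun \<phi>" by (simp add: cfun_def)
  moreover have "\<phi> x = 0" if "x \<in> I" for x using that I(3) q(2) by (simp add: \<phi>_def)
  moreover have "\<phi> x0 \<noteq> 0"
  proof
    assume "\<phi> x0 = 0"
    then have "Re (\<phi> x0) = 0" by simp
    with q(3) show False by (simp add: \<phi>_def)
  qed
  ultimately show ?thesis using that by blast
qed

text \<open>Reduces identities in the algebra, in particular those between integrals, to scalar
  functions, to which Cauchy's and Liouville's theorems apply.\<close>

lemma cfun_eqI:
  assumes "\<And>\<phi>. cfun \<phi> \<Longrightarrow> \<phi> x = \<phi> y"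
  shows "x = y"
proof (rule ccontr)
  assume "x \<noteq> y"
  then have "x - y \<notin> {0}" by simp
  moreover have "subspace {0::'b}" "closed {0::'b}" by auto
  moreover have "\<And>x. x \<in> {0::'b} \<Longrightarrow> j * x \<in> {0}" by simp
  ultimately obtain \<phi> where "cfun \<phi>" "\<phi> (x - y) \<noteq> 0" by (metis cfun_separation)
  then show False using assms[of \<phi>] by (simp add: cfunD)
qed

section \<open>Algebra-valued holomorphic functions and local primitives\<close>

definition cderiv_on :: "complex set \<Rightarrow> (complex \<Rightarrow> 'b) \<Rightarrow> (complex \<Rightarrow> 'b) \<Rightarrow> bool" where
  "cderiv_on S f f' \<longleftrightarrow>
     continuous_on S f' \<and> (\<forall>z\<in>S. (f has_derivative (\<lambda>h. cx h * f' z)) (at z))"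

lemma cderiv_on_continuous_on: "cderiv_on S f f' \<Longrightarrow> continuous_on S f"
  unfolding cderiv_on_def
  by (intro continuous_at_imp_continuous_on) (auto dest: has_derivative_continuous)

lemma cderiv_on_subset: "cderiv_on S f f' \<Longrightarrow> A \<subseteq> S \<Longrightarrow> cderiv_on A f f'"
  unfolding cderiv_on_def by (auto intro: continuous_on_subset)

lemma cderiv_on_const: "cderiv_on S (\<lambda>z. c) (\<lambda>z. 0)"
  by (simp add: cderiv_on_def)

lemma cderiv_on_cx: "cderiv_on S cx (\<lambda>z. 1)"
  using bounded_linear_imp_has_derivative[OF bounded_linear_cx] by (simp add: cderiv_on_def)

lemma cderiv_on_diff:
  "cderiv_on S f f' \<Longrightarrow> cderiv_on S g g' \<Longrightarrow> cderiv_on S (\<lambda>z. f z - g z) (\<lambda>z. f' z - g' z)"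
  by (auto simp: cderiv_on_def right_diff_distrib intro!: continuous_intros has_derivative_diff)

text \<open>The increment \<open>cx h\<close> stands on the left of a derivative, so in the term
  with \<open>g'\<close> it has to move past \<open>f z\<close>.\<close>

lemma cderiv_on_mult:
  assumes f: "cderiv_on S f f'" and g: "cderiv_on S g g'" and j: "\<And>z. z \<in> S \<Longrightarrow> f z * j = j * f z"
  shows "cderiv_on S (\<lambda>z. f z * g z) (\<lambda>z. f z * g' z + f' z * g z)"
proof -
  have "((\<lambda>z. f z * g z) has_derivative (\<lambda>h. cx h * (f z * g' z + f' z * g z))) (at z)" if "z \<in> S" for z
  proof -
    have "((\<lambda>z. f z * g z) has_derivative (\<lambda>h. f z * (cx h * g' z) + cx h * f' z * g z)) (at z)"
      using f g that by (intro has_derivative_mult) (auto simp: cderiv_on_def)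
    moreover have "(\<lambda>h. f z * (cx h * g' z) + cx h * f' z * g z) = (\<lambda>h. cx h * (f z * g' z + f' z * g z))"
    proof
      fix h
      have "f z * (cx h * g' z) = cx h * (f z * g' z)"
        using cx_commute[OF j[OF that], of h] by (simp flip: mult.assoc)
      then show "f z * (cx h * g' z) + cx h * f' z * g z = cx h * (f z * g' z + f' z * g z)"
        by (simp add: distrib_left mult.assoc)
    qed
    ultimately show ?thesis by simp
  qed
  moreover have "continuous_on S (\<lambda>z. f z * g' z + f' z * g z)"
    using cderiv_on_continuous_on[OF f] cderiv_on_continuous_on[OF g] f g
    by (auto simp: cderiv_on_def intro!: continuous_intros)
  ultimately show ?thesis by (simp add: cderiv_on_def)
qed

lemma cfun_cderiv_on:
  assumes \<phi>: "cfun \<phi>" and f: "cderiv_on S f f'" "z \<in> S"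
  shows "((\<lambda>z. \<phi> (f z)) has_field_derivative \<phi> (f' z)) (at z)"
proof -
  have "((\<lambda>z. \<phi> (f z)) has_derivative (\<lambda>h. \<phi> (cx h * f' z))) (at z)"
    using f by (intro bounded_linear.has_derivative[OF cfun_bounded_linear[OF \<phi>]]) (simp add: cderiv_on_def)
  moreover have "(\<lambda>h. \<phi> (cx h * f' z)) = (*) (\<phi> (f' z))"
    by (simp add: cfunD(6)[OF \<phi>] fun_eq_iff)
  ultimately show ?thesis by (simp add: has_field_derivative_def)
qed

lemma cfun_holomorphic_on:
  "cfun \<phi> \<Longrightarrow> cderiv_on S f f' \<Longrightarrow> open S \<Longrightarrow> (\<lambda>z. \<phi> (f z)) holomorphic_on S"
  using cfun_cderiv_on by (fastforce simp: holomorphic_on_open)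

text \<open>The primitive is the integral of \<open>f\<close> along the segment from the centre.
  Differentiating under the integral sign gives an integrand that is a total derivative in the
  segment parameter \<open>t\<close>. Continuity of \<open>f'\<close>, part of
  \<open>cderiv_on\<close>, is what the Leibniz rule asks for.\<close>

lemma local_primitive:
  assumes f: "cderiv_on (ball c r) f f'"
  shows "\<exists>F. \<forall>z\<in>ball c r. (F has_derivative (\<lambda>h. cx h * f z)) (at z)"
proof -
  \<comment> \<open>The Leibniz rule wants the derivative as a continuous family of bounded linear
    operators; \<open>L y\<close> is the operator \<open>h \<mapsto> cx h * y\<close> in that
    form.\<close>
  define B where "B = Blinfun cx"
  have B: "blinfun_apply B = cx" unfolding B_def by (rule bounded_linear_Blinfun_apply[OF bounded_linear_cx])
  define L where "L y = blinfun_mult_left y o\<^sub>L B" for y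
  have L: "blinfun_apply (L y) h = cx h * y" for y h by (simp add: L_def B)
  define \<gamma> where "\<gamma> = (\<lambda>(z, t). c + t *\<^sub>R (z - c))"
  define G where "G z t = cx (z - c) * f (\<gamma> (z, t))" for z t
  \<comment> \<open>\<open>cx h * H z t\<close> is the derivative of \<open>G\<close> with respect
    to \<open>z\<close> in direction \<open>h\<close>, and \<open>H z t\<close> is also the
    derivative of \<open>t *\<^sub>R f (\<gamma> (z, t))\<close> with respect to \<open>t\<close>;
    the integral over \<open>t\<close> is therefore \<open>cx h * f z\<close>.\<close>
  define H where "H z t = f (\<gamma> (z, t)) + t *\<^sub>R (cx (z - c) * f' (\<gamma> (z, t)))" for z and t :: real
  define F where "F z = integral (cbox 0 1) (G z)" for z
  have \<gamma>: "\<gamma> (z, t) \<in> ball c r" if "z \<in> ball c r" "t \<in> cbox 0 1" for z t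
  proof -
    have "t * dist c z \<le> 1 * dist c z" using that by (intro mult_right_mono) auto
    with that show ?thesis by (auto simp: \<gamma>_def dist_norm norm_minus_commute)
  qed
  have cont\<gamma>: "continuous_on (ball c r \<times> cbox 0 1) \<gamma>"
    unfolding \<gamma>_def case_prod_beta by (intro continuous_intros)
  have img: "\<gamma> ` (ball c r \<times> cbox 0 1) \<subseteq> ball c r" using \<gamma> by auto
  have contf: "continuous_on (ball c r \<times> cbox 0 1) (\<lambda>x. f (\<gamma> x))"
    using continuous_on_compose2[OF cderiv_on_continuous_on[OF f] cont\<gamma> img] .
  have contf': "continuous_on (ball c r \<times> cbox 0 1) (\<lambda>x. f' (\<gamma> x))"
    using f continuous_on_compose2[OF _ cont\<gamma> img] by (auto simp: cderiv_on_def)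
  have contH: "continuous_on (ball c r \<times> cbox 0 1) (\<lambda>(z, t). L (H z t))"
    unfolding L_def H_def case_prod_beta prod.collapse
    by (intro continuous_intros contf contf' bounded_linear.continuous_on[OF bounded_linear_blinfun_mult_left])
  have d\<gamma>: "((\<lambda>z. \<gamma> (z, t)) has_derivative (\<lambda>h. t *\<^sub>R h)) (at z)" for z t
    unfolding \<gamma>_def by (auto intro!: derivative_eq_intros)
  have dG: "((\<lambda>z. G z t) has_derivative blinfun_apply (L (H z t))) (at z within ball c r)"
    if z: "z \<in> ball c r" "t \<in> cbox 0 1" for z t
  proof -
    have "(f has_derivative (\<lambda>h. cx h * f' (\<gamma> (z, t)))) (at (\<gamma> (z, t)))"
      using f \<gamma>[OF z] by (simp add: cderiv_on_def)
    from has_derivative_compose[OF d\<gamma> this]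
    have 1: "((\<lambda>z. f (\<gamma> (z, t))) has_derivative (\<lambda>h. cx (t *\<^sub>R h) * f' (\<gamma> (z, t)))) (at z)" .
    have 2: "((\<lambda>z. cx (z - c)) has_derivative cx) (at z)"
      by (rule bounded_linear.has_derivative[OF bounded_linear_cx]) (auto intro!: derivative_eq_intros)
    have "((\<lambda>z. G z t) has_derivative
        (\<lambda>h. cx (z - c) * (cx (t *\<^sub>R h) * f' (\<gamma> (z, t))) + cx h * f (\<gamma> (z, t)))) (at z)"
      unfolding G_def by (rule has_derivative_mult[OF 2 1])
    moreover have "cx (z - c) * (cx (t *\<^sub>R h) * f' (\<gamma> (z, t))) = cx h * (t *\<^sub>R (cx (z - c) * f' (\<gamma> (z, t))))" for h
      by (simp add: cx_scaleR flip: mult.assoc cx_mult) (simp add: mult.commute)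
    ultimately have "((\<lambda>z. G z t) has_derivative blinfun_apply (L (H z t))) (at z)"
      by (simp add: L[abs_def] H_def distrib_left add.commute)
    then show ?thesis by (rule has_derivative_at_withinI)
  qed
  have intG: "G z integrable_on cbox 0 1" if "z \<in> ball c r" for z
  proof (rule integrable_continuous)
    have "continuous_on (cbox 0 1) (\<lambda>t. f (\<gamma> (z, t)))"
      by (rule continuous_on_compose2[OF contf]) (use that in \<open>auto intro!: continuous_intros\<close>)
    then show "continuous_on (cbox 0 1) (G z)"
      unfolding G_def by (intro continuous_intros)
  qed
  have "(F has_derivative (\<lambda>h. cx h * f z)) (at z)" if z: "z \<in> ball c r" for z
  proof -
    have contt: "continuous_on (cbox 0 1) (\<lambda>t. L (H z t))"
    proof -
      have "continuous_on (cbox 0 1) (\<lambda>t. (z, t :: real))" by (intro continuous_intros)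
      moreover have "(\<lambda>t. (z, t)) ` cbox 0 1 \<subseteq> ball c r \<times> cbox 0 1" using z by auto
      ultimately show ?thesis using continuous_on_compose2[OF contH] by fastforce
    qed
    have "(F has_derivative integral (cbox 0 1) (\<lambda>t. L (H z t))) (at z within ball c r)"
      unfolding F_def by (rule leibniz_rule[OF dG intG contH z convex_ball])
    moreover have "blinfun_apply (integral (cbox 0 1) (\<lambda>t. L (H z t))) = (\<lambda>h. cx h * f z)"
    proof
      fix h
      have "blinfun_apply (integral (cbox 0 1) (\<lambda>t. L (H z t))) h = integral (cbox 0 1) (\<lambda>t. blinfun_apply (L (H z t)) h)"
        using blinfun_apply_integral[OF integrable_continuous[OF contt]] .
      also have "\<dots> = cx h * f z"
      proof -
        have "((\<lambda>t. blinfun_apply (L (H z t)) h) has_integral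
            (cx h * (1 *\<^sub>R f (\<gamma> (z, 1))) - cx h * (0 *\<^sub>R f (\<gamma> (z, 0))))) {0..1}"
        proof (rule fundamental_theorem_of_calculus)
          fix t :: real assume t: "t \<in> {0..1}"
          have d1: "((\<lambda>t. \<gamma> (z, t)) has_derivative (\<lambda>s. s *\<^sub>R (z - c))) (at t)"
            unfolding \<gamma>_def by (auto intro!: derivative_eq_intros)
          have "(f has_derivative (\<lambda>h. cx h * f' (\<gamma> (z, t)))) (at (\<gamma> (z, t)))"
            using f \<gamma>[OF z, of t] t by (simp add: cderiv_on_def)
          from has_derivative_compose[OF d1 this]
          have "((\<lambda>t. f (\<gamma> (z, t))) has_vector_derivative cx (z - c) * f' (\<gamma> (z, t))) (at t)"
            by (simp add: has_vector_derivative_def cx_scaleR)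
          then have "((\<lambda>t. t *\<^sub>R f (\<gamma> (z, t))) has_vector_derivative
              t *\<^sub>R (cx (z - c) * f' (\<gamma> (z, t))) + 1 *\<^sub>R f (\<gamma> (z, t))) (at t)"
            by (intro has_vector_derivative_scaleR) (auto intro!: derivative_eq_intros)
          then have "((\<lambda>t. cx h * (t *\<^sub>R f (\<gamma> (z, t)))) has_vector_derivative
              cx h * H z t) (at t)"
            by (intro has_vector_derivative_mult_right) (simp add: H_def add.commute)
          then show "((\<lambda>t. cx h * (t *\<^sub>R f (\<gamma> (z, t)))) has_vector_derivative
              blinfun_apply (L (H z t)) h) (at t within {0..1})"
            by (simp add: L has_vector_derivative_at_within)
        qed simp
        then show ?thesis by (simp add: integral_unique \<gamma>_def)
      qed
      finally show "blinfun_apply (integral (cbox 0 1) (\<lambda>t. L (H z t))) h = cx h * f z" .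
    qed
    ultimately show ?thesis
      using z by (simp add: at_within_open[of z "ball c r"])
  qed
  then show ?thesis by blast
qed

section \<open>Algebra-valued path integrals\<close>

definition path_integral :: "(real \<Rightarrow> complex) \<Rightarrow> (complex \<Rightarrow> 'b) \<Rightarrow> 'b" where
  "path_integral \<gamma> f = integral {0..1} (\<lambda>t. cx (vector_derivative \<gamma> (at t within {0..1})) * f (\<gamma> t))"

definition path_integrable :: "(real \<Rightarrow> complex) \<Rightarrow> (complex \<Rightarrow> 'b) \<Rightarrow> bool" where
  "path_integrable \<gamma> f \<longleftrightarrow> (\<lambda>t. cx (vector_derivative \<gamma> (at t within {0..1})) * f (\<gamma> t)) integrable_on {0..1}"

text \<open>The derivative of a valid path need not be bounded near its finitely many exceptional
  points, so that continuity of the integrand would not suffice.\<close>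

lemma path_integrable_cderiv_on:
  assumes S: "open S" and f: "cderiv_on S f f'" and \<gamma>: "valid_path \<gamma>" "path_image \<gamma> \<subseteq> S"
  shows "path_integrable \<gamma> f"
proof -
  let ?g = "\<lambda>t. cx (vector_derivative \<gamma> (at t within {0..1})) * f (\<gamma> t)"
  have cont: "continuous_on {0..1} \<gamma>" using \<gamma>(1) valid_path_imp_path path_def by blast
  obtain K where K: "finite K" "\<And>t. t \<in> {0..1} - K \<Longrightarrow> \<gamma> differentiable (at t)"
    using \<gamma>(1) by (auto simp: valid_path_def piecewise_C1_differentiable_on_def C1_differentiable_on_eq)
  \<comment> \<open>On a short parameter interval the integrand is, off the finite set
    \<open>K\<close>, the derivative of \<open>F \<circ> \<gamma>\<close> for a local primitive
    \<open>F\<close>. The fundamental theorem of calculus then yields integrability from the mere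
    continuity of \<open>F \<circ> \<gamma>\<close>.\<close>
  have "?g integrable_on cbox 0 1"
  proof (rule integrable_on_little_subintervals, intro ballI)
    fix t :: real assume "t \<in> cbox 0 1"
    then have t: "t \<in> {0..1}" by simp
    then have "\<gamma> t \<in> S" using \<gamma>(2) by (auto simp: path_image_def)
    then obtain r where r: "r > 0" "ball (\<gamma> t) r \<subseteq> S" using S open_contains_ball by blast
    obtain F where F: "\<And>z. z \<in> ball (\<gamma> t) r \<Longrightarrow> (F has_derivative (\<lambda>h. cx h * f z)) (at z)"
      using local_primitive[OF cderiv_on_subset[OF f r(2)]] by blast
    obtain d where d: "d > 0" "\<And>s. s \<in> {0..1} \<Longrightarrow> dist s t < d \<Longrightarrow> dist (\<gamma> s) (\<gamma> t) < r"
      using cont t r(1) unfolding continuous_on_iff by blast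
    show "\<exists>d>0. \<forall>u v. t \<in> cbox u v \<and> cbox u v \<subseteq> ball t d \<and> cbox u v \<subseteq> cbox 0 1 \<longrightarrow> ?g integrable_on cbox u v"
    proof (intro exI[of _ d] conjI d(1) allI impI)
      fix u v assume uv: "t \<in> cbox u v \<and> cbox u v \<subseteq> ball t d \<and> cbox u v \<subseteq> cbox 0 1"
      then have b: "\<gamma> s \<in> ball (\<gamma> t) r" if "s \<in> {u..v}" for s
        using d(2)[of s] that by (auto simp: dist_commute subset_eq)
      have "(?g has_integral ((F \<circ> \<gamma>) v - (F \<circ> \<gamma>) u)) {u..v}"
      proof (rule fundamental_theorem_of_calculus_interior_strong[OF K(1)])
        show "u \<le> v" using uv by auto
        fix s assume s: "s \<in> {u<..<v} - K"
        then have s01: "s \<in> {0..1} - K" using uv by (auto simp: subset_eq)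
        have D: "(\<gamma> has_vector_derivative vector_derivative \<gamma> (at s)) (at s)"
          using K(2)[OF s01] by (simp add: vector_derivative_works)
        have "(F has_derivative (\<lambda>h. cx h * f (\<gamma> s))) (at (\<gamma> s))" using F b s by auto
        from has_derivative_compose[OF D[unfolded has_vector_derivative_def] this]
        have "((F \<circ> \<gamma>) has_vector_derivative cx (vector_derivative \<gamma> (at s)) * f (\<gamma> s)) (at s)"
          by (simp add: has_vector_derivative_def cx_scaleR o_def)
        moreover have "vector_derivative \<gamma> (at s within {0..1}) = vector_derivative \<gamma> (at s)"
          using s01 D by (intro vector_derivative_at_within_ivl) auto
        ultimately show "((F \<circ> \<gamma>) has_vector_derivative ?g s) (at s)" by simp
      next
        show "continuous_on {u..v} (F \<circ> \<gamma>)"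
        proof (rule continuous_on_compose)
          show "continuous_on {u..v} \<gamma>" using uv by (intro continuous_on_subset[OF cont]) auto
          show "continuous_on (\<gamma> ` {u..v}) F"
          proof (rule continuous_at_imp_continuous_on, clarify)
            fix s assume "s \<in> {u..v}"
            then have "(F has_derivative (\<lambda>h. cx h * f (\<gamma> s))) (at (\<gamma> s))" using F b by blast
            then show "isCont F (\<gamma> s)" by (rule has_derivative_continuous)
          qed
        qed
      qed
      then show "?g integrable_on cbox u v" by auto
    qed
  qed
  then show ?thesis by (simp add: path_integrable_def)
qed

lemma cfun_path_integral:
  assumes "cfun \<phi>" "path_integrable \<gamma> f"
  shows "((\<lambda>z. \<phi> (f z)) has_contour_integral \<phi> (path_integral \<gamma> f)) \<gamma>"
proof -
  let ?g = "\<lambda>t. cx (vector_derivative \<gamma> (at t within {0..1})) * f (\<gamma> t)"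
  have "(?g has_integral path_integral \<gamma> f) {0..1}"
    using assms(2) unfolding path_integrable_def path_integral_def by (rule integrable_integral)
  from has_integral_linear[OF this cfun_bounded_linear[OF assms(1)]] show ?thesis
    by (simp add: has_contour_integral_def o_def cfunD(6)[OF assms(1)] mult.commute)
qed

end

section \<open>Quadratic pencils of commuting operators\<close>

text \<open>Differentiability in Caratheodory's form: the increment factors through
  \<open>cx (y - z)\<close>, and the cofactor has a limit.\<close>

lemma (in complex_unit) has_cderivI:
  assumes ev: "eventually (\<lambda>y. f y - f z = cx (y - z) * g y) (at z)" and g: "(g \<longlongrightarrow> D) (at z)"
  shows "(f has_derivative (\<lambda>h. cx h * D)) (at z)"
proof -
  obtain K where K: "\<And>x. norm (cx x) \<le> norm x * K"
    using bounded_linear.bounded[OF bounded_linear_cx] by blast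
  have bl: "bounded_linear (\<lambda>h. cx h * D)"
    using bounded_linear_mult_left bounded_linear_cx by (rule bounded_linear_compose)
  have "((\<lambda>y. (f y - f z - cx (y - z) * D) /\<^sub>R norm (y - z)) \<longlongrightarrow> 0) (at z)"
  proof (rule Lim_null_comparison)
    have "eventually (\<lambda>y. y \<noteq> z) (at z)" by (simp add: eventually_at_filter)
    then show "eventually (\<lambda>y. norm ((f y - f z - cx (y - z) * D) /\<^sub>R norm (y - z)) \<le> K * norm (g y - D)) (at z)"
      using ev
    proof eventually_elim
      case (elim y)
      have "norm (f y - f z - cx (y - z) * D) = norm (cx (y - z) * (g y - D))"
        using elim(2) by (simp add: right_diff_distrib)
      also have "\<dots> \<le> norm (y - z) * K * norm (g y - D)"
        by (rule order_trans[OF norm_mult_ineq mult_right_mono[OF K]]) simp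
      finally have "norm (f y - f z - cx (y - z) * D) / norm (y - z) \<le> K * norm (g y - D)"
        using elim(1) by (simp add: pos_divide_le_eq ac_simps)
      then show ?case by (simp add: divide_inverse_commute)
    qed
    show "((\<lambda>y. K * norm (g y - D)) \<longlongrightarrow> 0) (at z)"
      using g by (auto intro!: tendsto_eq_intros tendsto_mult_right_zero)
  qed
  with bl show ?thesis by (simp add: has_derivative_def)
qed

locale commuting_operators = complex_unit j for j :: "'b::unital_banach_algebra" +
  fixes T0 T1 T2 :: 'b
  assumes comm: "T0 * j = j * T0" "T1 * j = j * T1" "T2 * j = j * T2"
    "T1 * T0 = T0 * T1" "T2 * T0 = T0 * T2" "T2 * T1 = T1 * T2"
begin

definition commutes :: "'b \<Rightarrow> bool" where
  "commutes y \<longleftrightarrow> y * j = j * y \<and> y * T0 = T0 * y \<and> y * T1 = T1 * y \<and> y * T2 = T2 * y"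

text \<open>The bicommutant of \<open>j\<close>, \<open>T0\<close>, \<open>T1\<close>,
  \<open>T2\<close>. It is commutative because these elements commute with each other, it is closed,
  and it contains the inverses of its invertible elements; so \<open>qi\<close> and its path
  integrals stay inside. An algebra generated by the four elements would not give this
  directly.\<close>

definition alg :: "'b set" where
  "alg = {x. \<forall>y. commutes y \<longrightarrow> x * y = y * x}"

lemma algD: "x \<in> alg \<Longrightarrow> commutes y \<Longrightarrow> x * y = y * x"
  by (simp add: alg_def)

lemma alg_generators: "j \<in> alg" "T0 \<in> alg" "T1 \<in> alg" "T2 \<in> alg"
  by (auto simp: alg_def commutes_def)

lemma alg_commutes: "x \<in> alg \<Longrightarrow> commutes x"
  using comm by (auto simp: alg_def commutes_def)

lemma alg_commute: "x \<in> alg \<Longrightarrow> y \<in> alg \<Longrightarrow> x * y = y * x"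
  using algD alg_commutes by blast

lemma alg_left_commute: "x \<in> alg \<Longrightarrow> y \<in> alg \<Longrightarrow> x * (y * z) = y * (x * z)"
  using alg_commute by (metis mult.assoc)

lemma alg_0: "0 \<in> alg" and alg_1: "1 \<in> alg"
  by (simp_all add: alg_def)

lemma alg_add: "x \<in> alg \<Longrightarrow> y \<in> alg \<Longrightarrow> x + y \<in> alg"
  and alg_diff: "x \<in> alg \<Longrightarrow> y \<in> alg \<Longrightarrow> x - y \<in> alg"
  by (simp_all add: alg_def algebra_simps)

lemma alg_scaleR: "x \<in> alg \<Longrightarrow> r *\<^sub>R x \<in> alg"
  by (simp add: alg_def)

lemma alg_minus: "x \<in> alg \<Longrightarrow> - x \<in> alg"
  by (simp add: alg_def)

lemma alg_mult: 
  assumes "x \<in> alg" "y \<in> alg"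
  shows "x * y \<in> alg"
proof -
  have "x * y * z = z * (x * y)" if "commutes z" for z
    using algD[OF assms(1) that] algD[OF assms(2) that]
    by (metis mult.assoc)
  then show ?thesis by (simp add: alg_def)
qed

lemma alg_sum: "(\<And>i. i \<in> I \<Longrightarrow> f i \<in> alg) \<Longrightarrow> sum f I \<in> alg"
  by (induction I rule: infinite_finite_induct) (auto intro: alg_0 alg_add)

lemma alg_cx: "cx z \<in> alg"
  unfolding cx_def by (intro alg_add alg_scaleR alg_1 alg_generators)

lemma alg_inverse: "x \<in> alg \<Longrightarrow> inverse_pair x y \<Longrightarrow> y \<in> alg"
  using inverse_pair_commute[of x y] by (simp add: alg_def)

lemma closed_alg: "closed alg"
proof -
  have "alg = (\<Inter>y\<in>{y. commutes y}. {x. x * y = y * x})" by (auto simp: alg_def)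
  also have "closed \<dots>" by (intro closed_INT ballI closed_Collect_eq continuous_intros)
  finally show ?thesis .
qed

lemma alg_path_integral:
  assumes f: "path_integrable \<gamma> f" and alg: "\<And>z. z \<in> path_image \<gamma> \<Longrightarrow> f z \<in> alg"
  shows "path_integral \<gamma> f \<in> alg"
proof -
  let ?g = "\<lambda>t. cx (vector_derivative \<gamma> (at t within {0..1})) * f (\<gamma> t)"
  have "path_integral \<gamma> f * y = y * path_integral \<gamma> f" if y: "commutes y" for y
  proof -
    have "path_integral \<gamma> f * y = integral {0..1} (\<lambda>t. ?g t * y)"
      using integral_linear[OF f[unfolded path_integrable_def] bounded_linear_mult_left[of y]]
      by (simp add: path_integral_def o_def)
    also have "\<dots> = integral {0..1} (\<lambda>t. y * ?g t)"
      using y by (intro integral_cong algD alg_mult alg_cx alg) (auto simp: path_image_def)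
    also have "\<dots> = y * path_integral \<gamma> f"
      using integral_linear[OF f[unfolded path_integrable_def] bounded_linear_mult_right[of y]]
      by (simp add: path_integral_def o_def)
    finally show ?thesis .
  qed
  then show ?thesis by (simp add: alg_def)
qed

section \<open>The pencil, its inverse and the behaviour at infinity\<close>

definition M :: 'b where "M = T1 * T1 + T2 * T2"
definition W :: "complex \<Rightarrow> 'b" where "W z = cx z - T0"
definition Q :: "complex \<Rightarrow> 'b" where "Q z = W z * W z + M"
definition res :: "complex set" where "res = {z. \<exists>v. inverse_pair (Q z) v}"
definition qi :: "complex \<Rightarrow> 'b" where "qi z = (SOME v. inverse_pair (Q z) v)"

lemma alg_M: "M \<in> alg" and alg_W: "W z \<in> alg" and alg_Q: "Q z \<in> alg"
  unfolding Q_def M_def W_def by (intro alg_add alg_diff alg_mult alg_cx alg_generators)+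

lemma inverse_pair_qi: "z \<in> res \<Longrightarrow> inverse_pair (Q z) (qi z)"
  unfolding res_def qi_def by (auto intro: someI)

lemma alg_qi: "z \<in> res \<Longrightarrow> qi z \<in> alg"
  using alg_inverse alg_Q inverse_pair_qi by blast

lemmas alg_intros = alg_0 alg_1 alg_add alg_diff alg_minus alg_mult alg_scaleR alg_cx
  alg_generators alg_M alg_W alg_Q alg_qi

lemma Q_qi: "z \<in> res \<Longrightarrow> Q z * qi z = 1" "z \<in> res \<Longrightarrow> qi z * Q z = 1"
  using inverse_pair_qi by (auto simp: inverse_pair_def)

lemma isCont_W: "isCont W z" and isCont_Q: "isCont Q z"
  unfolding Q_def W_def
  by (intro continuous_intros bounded_linear.continuous[OF bounded_linear_cx] continuous_ident)+

lemma open_res: "open res"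
proof (unfold open_dist, intro ballI)
  fix z assume z: "z \<in> res"
  have "((\<lambda>y. norm (Q y - Q z) * norm (qi z)) \<longlongrightarrow> 0) (at z)"
    using isCont_Q[of z] unfolding isCont_def
    by (intro tendsto_mult_left_zero tendsto_norm_zero LIM_zero)
  then have "eventually (\<lambda>y. norm (Q y - Q z) * norm (qi z) < 1/2) (at z)"
    by (rule order_tendstoD) simp
  then obtain d where d: "d > 0" "\<And>y. y \<noteq> z \<Longrightarrow> dist y z < d \<Longrightarrow> norm (Q y - Q z) * norm (qi z) < 1/2"
    by (auto simp: eventually_at)
  have "y \<in> res" if "dist y z < d" for y
  proof (cases "y = z")
    case False
    then have "\<exists>v. inverse_pair (Q y) v"
      using inverse_pair_perturb(1)[OF inverse_pair_qi[OF z], of "Q y"] d(2)[of y] that by simp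
    then show ?thesis by (simp add: res_def)
  qed (use z in simp)
  with d(1) show "\<exists>e>0. \<forall>y. dist y z < e \<longrightarrow> y \<in> res" by blast
qed

lemma eventually_res: "z \<in> res \<Longrightarrow> eventually (\<lambda>y. y \<in> res) (at z)"
  using open_res by (simp add: eventually_at_in_open')

lemma isCont_qi:
  assumes z: "z \<in> res"
  shows "isCont qi z"
  unfolding isCont_def
proof (rule inverse_pair_tendsto[OF inverse_pair_qi[OF z]])
  show "Q \<midarrow>z\<rightarrow> Q z" using isCont_Q by (simp add: isCont_def)
  show "\<forall>\<^sub>F y in at z. inverse_pair (Q y) (qi y)"
    using eventually_res[OF z] by eventually_elim (rule inverse_pair_qi)
qed

lemma W_diff: "W z - W y = cx (z - y)"
  by (simp add: W_def cx_diff)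

lemma Q_diff: "Q z - Q y = cx (z - y) * (W z + W y)"
  by (simp add: Q_def W_diff[symmetric] algebra_simps alg_commute[OF alg_W alg_W, of z y])

text \<open>The resolvent identity of the pencil. As the two points merge it gives the derivative of
  \<open>qi\<close>; integrated over a cycle it gives \<open>pencil_cauchy\<close>.\<close>

lemma qi_diff:
  assumes "y \<in> res" "z \<in> res"
  shows "qi y - qi z = cx (z - y) * (qi z * (W z + W y) * qi y)"
proof -
  have "qi y - qi z = qi y * (Q z - Q y) * qi z"
    using inverse_pair_diff inverse_pair_qi assms by blast
  also have "\<dots> = cx (z - y) * (qi z * (W z + W y) * qi y)"
    unfolding Q_diff
    by (simp add: mult.assoc alg_commute alg_left_commute alg_intros assms)
  finally show ?thesis .
qed

lemma cderiv_on_qi: "cderiv_on res qi (\<lambda>z. - (2 *\<^sub>R (qi z * W z * qi z)))"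
  unfolding cderiv_on_def
proof (intro conjI ballI)
  have "continuous_on res qi" using isCont_qi continuous_at_imp_continuous_on by blast
  moreover have "continuous_on res W" using isCont_W continuous_at_imp_continuous_on by blast
  ultimately show "continuous_on res (\<lambda>z. - (2 *\<^sub>R (qi z * W z * qi z)))" by (intro continuous_intros)
  fix z assume z: "z \<in> res"
  show "(qi has_derivative (\<lambda>h. cx h * - (2 *\<^sub>R (qi z * W z * qi z)))) (at z)"
  proof (rule has_cderivI)
    show "\<forall>\<^sub>F y in at z. qi y - qi z = cx (y - z) * - (qi z * (W z + W y) * qi y)"
      using eventually_res[OF z]
    proof eventually_elim
      case (elim y)
      then show ?case using qi_diff[OF elim z] cx_minus[of "z - y"] by simp
    qed
    have "(\<lambda>y. - (qi z * (W z + W y) * qi y)) \<midarrow>z\<rightarrow> - (qi z * (W z + W z) * qi z)"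
      using isCont_qi[OF z] isCont_W[of z] unfolding isCont_def by (intro tendsto_intros)
    moreover have "qi z * (W z + W z) * qi z = 2 *\<^sub>R (qi z * W z * qi z)"
      by (simp add: scaleR_2 algebra_simps)
    ultimately show "(\<lambda>y. - (qi z * (W z + W y) * qi y)) \<midarrow>z\<rightarrow> - (2 *\<^sub>R (qi z * W z * qi z))"
      by simp
  qed
qed

lemma cderiv_on_W: "cderiv_on S W (\<lambda>z. 1)"
  using cderiv_on_diff[OF cderiv_on_cx cderiv_on_const[of S T0]] by (simp add: W_def[abs_def])

lemma cx_inverse_tendsto: "((\<lambda>z. cx (inverse z)) \<longlongrightarrow> 0) at_infinity"
  using cx_tendsto[OF tendsto_inverse_0] by simp

text \<open>\<open>Q z\<close> is \<open>z^2\<close> times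
  \<open>U z = (1 - T0/z)^2 + M/z^2\<close>, which tends to 1. So \<open>Q z\<close> is invertible
  for large \<open>z\<close> and \<open>qi z\<close> decays like \<open>z^(-2)\<close>, fast enough
  for \<open>qi z\<close> times an affine function of \<open>z\<close> to vanish at
  infinity.\<close>

lemma qi_at_infinity:
  "eventually (\<lambda>z. z \<in> res) at_infinity"
  "((\<lambda>z. cx z * qi z) \<longlongrightarrow> 0) at_infinity"
proof -
  define U where "U z = 1 - cx (inverse z) * (2 *\<^sub>R T0) + cx (inverse z) * cx (inverse z) * (T0 * T0 + M)" for z
  have U: "(U \<longlongrightarrow> 1) at_infinity"
  proof -
    have "(U \<longlongrightarrow> 1 - 0 * (2 *\<^sub>R T0) + 0 * 0 * (T0 * T0 + M)) at_infinity"
      unfolding U_def by (intro tendsto_intros cx_inverse_tendsto)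
    then show ?thesis by simp
  qed
  have U_alg: "U z \<in> alg" for z unfolding U_def by (intro alg_intros)
  obtain v where ev: "eventually (\<lambda>z. inverse_pair (U z) (v z)) at_infinity"
    and v: "(v \<longlongrightarrow> 1) at_infinity"
    using inverse_pair_near_one[OF U] by blast
  have ne: "eventually (\<lambda>z::complex. z \<noteq> 0) at_infinity"
    by (rule eventually_not_equal_at_infinity)
  have Q_eq: "Q z = cx z * cx z * U z" if "z \<noteq> 0" for z
  proof -
    define k where "k = cx (inverse z)"
    define X where "X = 1 - k * T0"
    have k: "k \<in> alg" "X \<in> alg" unfolding X_def k_def by (intro alg_intros)+
    have ck: "cx z * k = 1" using that by (simp add: k_def flip: cx_mult)
    have "U z = X * X + k * k * M"
      by (simp add: U_def X_def k_def[symmetric] algebra_simps scaleR_2 alg_commute alg_left_commute alg_intros k)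
    moreover have "cx z * X = W z"
      using ck by (simp add: X_def W_def right_diff_distrib flip: mult.assoc)
    moreover have "cx z * cx z * (X * X) = (cx z * X) * (cx z * X)"
      by (simp add: mult.assoc alg_left_commute[OF k(2) alg_cx])
    moreover have "cx z * cx z * (k * k * M) = cx z * (cx z * k) * k * M" by (simp add: mult.assoc)
    ultimately show ?thesis using ck by (simp add: Q_def distrib_left)
  qed
  have inv: "inverse_pair (Q z) (cx (inverse z) * cx (inverse z) * v z)"
    if "inverse_pair (U z) (v z)" "z \<noteq> 0" for z
  proof -
    have "v z * (cx (inverse z) * cx (inverse z)) = cx (inverse z) * cx (inverse z) * v z"
      using alg_inverse[OF U_alg that(1)] by (intro alg_commute alg_intros)
    then show ?thesis
      using inverse_pair_mult[OF inverse_pair_mult[OF cx_inverse[OF that(2)] cx_inverse[OF that(2)]] that(1)]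
      by (simp add: Q_eq[OF that(2)])
  qed
  show res: "eventually (\<lambda>z. z \<in> res) at_infinity"
    using ev ne by eventually_elim (use inv in \<open>auto simp: res_def\<close>)
  have "((\<lambda>z. cx (inverse z) * v z) \<longlongrightarrow> 0 * 1) at_infinity"
    by (intro tendsto_intros cx_inverse_tendsto v)
  moreover have "eventually (\<lambda>z. cx (inverse z) * v z = cx z * qi z) at_infinity"
    using ev ne
  proof eventually_elim
    case (elim z)
    have "z \<in> res" using inv[OF elim] by (auto simp: res_def)
    then have "qi z = cx (inverse z) * cx (inverse z) * v z"
      using inverse_pair_unique inverse_pair_qi inv[OF elim] by blast
    then show ?case using elim(2) by (simp flip: mult.assoc cx_mult)
  qed
  ultimately show "((\<lambda>z. cx z * qi z) \<longlongrightarrow> 0) at_infinity"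
    by (simp add: tendsto_cong)
qed

text \<open>This replaces the homology version of Cauchy's theorem, which the library has only for complex
  functions and a single closed path.\<close>

lemma pencil_Liouville:
  assumes AE: "A \<in> alg" "E \<in> alg" and N: "open N" "N \<union> res = UNIV"
    and h: "\<And>\<phi>. cfun \<phi> \<Longrightarrow> h \<phi> holomorphic_on N"
           "\<And>\<phi> z. cfun \<phi> \<Longrightarrow> z \<in> N \<Longrightarrow> z \<in> res \<Longrightarrow> h \<phi> z = \<phi> (qi z * (W z * A + E))"
  shows "A = 0" "E = 0"
proof -
  have zero: "qi z * (W z * A + E) = 0" if z: "z \<in> res" for z
  proof (rule cfun_eqI)
    fix \<phi> assume \<phi>: "cfun \<phi>"
    \<comment> \<open>\<open>g\<close> glues the expression on \<open>res\<close> to its extension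
      \<open>h \<phi>\<close> across the singular points. The result is entire and tends to 0 at
      infinity.\<close>
    define g where "g z = (if z \<in> res then \<phi> (qi z * (W z * A + E)) else h \<phi> z)" for z
    have "cderiv_on res (\<lambda>z. W z * A + E) (\<lambda>z. A)"
      using cderiv_on_diff[OF cderiv_on_mult[OF cderiv_on_W cderiv_on_const] cderiv_on_const, of res A "- E"]
      by (simp add: alg_commute alg_intros)
    then have "cderiv_on res (\<lambda>z. qi z * (W z * A + E)) (\<lambda>z. qi z * A + - (2 *\<^sub>R (qi z * W z * qi z)) * (W z * A + E))"
      by (intro cderiv_on_mult[OF cderiv_on_qi]) (simp_all add: alg_commute alg_intros)
    then have "(\<lambda>z. \<phi> (qi z * (W z * A + E))) holomorphic_on res"
      using cfun_holomorphic_on[OF \<phi>] open_res by blast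
    then have "g holomorphic_on res \<union> N"
      unfolding g_def
      by (intro holomorphic_on_If_Un open_res N(1) h(1)[OF \<phi>]) (use h(2)[OF \<phi>] in auto)
    then have hol: "g holomorphic_on UNIV" using N(2) by (simp add: Un_commute)
    have lim1: "((\<lambda>z. cx z * qi z * A) \<longlongrightarrow> 0 * A) at_infinity"
      by (intro tendsto_intros qi_at_infinity)
    have lim2: "((\<lambda>z. cx (inverse z) * (cx z * qi z) * (E - T0 * A)) \<longlongrightarrow> 0 * 0 * (E - T0 * A)) at_infinity"
      by (intro tendsto_intros qi_at_infinity cx_inverse_tendsto)
    have "((\<lambda>z. cx z * qi z * A + cx (inverse z) * (cx z * qi z) * (E - T0 * A)) \<longlongrightarrow> 0) at_infinity"
      using tendsto_add[OF lim1 lim2] by simp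
    then have "((\<lambda>z. \<phi> (cx z * qi z * A + cx (inverse z) * (cx z * qi z) * (E - T0 * A))) \<longlongrightarrow> \<phi> 0) at_infinity"
      by (rule bounded_linear.tendsto[OF cfun_bounded_linear[OF \<phi>]])
    moreover have "eventually (\<lambda>z. \<phi> (cx z * qi z * A + cx (inverse z) * (cx z * qi z) * (E - T0 * A)) = g z) at_infinity"
      using qi_at_infinity(1) eventually_not_equal_at_infinity[of "0::complex"]
    proof eventually_elim
      case (elim z)
      have "cx (inverse z) * (cx z * qi z) = qi z" using elim by (simp flip: mult.assoc cx_mult)
      then have "cx z * qi z * A + cx (inverse z) * (cx z * qi z) * (E - T0 * A) = qi z * (W z * A + E)"
        using elim by (simp add: W_def algebra_simps alg_commute alg_left_commute alg_intros AE)
      then show ?case using elim by (simp add: g_def)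
    qed
    ultimately have "(g \<longlongrightarrow> 0) at_infinity" using cfunD(4)[OF \<phi>] by (simp add: tendsto_cong)
    with hol have "g z = 0" by (rule Liouville_weak_0)
    with z show "\<phi> (qi z * (W z * A + E)) = \<phi> 0" by (simp add: g_def cfunD(4)[OF \<phi>])
  qed
  have lin: "W z * A + E = 0" if "z \<in> res" for z
  proof -
    have "W z * A + E = Q z * (qi z * (W z * A + E))"
      using Q_qi(1)[OF that] by (simp flip: mult.assoc)
    with zero[OF that] show ?thesis by simp
  qed
  obtain B where B: "\<And>z. norm z \<ge> B \<Longrightarrow> z \<in> res"
    using qi_at_infinity(1) unfolding eventually_at_infinity by blast
  \<comment> \<open>For a large nonnegative real \<open>z\<close> both \<open>z\<close> and
    \<open>z + 1\<close> lie in \<open>res\<close>; subtracting the affine identity at these two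
    points isolates \<open>A\<close>.\<close>
  define b where "b = max B 0"
  define z where "z = complex_of_real b"
  have "z + 1 = complex_of_real (b + 1)" by (simp add: z_def)
  then have "norm z = b" "norm (z + 1) = b + 1"
    using norm_of_real[of "b + 1", where 'a = complex] by (simp_all add: z_def b_def)
  then have "norm z \<ge> B" "norm (z + 1) \<ge> B" by (simp_all add: b_def)
  then have "z \<in> res" "z + 1 \<in> res" using B by auto
  with lin[of z] lin[of "z + 1"] show A: "A = 0" by (simp add: W_def cx_add algebra_simps)
  with lin[OF \<open>z \<in> res\<close>] show "E = 0" by simp
qed

end

section \<open>Cycles and the contour integrals of the inverse pencil\<close>

definition cycle :: "(real \<Rightarrow> complex) set \<Rightarrow> bool" where
  "cycle \<Gamma> \<longleftrightarrow> finite \<Gamma> \<and> (\<forall>\<gamma>\<in>\<Gamma>. valid_path \<gamma> \<and> pathfinish \<gamma> = pathstart \<gamma>)"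

definition cycle_image :: "(real \<Rightarrow> complex) set \<Rightarrow> complex set" where
  "cycle_image \<Gamma> = (\<Union>\<gamma>\<in>\<Gamma>. path_image \<gamma>)"

definition cycle_winding :: "(real \<Rightarrow> complex) set \<Rightarrow> complex \<Rightarrow> complex" where
  "cycle_winding \<Gamma> w = (\<Sum>\<gamma>\<in>\<Gamma>. winding_number \<gamma> w)"

text \<open>Minus the Cauchy integral. With this sign it is the term added to the winding number
  term in \<open>pencil_cauchy\<close>, and it is holomorphic off the cycle even at singular points
  of the pencil.\<close>

definition cauchy_transform :: "(real \<Rightarrow> complex) set \<Rightarrow> (complex \<Rightarrow> complex) \<Rightarrow> complex \<Rightarrow> complex" where
  "cauchy_transform \<Gamma> f w = - (\<Sum>\<gamma>\<in>\<Gamma>. contour_integral \<gamma> (\<lambda>z. f z / (z - w))) / (2 * pi * \<i>)"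

lemma closed_cycle_image: "cycle \<Gamma> \<Longrightarrow> closed (cycle_image \<Gamma>)"
  unfolding cycle_def cycle_image_def by (intro closed_UN) (auto intro: closed_valid_path_image)

lemma cycle_winding_locally_constant:
  assumes \<Gamma>: "cycle \<Gamma>" and w: "w \<notin> cycle_image \<Gamma>"
  shows "\<exists>U. open U \<and> w \<in> U \<and> U \<inter> cycle_image \<Gamma> = {} \<and>
    (\<forall>y\<in>U. cycle_winding \<Gamma> y = cycle_winding \<Gamma> w)"
proof -
  have "open (- cycle_image \<Gamma>)" using closed_cycle_image[OF \<Gamma>] by (simp add: open_Compl)
  then obtain r where r: "r > 0" "ball w r \<subseteq> - cycle_image \<Gamma>"
    using w open_contains_ball by blast
  have "cycle_winding \<Gamma> y = cycle_winding \<Gamma> w" if y: "y \<in> ball w r" for y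
    unfolding cycle_winding_def
  proof (rule sum.cong[OF refl])
    fix \<gamma> assume \<gamma>: "\<gamma> \<in> \<Gamma>"
    have "winding_number \<gamma> constant_on ball w r"
      using \<Gamma> \<gamma> r(2)
      by (intro winding_number_constant) (auto simp: cycle_def cycle_image_def valid_path_imp_path)
    then show "winding_number \<gamma> y = winding_number \<gamma> w"
      using y r(1) by (auto simp: constant_on_def)
  qed
  moreover have "w \<in> ball w r" "ball w r \<inter> cycle_image \<Gamma> = {}" using r by auto
  ultimately show ?thesis using open_ball by blast
qed

lemma open_cycle_winding:
  assumes \<Gamma>: "cycle \<Gamma>"
  shows "open {w. w \<notin> cycle_image \<Gamma> \<and> P (cycle_winding \<Gamma> w)}"
proof (subst open_subopen, intro ballI)
  fix w assume w: "w \<in> {w. w \<notin> cycle_image \<Gamma> \<and> P (cycle_winding \<Gamma> w)}"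
  then have wn: "w \<notin> cycle_image \<Gamma>" and P: "P (cycle_winding \<Gamma> w)" by auto
  obtain U where U: "open U" "w \<in> U" "U \<inter> cycle_image \<Gamma> = {}"
    "\<forall>y\<in>U. cycle_winding \<Gamma> y = cycle_winding \<Gamma> w"
    using cycle_winding_locally_constant[OF \<Gamma> wn] by blast
  have "y \<notin> cycle_image \<Gamma> \<and> P (cycle_winding \<Gamma> y)" if "y \<in> U" for y
    using bspec[OF U(4) that] P U(3) that by auto
  with U(1,2) show "\<exists>T. open T \<and> w \<in> T \<and> T \<subseteq> {w. w \<notin> cycle_image \<Gamma> \<and> P (cycle_winding \<Gamma> w)}"
    by blast
qed

lemma cycle_winding_holomorphic:
  assumes \<Gamma>: "cycle \<Gamma>"
  shows "cycle_winding \<Gamma> holomorphic_on - cycle_image \<Gamma>"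
proof -
  have "(cycle_winding \<Gamma> has_field_derivative 0) (at w)" if w: "w \<in> - cycle_image \<Gamma>" for w
  proof -
    obtain U where U: "open U" "w \<in> U" "\<forall>y\<in>U. cycle_winding \<Gamma> y = cycle_winding \<Gamma> w"
      using cycle_winding_locally_constant[OF \<Gamma>, of w] w by blast
    have "((\<lambda>y. cycle_winding \<Gamma> w) has_field_derivative 0) (at w)" by simp
    then show ?thesis
      by (rule has_field_derivative_transform_within_open[OF _ U(1,2)]) (rule bspec[OF U(3), symmetric])
  qed
  then show ?thesis
    unfolding holomorphic_on_open[OF open_Compl[OF closed_cycle_image[OF \<Gamma>]]] by blast
qed

text \<open>Differentiation under the integral sign needs a path with bounded derivative. So
  \<open>\<gamma>\<close> is replaced by a polynomial loop so close to it that both give the same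
  integral for every function holomorphic on \<open>S0\<close>. Removing a closed ball around
  \<open>w0\<close> from \<open>S\<close> makes the kernel holomorphic on \<open>S0\<close> for all
  \<open>w\<close> in the open ball simultaneously.\<close>

lemma cauchy_kernel_integral_holomorphic:
  assumes S: "open S" and f: "f holomorphic_on S"
    and \<gamma>: "valid_path \<gamma>" "pathfinish \<gamma> = pathstart \<gamma>" "path_image \<gamma> \<subseteq> S"
  shows "(\<lambda>w. contour_integral \<gamma> (\<lambda>z. f z / (z - w))) holomorphic_on - path_image \<gamma>"
proof -
  have "\<exists>D. ((\<lambda>w. contour_integral \<gamma> (\<lambda>z. f z / (z - w))) has_field_derivative D) (at w0)"
    if w0: "w0 \<in> - path_image \<gamma>" for w0
  proof -
    have "open (- path_image \<gamma>)" using \<gamma>(1) by (simp add: closed_valid_path_image open_Compl)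
    then obtain r where r: "r > 0" "cball w0 r \<subseteq> - path_image \<gamma>"
      using w0 open_contains_cball by blast
    define S0 where "S0 = S - cball w0 r"
    have S0: "open S0" "path_image \<gamma> \<subseteq> S0" using S \<gamma>(3) r(2) by (auto simp: S0_def open_Diff)
    have path: "path \<gamma>" using \<gamma>(1) valid_path_imp_path by blast
    obtain d where d: "d > 0" and near: "\<And>g h. valid_path g \<Longrightarrow> valid_path h \<Longrightarrow>
        (\<forall>t \<in> {0..1}. norm(g t - \<gamma> t) < d \<and> norm(h t - \<gamma> t) < d) \<Longrightarrow>
        pathfinish g = pathstart g \<Longrightarrow> pathfinish h = pathstart h \<Longrightarrow>
        path_image h \<subseteq> S0 \<and> (\<forall>f. f holomorphic_on S0 \<longrightarrow> contour_integral h f = contour_integral g f)"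
      using contour_integral_nearby_loops[OF S0(1) path S0(2)] by metis
    obtain p where p: "polynomial_function p" "pathstart p = pathstart \<gamma>" "pathfinish p = pathfinish \<gamma>"
        "\<And>t. t \<in> {0..1} \<Longrightarrow> norm (p t - \<gamma> t) < d"
      using path_approx_polynomial_function[OF path d] by metis
    have vp: "valid_path p" using p(1) valid_path_polynomial_function by blast
    have im: "path_image p \<subseteq> S0" and eq: "\<And>f. f holomorphic_on S0 \<Longrightarrow> contour_integral p f = contour_integral \<gamma> f"
      using near[OF \<gamma>(1) vp] p \<gamma>(2) d by auto
    obtain p' where p': "polynomial_function p'" "\<And>x. (p has_vector_derivative (p' x)) (at x)"
      using has_vector_derivative_polynomial_function[OF p(1)] by blast
    have "bounded (p' ` {0..1})"
      by (intro compact_imp_bounded compact_continuous_image continuous_on_polymonial_function p'(1)) simp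
    then obtain B where B: "\<And>t. t \<in> {0..1} \<Longrightarrow> norm (p' t) \<le> B"
      unfolding bounded_iff by blast
    have hol: "(\<lambda>z. f z / (z - w)) holomorphic_on S0" if "w \<in> ball w0 r" for w
      using that by (intro holomorphic_intros holomorphic_on_subset[OF f]) (auto simp: S0_def)
    have contf: "continuous_on (path_image p) f"
      using holomorphic_on_imp_continuous_on[OF f] im by (auto simp: S0_def elim: continuous_on_subset)
    have "((\<lambda>w. contour_integral p (\<lambda>z. f z / (z - w)))
        has_field_derivative (of_nat 1 * contour_integral p (\<lambda>u. f u / (u - w0) ^ Suc 1))) (at w0)"
    proof (rule Cauchy_next_derivative(2)[OF contf, where B = B and S = "ball w0 r" and k = 1])
      show "norm (vector_derivative p (at t)) \<le> B" if "t \<in> {0..1}" for t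
        using B[OF that] vector_derivative_at[OF p'(2), of t] by simp
      show "((\<lambda>u. f u / (u - w) ^ 1) has_contour_integral contour_integral p (\<lambda>z. f z / (z - w))) p"
        if "w \<in> ball w0 r - path_image p" for w
        using contour_integrable_holomorphic_simple[OF hol S0(1) vp im] that
        by (simp add: has_contour_integral_integral)
      show "w0 \<in> ball w0 r - path_image p" using im r(1) by (auto simp: S0_def)
    qed (use vp in auto)
    then have "((\<lambda>w. contour_integral \<gamma> (\<lambda>z. f z / (z - w)))
        has_field_derivative (of_nat 1 * contour_integral p (\<lambda>u. f u / (u - w0) ^ Suc 1))) (at w0)"
      by (rule has_field_derivative_transform_within_open[of _ _ _ "ball w0 r"])
         (use r(1) eq[OF hol] in auto)
    then show ?thesis by blast
  qed
  then show ?thesis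
    unfolding holomorphic_on_open[OF open_Compl[OF closed_valid_path_image[OF \<gamma>(1)]]] by blast
qed

lemma cauchy_transform_holomorphic:
  assumes S: "open S" and f: "f holomorphic_on S" and \<Gamma>: "cycle \<Gamma>" "cycle_image \<Gamma> \<subseteq> S"
  shows "cauchy_transform \<Gamma> f holomorphic_on - cycle_image \<Gamma>"
proof -
  have "(\<lambda>w. contour_integral \<gamma> (\<lambda>z. f z / (z - w))) holomorphic_on - cycle_image \<Gamma>" if "\<gamma> \<in> \<Gamma>" for \<gamma>
    using that \<Gamma>
    by (intro holomorphic_on_subset[OF cauchy_kernel_integral_holomorphic[OF S f]])
       (auto simp: cycle_def cycle_image_def)
  then show ?thesis unfolding cauchy_transform_def[abs_def] by (intro holomorphic_intros) auto
qed

context commuting_operators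
begin

definition cycle_integral :: "(real \<Rightarrow> complex) set \<Rightarrow> (complex \<Rightarrow> 'b) \<Rightarrow> 'b" where
  "cycle_integral \<Gamma> f = (\<Sum>\<gamma>\<in>\<Gamma>. path_integral \<gamma> f)"

text \<open>The Riesz projection of \<open>T\<close> is \<open>c1 + c0 * (T - T\<^sub>0)\<close>.\<close>

definition c0 :: "(real \<Rightarrow> complex) set \<Rightarrow> 'b" where
  "c0 \<Gamma> = cx (1 / (2 * pi * \<i>)) * cycle_integral \<Gamma> qi"

definition c1 :: "(real \<Rightarrow> complex) set \<Rightarrow> 'b" where
  "c1 \<Gamma> = cx (1 / (2 * pi * \<i>)) * cycle_integral \<Gamma> (\<lambda>z. W z * qi z)"

definition admissible :: "(real \<Rightarrow> complex) set \<Rightarrow> bool" where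
  "admissible \<Gamma> \<longleftrightarrow> cycle \<Gamma> \<and> cycle_image \<Gamma> \<subseteq> res"

lemma cderiv_on_W_qi:
  "cderiv_on res (\<lambda>z. W z * qi z) (\<lambda>z. W z * - (2 *\<^sub>R (qi z * W z * qi z)) + 1 * qi z)"
  by (intro cderiv_on_mult cderiv_on_W cderiv_on_qi) (simp_all add: alg_commute alg_intros)

lemma cycle_path_integrable:
  assumes "admissible \<Gamma>" "\<gamma> \<in> \<Gamma>" "cderiv_on res f f'"
  shows "path_integrable \<gamma> f"
  by (rule path_integrable_cderiv_on[OF open_res assms(3)])
     (use assms in \<open>auto simp: admissible_def cycle_def cycle_image_def\<close>)

lemma alg_cycle_integral:
  assumes "admissible \<Gamma>" "cderiv_on res f f'" "\<And>z. z \<in> res \<Longrightarrow> f z \<in> alg"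
  shows "cycle_integral \<Gamma> f \<in> alg"
  unfolding cycle_integral_def using assms
  by (intro alg_sum alg_path_integral cycle_path_integrable[OF assms(1) _ assms(2)])
     (auto simp: admissible_def cycle_image_def)

lemma alg_c0: "admissible \<Gamma> \<Longrightarrow> c0 \<Gamma> \<in> alg" and alg_c1: "admissible \<Gamma> \<Longrightarrow> c1 \<Gamma> \<in> alg"
  unfolding c0_def c1_def
  by (auto intro!: alg_mult alg_cx alg_cycle_integral[OF _ cderiv_on_qi] alg_cycle_integral[OF _ cderiv_on_W_qi] alg_qi alg_W)

lemma cfun_cycle_integral:
  assumes "cfun \<phi>" "admissible \<Gamma>" "cderiv_on res f f'"
  shows "\<phi> (cycle_integral \<Gamma> f) = (\<Sum>\<gamma>\<in>\<Gamma>. contour_integral \<gamma> (\<lambda>z. \<phi> (f z)))"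
proof -
  interpret bounded_linear \<phi> using cfun_bounded_linear[OF assms(1)] .
  show ?thesis
    unfolding cycle_integral_def sum
    by (intro sum.cong refl contour_integral_unique[symmetric] cfun_path_integral[OF assms(1)]
        cycle_path_integrable[OF assms(2) _ assms(3)])
qed

lemma cfun_qi_holomorphic: "cfun \<phi> \<Longrightarrow> (\<lambda>z. \<phi> (qi z)) holomorphic_on res"
  by (rule cfun_holomorphic_on[OF _ cderiv_on_qi open_res])

text \<open>By \<open>qi_diff\<close>, \<open>(qi w - qi z) / (z - w)\<close> equals
  \<open>qi w * (W w * qi z + W z * qi z)\<close>. Integrated over the cycle and divided by
  \<open>2 * pi * \<i>\<close>, the second form produces \<open>c0\<close> and \<open>c1\<close>,
  the first the winding number and the Cauchy transform.\<close>

lemma pencil_cauchy: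
  assumes \<phi>: "cfun \<phi>" and \<Gamma>: "admissible \<Gamma>" and w: "w \<in> res" "w \<notin> cycle_image \<Gamma>"
  shows "\<phi> (qi w * (W w * c0 \<Gamma> + c1 \<Gamma>)) =
    cycle_winding \<Gamma> w * \<phi> (qi w) + cauchy_transform \<Gamma> (\<lambda>z. \<phi> (qi z)) w"
proof -
  define k where "k = 1 / (2 * pi * \<i>)"
  define \<psi>1 where "\<psi>1 y = \<phi> (qi w * W w * y)" for y
  define \<psi>2 where "\<psi>2 y = \<phi> (qi w * y)" for y
  have al: "qi w \<in> alg" "qi w * W w \<in> alg" using w(1) by (auto intro: alg_intros)
  have \<psi>: "cfun \<psi>1" "cfun \<psi>2"
    unfolding \<psi>1_def[abs_def] \<psi>2_def[abs_def]
    by (intro cfun_mult_left[OF \<phi>] alg_commute al alg_generators)+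
  have each: "contour_integral \<gamma> (\<lambda>z. \<psi>1 (qi z)) + contour_integral \<gamma> (\<lambda>z. \<psi>2 (W z * qi z)) =
      2 * pi * \<i> * winding_number \<gamma> w * \<phi> (qi w) - contour_integral \<gamma> (\<lambda>z. \<phi> (qi z) / (z - w))"
    if \<gamma>: "\<gamma> \<in> \<Gamma>" for \<gamma>
  proof -
    have vp: "valid_path \<gamma>" "path_image \<gamma> \<subseteq> res" "w \<notin> path_image \<gamma>"
      using \<Gamma> \<gamma> w(2) by (auto simp: admissible_def cycle_def cycle_image_def)
    have "((\<lambda>z. \<psi>1 (qi z)) has_contour_integral contour_integral \<gamma> (\<lambda>z. \<psi>1 (qi z))) \<gamma>"
         "((\<lambda>z. \<psi>2 (W z * qi z)) has_contour_integral contour_integral \<gamma> (\<lambda>z. \<psi>2 (W z * qi z))) \<gamma>"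
      using cfun_path_integral[OF \<psi>(1) cycle_path_integrable[OF \<Gamma> \<gamma> cderiv_on_qi]]
        cfun_path_integral[OF \<psi>(2) cycle_path_integrable[OF \<Gamma> \<gamma> cderiv_on_W_qi]]
      by (simp_all add: contour_integral_unique)
    from has_contour_integral_add[OF this]
    have 1: "((\<lambda>z. \<psi>1 (qi z) + \<psi>2 (W z * qi z)) has_contour_integral
      contour_integral \<gamma> (\<lambda>z. \<psi>1 (qi z)) + contour_integral \<gamma> (\<lambda>z. \<psi>2 (W z * qi z))) \<gamma>" .
    have "(\<lambda>z. \<phi> (qi z) / (z - w)) holomorphic_on res - {w}"
      by (intro holomorphic_intros holomorphic_on_subset[OF cfun_qi_holomorphic[OF \<phi>]]) auto
    then have 2: "((\<lambda>z. \<phi> (qi z) / (z - w)) has_contour_integral contour_integral \<gamma> (\<lambda>z. \<phi> (qi z) / (z - w))) \<gamma>"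
      by (intro has_contour_integral_integral contour_integrable_holomorphic_simple[of _ "res - {w}"])
         (use open_res vp in auto)
    have 3: "((\<lambda>z. \<phi> (qi w) * (1 / (z - w))) has_contour_integral \<phi> (qi w) * (2 * pi * \<i> * winding_number \<gamma> w)) \<gamma>"
      using has_contour_integral_lmul[OF has_contour_integral_winding_number[OF vp(1,3)]] by simp
    have "((\<lambda>z. \<phi> (qi w) * (1 / (z - w)) - \<phi> (qi z) / (z - w)) has_contour_integral
        \<phi> (qi w) * (2 * pi * \<i> * winding_number \<gamma> w) - contour_integral \<gamma> (\<lambda>z. \<phi> (qi z) / (z - w))) \<gamma>"
      by (rule has_contour_integral_diff[OF 3 2])
    moreover have "\<phi> (qi w) * (1 / (z - w)) - \<phi> (qi z) / (z - w) = \<psi>1 (qi z) + \<psi>2 (W z * qi z)"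
      if z: "z \<in> path_image \<gamma>" for z
    proof -
      have zr: "z \<in> res" and ne: "z \<noteq> w" using z vp by auto
      have "\<phi> (qi z) - \<phi> (qi w) = \<phi> (cx (w - z) * (qi w * (W w + W z) * qi z))"
        using qi_diff[OF zr w(1)] cfunD(2)[OF \<phi>] by metis
      also have "\<dots> = (w - z) * (\<psi>1 (qi z) + \<psi>2 (W z * qi z))"
        using cfunD(6)[OF \<phi>] cfunD(1)[OF \<phi>] by (simp add: \<psi>1_def \<psi>2_def distrib_left distrib_right mult.assoc)
      finally have "(\<phi> (qi z) - \<phi> (qi w)) / (w - z) = \<psi>1 (qi z) + \<psi>2 (W z * qi z)"
        using ne by simp
      moreover have "(\<phi> (qi z) - \<phi> (qi w)) / (w - z) = (\<phi> (qi w) - \<phi> (qi z)) / (z - w)"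
        using minus_divide_divide[of "\<phi> (qi w) - \<phi> (qi z)" "z - w"] by simp
      ultimately show ?thesis by (simp add: diff_divide_distrib)
    qed
    ultimately have "((\<lambda>z. \<psi>1 (qi z) + \<psi>2 (W z * qi z)) has_contour_integral
        \<phi> (qi w) * (2 * pi * \<i> * winding_number \<gamma> w) - contour_integral \<gamma> (\<lambda>z. \<phi> (qi z) / (z - w))) \<gamma>"
      by (rule has_contour_integral_eq)
    from contour_integral_unique[OF this] contour_integral_unique[OF 1] show ?thesis
      by (simp add: mult_ac)
  qed
  have c01: "c0 \<Gamma> = cx k * cycle_integral \<Gamma> qi" "c1 \<Gamma> = cx k * cycle_integral \<Gamma> (\<lambda>z. W z * qi z)"
    by (simp_all only: c0_def c1_def k_def)
  have "\<phi> (qi w * (W w * c0 \<Gamma> + c1 \<Gamma>)) =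
      \<phi> (cx k * (qi w * W w * cycle_integral \<Gamma> qi) + cx k * (qi w * cycle_integral \<Gamma> (\<lambda>z. W z * qi z)))"
    using w(1) by (simp add: c01 distrib_left mult.assoc alg_left_commute alg_intros)
  also have "\<dots> = k * (\<psi>1 (cycle_integral \<Gamma> qi) + \<psi>2 (cycle_integral \<Gamma> (\<lambda>z. W z * qi z)))"
    using cfunD(6)[OF \<phi>] cfunD(1)[OF \<phi>] by (simp add: \<psi>1_def \<psi>2_def distrib_left)
  also have "\<dots> = k * (\<Sum>\<gamma>\<in>\<Gamma>. contour_integral \<gamma> (\<lambda>z. \<psi>1 (qi z)) + contour_integral \<gamma> (\<lambda>z. \<psi>2 (W z * qi z)))"
    using cfun_cycle_integral[OF \<psi>(1) \<Gamma> cderiv_on_qi] cfun_cycle_integral[OF \<psi>(2) \<Gamma> cderiv_on_W_qi]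
    by (simp add: sum.distrib)
  also have "\<dots> = k * (\<Sum>\<gamma>\<in>\<Gamma>. 2 * pi * \<i> * winding_number \<gamma> w * \<phi> (qi w) - contour_integral \<gamma> (\<lambda>z. \<phi> (qi z) / (z - w)))"
    using each by simp
  also have "\<dots> = cycle_winding \<Gamma> w * \<phi> (qi w) + cauchy_transform \<Gamma> (\<lambda>z. \<phi> (qi z)) w"
    by (simp add: sum_subtractf cycle_winding_def cauchy_transform_def k_def
        sum_distrib_left sum_distrib_right right_diff_distrib sum_divide_distrib)
  finally show ?thesis .
qed

text \<open>Where the winding numbers are proportional, their terms cancel in the corresponding
  combination of the two instances of \<open>pencil_cauchy\<close>. What remains are Cauchy
  transforms, which extend across the singular points, so \<open>pencil_Liouville\<close> applies.
  The factor \<open>c\<close> is 1 for the two boundaries and -1 for the conjugate cycle.\<close>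

lemma homologous_cycles:
  fixes c :: real
  assumes \<Gamma>: "admissible \<Gamma>" and \<Delta>: "admissible \<Delta>"
    and wind: "\<And>w. w \<notin> res \<Longrightarrow> cycle_winding \<Gamma> w = of_real c * cycle_winding \<Delta> w"
  shows "c0 \<Gamma> = c *\<^sub>R c0 \<Delta>" "c1 \<Gamma> = c *\<^sub>R c1 \<Delta>"
proof -
  define N where "N = {w. w \<notin> cycle_image \<Gamma> \<and> w \<notin> cycle_image \<Delta> \<and> cycle_winding \<Gamma> w = of_real c * cycle_winding \<Delta> w}"
  have N: "open N"
  proof (subst open_subopen, intro ballI)
    fix w assume w: "w \<in> N"
    then have wn: "w \<notin> cycle_image \<Gamma>" "w \<notin> cycle_image \<Delta>" and cyc: "cycle \<Gamma>" "cycle \<Delta>"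
      using \<Gamma> \<Delta> by (auto simp: N_def admissible_def)
    obtain U where U: "open U" "w \<in> U" "U \<inter> cycle_image \<Gamma> = {}"
      "\<forall>y\<in>U. cycle_winding \<Gamma> y = cycle_winding \<Gamma> w"
      using cycle_winding_locally_constant[OF cyc(1) wn(1)] by blast
    obtain V where V: "open V" "w \<in> V" "V \<inter> cycle_image \<Delta> = {}"
      "\<forall>y\<in>V. cycle_winding \<Delta> y = cycle_winding \<Delta> w"
      using cycle_winding_locally_constant[OF cyc(2) wn(2)] by blast
    show "\<exists>T. open T \<and> w \<in> T \<and> T \<subseteq> N"
    proof (intro exI[of _ "U \<inter> V"] conjI subsetI)
      fix y assume "y \<in> U \<inter> V"
      then have "cycle_winding \<Gamma> y = cycle_winding \<Gamma> w" "cycle_winding \<Delta> y = cycle_winding \<Delta> w"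
        "y \<notin> cycle_image \<Gamma>" "y \<notin> cycle_image \<Delta>"
        using U V by blast+
      with w show "y \<in> N" by (simp add: N_def)
    qed (use U V in auto)
  qed
  have NR: "N \<union> res = UNIV" using wind \<Gamma> \<Delta> by (auto simp: N_def admissible_def)
  have AE: "c0 \<Gamma> - c *\<^sub>R c0 \<Delta> \<in> alg" "c1 \<Gamma> - c *\<^sub>R c1 \<Delta> \<in> alg"
    using \<Gamma> \<Delta> by (auto intro!: alg_diff alg_scaleR alg_c0 alg_c1)
  have h1: "(\<lambda>w. cauchy_transform \<Gamma> (\<lambda>z. \<phi> (qi z)) w - of_real c * cauchy_transform \<Delta> (\<lambda>z. \<phi> (qi z)) w) holomorphic_on N"
    if "cfun \<phi>" for \<phi>
    using \<Gamma> \<Delta> that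
    by (intro holomorphic_intros holomorphic_on_subset[OF cauchy_transform_holomorphic[OF open_res cfun_qi_holomorphic]])
       (auto simp: admissible_def N_def)
  have h2: "cauchy_transform \<Gamma> (\<lambda>z. \<phi> (qi z)) w - of_real c * cauchy_transform \<Delta> (\<lambda>z. \<phi> (qi z)) w =
      \<phi> (qi w * (W w * (c0 \<Gamma> - c *\<^sub>R c0 \<Delta>) + (c1 \<Gamma> - c *\<^sub>R c1 \<Delta>)))"
    if \<phi>: "cfun \<phi>" and w: "w \<in> N" "w \<in> res" for \<phi> w
  proof -
    have "\<phi> (qi w * (W w * (c0 \<Gamma> - c *\<^sub>R c0 \<Delta>) + (c1 \<Gamma> - c *\<^sub>R c1 \<Delta>))) =
        \<phi> (qi w * (W w * c0 \<Gamma> + c1 \<Gamma>) - c *\<^sub>R (qi w * (W w * c0 \<Delta> + c1 \<Delta>)))"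
      by (simp add: algebra_simps)
    also have "\<dots> = \<phi> (qi w * (W w * c0 \<Gamma> + c1 \<Gamma>)) - of_real c * \<phi> (qi w * (W w * c0 \<Delta> + c1 \<Delta>))"
      using cfunD(2,5)[OF \<phi>] by (simp add: scaleR_conv_of_real)
    finally show ?thesis
      using pencil_cauchy[OF \<phi> \<Gamma> w(2)] pencil_cauchy[OF \<phi> \<Delta> w(2)] w(1)
      by (simp add: N_def algebra_simps)
  qed
  show "c0 \<Gamma> = c *\<^sub>R c0 \<Delta>" "c1 \<Gamma> = c *\<^sub>R c1 \<Delta>"
    using pencil_Liouville[OF AE N NR, of "\<lambda>\<phi> w. cauchy_transform \<Gamma> (\<lambda>z. \<phi> (qi z)) w
      - of_real c * cauchy_transform \<Delta> (\<lambda>z. \<phi> (qi z)) w", OF h1 h2] by simp_all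
qed

text \<open>With \<open>y = W w * c0 \<Gamma> + c1 \<Gamma>\<close>, the function \<open>qi w * y\<close> extends holomorphically where the
  cycle has winding number 0, and \<open>qi w * (y - 1)\<close> where it has winding number 1; hence
  \<open>qi w * y * (y - 1)\<close> is entire up to the constant \<open>c0 \<Gamma> * c0 \<Gamma>\<close>.\<close>

lemma cycle_idempotent:
  assumes \<Gamma>: "admissible \<Gamma>" and wind: "\<And>w. w \<notin> res \<Longrightarrow> cycle_winding \<Gamma> w \<in> {0, 1}"
  shows "2 *\<^sub>R (c1 \<Gamma> * c0 \<Gamma>) - c0 \<Gamma> = 0" "c1 \<Gamma> * c1 \<Gamma> - c1 \<Gamma> - M * (c0 \<Gamma> * c0 \<Gamma>) = 0"
proof -
  define a where "a = c0 \<Gamma>"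
  define e where "e = c1 \<Gamma>"
  define N where "N = {w. w \<notin> cycle_image \<Gamma> \<and> cycle_winding \<Gamma> w \<in> {0, 1}}"
  have al: "a \<in> alg" "e \<in> alg" using \<Gamma> by (auto simp: a_def e_def alg_c0 alg_c1)
  have cyc: "cycle \<Gamma>" "cycle_image \<Gamma> \<subseteq> res" using \<Gamma> by (auto simp: admissible_def)
  have N: "open N" unfolding N_def by (rule open_cycle_winding[OF cyc(1)])
  have NR: "N \<union> res = UNIV" using wind cyc by (auto simp: N_def)
  have AE: "2 *\<^sub>R (e * a) - a \<in> alg" "e * e - e - M * (a * a) \<in> alg"
    by (intro alg_intros al)+
  define C where "C \<phi> = cauchy_transform \<Gamma> (\<lambda>z. \<phi> (qi z))" for \<phi>
  \<comment> \<open>For a winding number \<open>n\<close> equal to 0 or 1,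
    \<open>y * (y - 1) = (y - n) * (y - 1 + n)\<close>. The Cauchy transform accounts for
    \<open>qi w * (y - n)\<close>; the other factor is \<open>w * a + (e - T0 * a - 1) + n\<close>,
    whose three terms give the first three summands. The last one removes the part of
    \<open>qi w * y * y\<close> that does not decay.\<close>
  define h where "h \<phi> w = w * C (\<lambda>x. \<phi> (x * a)) w + C (\<lambda>x. \<phi> (x * (e - T0 * a - 1))) w
      + cycle_winding \<Gamma> w * C \<phi> w - \<phi> (a * a)" for \<phi> w
  have h1: "h \<phi> holomorphic_on N" if \<phi>: "cfun \<phi>" for \<phi>
  proof -
    have "C \<psi> holomorphic_on N" if "cfun \<psi>" for \<psi>
      unfolding C_def
      by (intro holomorphic_on_subset[OF cauchy_transform_holomorphic[OF open_res cfun_qi_holomorphic[OF that] cyc]])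
         (auto simp: N_def)
    moreover have "cycle_winding \<Gamma> holomorphic_on N"
      by (intro holomorphic_on_subset[OF cycle_winding_holomorphic[OF cyc(1)]]) (auto simp: N_def)
    ultimately show ?thesis
      unfolding h_def by (intro holomorphic_intros) (use \<phi> cfun_mult_right in auto)
  qed
  have h2: "h \<phi> w = \<phi> (qi w * (W w * (2 *\<^sub>R (e * a) - a) + (e * e - e - M * (a * a))))"
    if \<phi>: "cfun \<phi>" and w: "w \<in> N" "w \<in> res" for \<phi> w
  proof -
    define n where "n = cycle_winding \<Gamma> w"
    define y where "y = W w * a + e"
    have wi: "w \<notin> cycle_image \<Gamma>" and n: "n = 0 \<or> n = 1" using w(1) by (auto simp: N_def n_def)
    have al': "qi w \<in> alg" "y \<in> alg" using w(2) unfolding y_def by (auto intro!: alg_intros al)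
    have C: "C \<psi> w = \<psi> (qi w * (y - cx n))" if \<psi>: "cfun \<psi>" for \<psi>
    proof -
      have "\<psi> (qi w * (y - cx n)) = \<psi> (qi w * y - cx n * qi w)"
        by (simp add: right_diff_distrib alg_commute[OF al'(1) alg_cx])
      then show ?thesis
        using pencil_cauchy[OF \<psi> \<Gamma> w(2) wi] cfunD(2,6)[OF \<psi>]
        by (simp add: C_def n_def y_def a_def e_def)
    qed
    have "h \<phi> w = \<phi> (cx w * (qi w * (y - cx n) * a)) + \<phi> (qi w * (y - cx n) * (e - T0 * a - 1))
       + \<phi> (cx n * (qi w * (y - cx n))) - \<phi> (a * a)"
      using C[OF \<phi>] C[OF cfun_mult_right[OF \<phi>]] cfunD(6)[OF \<phi>] by (simp add: h_def n_def)
    also have "\<dots> = \<phi> (cx w * (qi w * (y - cx n) * a) + qi w * (y - cx n) * (e - T0 * a - 1)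
       + cx n * (qi w * (y - cx n)) - a * a)"
      using cfunD(1,2)[OF \<phi>] by simp
    also have "cx w * (qi w * (y - cx n) * a) + qi w * (y - cx n) * (e - T0 * a - 1)
       + cx n * (qi w * (y - cx n)) = qi w * (y - cx n) * (y - 1 + cx n)"
    proof -
      have "y = cx w * a - T0 * a + e" by (simp add: y_def W_def left_diff_distrib)
      then have "y - 1 + cx n = cx w * a + (e - T0 * a - 1) + cx n" by simp
      moreover have "cx w * (qi w * (y - cx n) * a) = qi w * (y - cx n) * (cx w * a)"
        "cx n * (qi w * (y - cx n)) = qi w * (y - cx n) * cx n"
        by (simp_all add: mult.assoc alg_left_commute alg_commute alg_intros al al')
      ultimately show ?thesis by (simp only: distrib_left)
    qed
    also have "qi w * (y - cx n) * (y - 1 + cx n) = qi w * (y * y - y)"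
    proof -
      have "(y - cx n) * (y - 1 + cx n) = y * y - y"
        using n by (auto simp: algebra_simps)
      then show ?thesis by (simp add: mult.assoc)
    qed
    also have "qi w * (y * y - y) - a * a = qi w * (W w * (2 *\<^sub>R (e * a) - a) + (e * e - e - M * (a * a)))"
    proof -
      \<comment> \<open>Replacing \<open>W w * W w\<close> by \<open>Q w - M\<close> leaves a
        remainder that is affine in \<open>W w\<close>.\<close>
      have "y * y - y = Q w * (a * a) + (W w * (2 *\<^sub>R (e * a) - a) + (e * e - e - M * (a * a)))"
        by (simp add: y_def Q_def algebra_simps scaleR_2 alg_commute alg_left_commute alg_W alg_M al)
      moreover have "qi w * (Q w * (a * a)) = a * a" using Q_qi(2)[OF w(2)] by (simp flip: mult.assoc)
      ultimately show ?thesis by (simp add: distrib_left)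
    qed
    finally show ?thesis .
  qed
  show "2 *\<^sub>R (c1 \<Gamma> * c0 \<Gamma>) - c0 \<Gamma> = 0" "c1 \<Gamma> * c1 \<Gamma> - c1 \<Gamma> - M * (c0 \<Gamma> * c0 \<Gamma>) = 0"
    using pencil_Liouville[OF AE N NR h1 h2] by (simp_all add: a_def e_def)
qed

end

section \<open>Ideals and joint spectral points\<close>

context commuting_operators
begin

text \<open>Ideals of the commutative algebra \<open>alg\<close>, not of the ambient one. Closedness
  allows a functional to vanish on the ideal without vanishing at 1.\<close>

definition proper_ideal :: "'b set \<Rightarrow> bool" where
  "proper_ideal I \<longleftrightarrow> subspace I \<and> closed I \<and> I \<subseteq> alg \<and> (\<forall>x\<in>alg. \<forall>i\<in>I. x * i \<in> I) \<and> 1 \<notin> I"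

lemma proper_idealD:
  assumes "proper_ideal I"
  shows "subspace I" "closed I" "i \<in> I \<Longrightarrow> i \<in> alg" "x \<in> alg \<Longrightarrow> i \<in> I \<Longrightarrow> x * i \<in> I" "1 \<notin> I"
    "0 \<in> I" "i \<in> I \<Longrightarrow> k \<in> I \<Longrightarrow> i + k \<in> I" "i \<in> I \<Longrightarrow> k \<in> I \<Longrightarrow> i - k \<in> I"
    "x \<in> alg \<Longrightarrow> i \<in> I \<Longrightarrow> i * x \<in> I"
proof -
  show *: "subspace I" "closed I" "i \<in> I \<Longrightarrow> i \<in> alg" "x \<in> alg \<Longrightarrow> i \<in> I \<Longrightarrow> x * i \<in> I" "1 \<notin> I"
    for x i using assms by (auto simp: proper_ideal_def)
  show "0 \<in> I" "i \<in> I \<Longrightarrow> k \<in> I \<Longrightarrow> i + k \<in> I" "i \<in> I \<Longrightarrow> k \<in> I \<Longrightarrow> i - k \<in> I"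
    using *(1) subspace_0 subspace_add subspace_diff by auto
  show "x \<in> alg \<Longrightarrow> i \<in> I \<Longrightarrow> i * x \<in> I" using *(3,4) alg_commute by metis
qed

lemma proper_ideal_cfun:
  assumes I: "proper_ideal I"
  obtains \<phi> where "cfun \<phi>" "\<And>x. x \<in> I \<Longrightarrow> \<phi> x = 0" "\<phi> 1 \<noteq> 0"
  using cfun_separation[OF proper_idealD(1,2)[OF I] proper_idealD(4)[OF I alg_generators(1)] proper_idealD(5)[OF I]]
  by blast

lemma subspace_closure:
  fixes J :: "'b set"
  assumes J: "subspace J"
  shows "subspace (closure J)"
proof (rule subspaceI)
  show "0 \<in> closure J" using subspace_0[OF J] closure_subset by blast
  show "x + y \<in> closure J" if xy: "x \<in> closure J" "y \<in> closure J" for x y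
  proof -
    obtain f g where fg: "\<And>n::nat. f n \<in> J" "f \<longlonglongrightarrow> x" "\<And>n::nat. g n \<in> J" "g \<longlonglongrightarrow> y"
      using xy unfolding closure_sequential by blast
    then have "(\<lambda>n. f n + g n) \<longlonglongrightarrow> x + y" "\<And>n. f n + g n \<in> J"
      using subspace_add[OF J] by (auto intro: tendsto_add)
    then show ?thesis unfolding closure_sequential by (intro exI[of _ "\<lambda>n. f n + g n"]) auto
  qed
  show "r *\<^sub>R x \<in> closure J" if x: "x \<in> closure J" for r x
  proof -
    obtain f where f: "\<And>n::nat. f n \<in> J" "f \<longlonglongrightarrow> x"
      using x unfolding closure_sequential by blast
    then have "(\<lambda>n. r *\<^sub>R f n) \<longlonglongrightarrow> r *\<^sub>R x" "\<And>n. r *\<^sub>R f n \<in> J"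
      using subspace_scale[OF J] by (auto intro: tendsto_scaleR)
    then show ?thesis unfolding closure_sequential by (intro exI[of _ "\<lambda>n. r *\<^sub>R f n"]) auto
  qed
qed

lemma proper_ideal_closure:
  assumes J: "subspace J" "J \<subseteq> alg" "\<And>x i. x \<in> alg \<Longrightarrow> i \<in> J \<Longrightarrow> x * i \<in> J" and 1: "1 \<notin> closure J"
  shows "proper_ideal (closure J)"
proof -
  have "x * i \<in> closure J" if x: "x \<in> alg" and i: "i \<in> closure J" for x i
  proof -
    have "closure J \<subseteq> (\<lambda>i. x * i) -` closure J"
    proof (rule closure_minimal)
      show "J \<subseteq> (\<lambda>i. x * i) -` closure J" using J(3)[OF x] closure_subset by blast
      show "closed ((\<lambda>i. x * i) -` closure J)" by (intro closed_vimage closed_closure continuous_intros)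
    qed
    with i show ?thesis by blast
  qed
  moreover have "closure J \<subseteq> alg" using J(2) closed_alg by (rule closure_minimal)
  ultimately show ?thesis
    using 1 subspace_closure[OF J(1)] by (auto simp: proper_ideal_def)
qed

text \<open>The Gelfand--Mazur theorem for the quotient by \<open>I\<close>: if \<open>x - \<eta>\<close> were invertible modulo \<open>I\<close>
  for every \<open>\<eta>\<close>, a functional vanishing on \<open>I\<close> would turn the resolvent into an entire function
  that tends to 0 at infinity.\<close>

lemma proper_ideal_extend:
  assumes I: "proper_ideal I" and x: "x \<in> alg"
  shows "\<exists>\<eta> I'. I \<subseteq> I' \<and> proper_ideal I' \<and> x - cx \<eta> \<in> I'"
proof -
  note ID = proper_idealD[OF I]
  define J where "J \<eta> = {i + (x - cx \<eta>) * y | i y. i \<in> I \<and> y \<in> alg}" for \<eta>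
  have JI': "i + (x - cx \<eta>) * y \<in> J \<eta>" if "i \<in> I" "y \<in> alg" for i y \<eta>
    using that by (auto simp: J_def)
  have JE: "\<exists>i y. a = i + (x - cx \<eta>) * y \<and> i \<in> I \<and> y \<in> alg" if "a \<in> J \<eta>" for a \<eta>
    using that by (auto simp: J_def)
  have JI: "I \<subseteq> J \<eta>" and xJ: "x - cx \<eta> \<in> J \<eta>" and Jalg: "J \<eta> \<subseteq> alg" for \<eta>
  proof -
    show "I \<subseteq> J \<eta>" using JI'[OF _ alg_0] by auto
    show "x - cx \<eta> \<in> J \<eta>" using JI'[OF ID(6) alg_1] by simp
    show "J \<eta> \<subseteq> alg" unfolding J_def using ID(3) x by (auto intro!: alg_intros)
  qed
  have Jsub: "subspace (J \<eta>)" for \<eta>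
  proof (rule subspaceI)
    show "0 \<in> J \<eta>" using JI ID(6) by blast
    show "a + b \<in> J \<eta>" if "a \<in> J \<eta>" "b \<in> J \<eta>" for a b
    proof -
      from that obtain i y k z where iy: "a = i + (x - cx \<eta>) * y" "b = k + (x - cx \<eta>) * z"
        "i \<in> I" "k \<in> I" "y \<in> alg" "z \<in> alg" using JE by metis
      then have "a + b = (i + k) + (x - cx \<eta>) * (y + z)" by (simp add: distrib_left)
      moreover have "i + k \<in> I" "y + z \<in> alg" using iy ID(7) alg_add by auto
      ultimately show ?thesis by (simp only: JI')
    qed
    show "r *\<^sub>R a \<in> J \<eta>" if "a \<in> J \<eta>" for r a
    proof -
      from that obtain i y where iy: "a = i + (x - cx \<eta>) * y" "i \<in> I" "y \<in> alg" using JE by metis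
      then have "r *\<^sub>R a = r *\<^sub>R i + (x - cx \<eta>) * (r *\<^sub>R y)" by (simp add: scaleR_add_right)
      moreover have "r *\<^sub>R i \<in> I" "r *\<^sub>R y \<in> alg" using iy subspace_scale[OF ID(1)] alg_scaleR by auto
      ultimately show ?thesis by (simp only: JI')
    qed
  qed
  have Jmul: "b * a \<in> J \<eta>" if "b \<in> alg" "a \<in> J \<eta>" for a b \<eta>
  proof -
    from that obtain i y where iy: "a = i + (x - cx \<eta>) * y" "i \<in> I" "y \<in> alg" using JE by metis
    have "b * ((x - cx \<eta>) * y) = (x - cx \<eta>) * (b * y)"
      using that(1) x by (intro alg_left_commute alg_intros)
    with iy have "b * a = b * i + (x - cx \<eta>) * (b * y)" by (simp add: distrib_left)
    moreover have "b * i \<in> I" "b * y \<in> alg" using iy ID(4) alg_mult that(1) by auto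
    ultimately show ?thesis by (simp only: JI')
  qed
  show ?thesis
  proof (cases "\<exists>\<eta>. 1 \<notin> closure (J \<eta>)")
    case True
    then obtain \<eta> where "1 \<notin> closure (J \<eta>)" by blast
    then have "proper_ideal (closure (J \<eta>))"
      using Jsub Jalg Jmul by (intro proper_ideal_closure) auto
    moreover have "I \<subseteq> closure (J \<eta>)" "x - cx \<eta> \<in> closure (J \<eta>)"
      using JI xJ closure_subset by blast+
    ultimately show ?thesis by blast
  next
    case False
    define inv_mod where "inv_mod \<eta> y \<longleftrightarrow> y \<in> alg \<and> 1 - (x - cx \<eta>) * y \<in> I" for \<eta> y
    have "\<exists>y. inv_mod \<eta> y" for \<eta>
    proof -
      \<comment> \<open>An element \<open>u\<close> of \<open>J \<eta>\<close> at distance less than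
        1 from 1 is invertible; multiplying its decomposition by the inverse inverts
        \<open>x - cx \<eta>\<close> modulo \<open>I\<close>.\<close>
      have "1 \<in> closure (J \<eta>)" using False by blast
      then obtain u where u: "u \<in> J \<eta>" "dist u 1 < 1" unfolding closure_approachable using zero_less_one by blast
      then obtain i y where iy: "u = i + (x - cx \<eta>) * y" "i \<in> I" "y \<in> alg" by (auto simp: J_def)
      have "norm (1 - u) < 1" using u(2) by (simp add: dist_norm norm_minus_commute)
      from inverse_pair_one_minus[OF this] obtain v where v: "inverse_pair u v" by auto
      have val: "v \<in> alg" using alg_inverse[OF _ v] Jalg u(1) by blast
      have "1 - (x - cx \<eta>) * (v * y) = v * u - v * ((x - cx \<eta>) * y)"
        using v val x iy(3) by (simp add: inverse_pair_def alg_left_commute alg_intros)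
      also have "\<dots> = v * i" by (simp add: iy(1) distrib_left)
      finally show ?thesis using val iy ID(4) by (auto simp: inv_mod_def intro!: exI[of _ "v * y"] alg_mult)
    qed
    then obtain Y where Y: "inv_mod \<eta> (Y \<eta>)" for \<eta> by metis
    obtain \<phi> where \<phi>: "cfun \<phi>" "\<And>x. x \<in> I \<Longrightarrow> \<phi> x = 0" "\<phi> 1 \<noteq> 0"
      using proper_ideal_cfun[OF I] by blast
    \<comment> \<open>Inverses modulo \<open>I\<close> are unique modulo \<open>I\<close>, so the
      arbitrary choice \<open>Y\<close> is invisible to \<open>\<phi>\<close> and may be replaced by
      any convenient inverse.\<close>
    have uniq: "\<phi> y = \<phi> z" if "inv_mod \<eta> y" "inv_mod \<eta> z" for \<eta> y z
    proof -
      have yz: "y \<in> alg" "z \<in> alg" "1 - (x - cx \<eta>) * z \<in> I" "1 - (x - cx \<eta>) * y \<in> I"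
        using that by (auto simp: inv_mod_def)
      have "y - z = y * (1 - (x - cx \<eta>) * z) - z * (1 - (x - cx \<eta>) * y)"
        using yz x by (simp add: algebra_simps alg_commute alg_left_commute alg_intros)
      also have "\<dots> \<in> I" by (rule ID(8)[OF ID(4)[OF yz(1,3)] ID(4)[OF yz(2,4)]])
      finally show ?thesis using \<phi>(2)[of "y - z"] cfunD(2)[OF \<phi>(1)] by simp
    qed
    define g where "g \<eta> = \<phi> (Y \<eta>)" for \<eta>
    have "(g has_field_derivative \<phi> (Y \<mu> * Y \<mu>)) (at \<mu>)" for \<mu>
    proof -
      define y where "y = Y \<mu>"
      have y: "y \<in> alg" "1 - (x - cx \<mu>) * y \<in> I" using Y[of \<mu>] by (auto simp: y_def inv_mod_def)
      \<comment> \<open>Near \<open>\<mu>\<close> the inverse modulo \<open>I\<close> at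
        \<open>l\<close> is \<open>v l * y\<close> with \<open>v l\<close> inverse to
        \<open>u l\<close>, as in the usual expansion of a resolvent around a point.\<close>
      define u where "u l = 1 - cx (l - \<mu>) * y" for l
      have "(u \<longlongrightarrow> 1 - cx (\<mu> - \<mu>) * y) (at \<mu>)" unfolding u_def by (intro tendsto_intros)
      then have "(u \<longlongrightarrow> 1) (at \<mu>)" by simp
      from inverse_pair_near_one[OF this] obtain v
        where ev: "eventually (\<lambda>l. inverse_pair (u l) (v l)) (at \<mu>)" and v: "(v \<longlongrightarrow> 1) (at \<mu>)"
        by blast
      have "eventually (\<lambda>l. l \<noteq> \<mu>) (at \<mu>)" by (simp add: eventually_at_filter)
      with ev have "eventually (\<lambda>l. \<phi> (v l * y * y) = (g l - g \<mu>) / (l - \<mu>)) (at \<mu>)"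
      proof eventually_elim
        case (elim l)
        have "u l \<in> alg" unfolding u_def using y by (intro alg_intros)
        then have vl: "v l \<in> alg" using alg_inverse elim(1) by blast
        have vu: "v l - v l * (cx (l - \<mu>) * y) = 1"
          using elim(1) by (simp add: inverse_pair_def u_def right_diff_distrib)
        have "1 - (x - cx l) * (v l * y) = v l * (1 - (x - cx \<mu>) * y)"
        proof -
          have "(x - cx l) * (v l * y) = v l * ((x - cx \<mu>) * y) - v l * (cx (l - \<mu>) * y)"
            using y vl x by (simp add: cx_diff algebra_simps alg_commute alg_left_commute alg_intros)
          then have "1 - (x - cx l) * (v l * y) = (v l - v l * (cx (l - \<mu>) * y))
              - (v l * ((x - cx \<mu>) * y) - v l * (cx (l - \<mu>) * y))"
            by (simp only: vu)
          also have "\<dots> = v l * (1 - (x - cx \<mu>) * y)" by (simp add: right_diff_distrib)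
          finally show ?thesis .
        qed
        also have "\<dots> \<in> I" by (rule ID(4)[OF vl y(2)])
        finally have "inv_mod l (v l * y)" using vl y by (auto simp: inv_mod_def intro: alg_mult)
        then have "g l = \<phi> (v l * y)" unfolding g_def by (rule uniq[OF Y])
        moreover have "g \<mu> = \<phi> y" by (simp add: g_def y_def)
        moreover have "v l * y - y = cx (l - \<mu>) * (v l * y * y)"
        proof -
          have "v l * y - y = (v l - 1) * y" by (simp add: left_diff_distrib)
          also have "v l - 1 = v l * (cx (l - \<mu>) * y)" using vu by (simp add: algebra_simps)
          finally show ?thesis using vl y by (simp add: mult.assoc alg_left_commute alg_intros)
        qed
        ultimately have "g l - g \<mu> = (l - \<mu>) * \<phi> (v l * y * y)"
          using cfunD(2,6)[OF \<phi>(1)] by metis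
        with elim(2) show ?case by simp
      qed
      moreover have "((\<lambda>l. \<phi> (v l * y * y)) \<longlongrightarrow> \<phi> (1 * y * y)) (at \<mu>)"
        by (intro bounded_linear.tendsto[OF cfun_bounded_linear[OF \<phi>(1)]] tendsto_intros v)
      ultimately show ?thesis
        by (simp add: has_field_derivative_iff y_def tendsto_cong)
    qed
    then have hol: "g holomorphic_on UNIV" by (auto simp: holomorphic_on_open)
    \<comment> \<open>Here \<open>x - cx l\<close> is \<open>- (cx l * u l)\<close>, so for large
      \<open>l\<close> it is invertible in \<open>alg\<close> itself.\<close>
    define u where "u l = 1 - cx (inverse l) * x" for l
    have "(u \<longlongrightarrow> 1 - 0 * x) at_infinity" unfolding u_def by (intro tendsto_intros cx_inverse_tendsto)
    then have "(u \<longlongrightarrow> 1) at_infinity" by simp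
    from inverse_pair_near_one[OF this] obtain v
      where ev: "eventually (\<lambda>l. inverse_pair (u l) (v l)) at_infinity" and v: "(v \<longlongrightarrow> 1) at_infinity"
      by blast
    have ne: "eventually (\<lambda>l::complex. l \<noteq> 0) at_infinity" by (rule eventually_not_equal_at_infinity)
    have gv: "eventually (\<lambda>l. g l = \<phi> (- (cx (inverse l) * v l)) \<and> l * g l = - \<phi> (v l)) at_infinity"
      using ev ne
    proof eventually_elim
      case (elim l)
      have "u l \<in> alg" unfolding u_def using x by (intro alg_intros)
      then have vl: "v l \<in> alg" using alg_inverse elim(1) by blast
      have c: "cx l * cx (inverse l) = 1" using elim(2) by (simp flip: cx_mult)
      have "(x - cx l) = - (cx l * u l)"
        using c by (simp add: u_def right_diff_distrib flip: mult.assoc)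
      then have "(x - cx l) * (- (cx (inverse l) * v l)) = cx l * u l * (cx (inverse l) * v l)" by simp
      also have "\<dots> = cx l * cx (inverse l) * (u l * v l)"
        using \<open>u l \<in> alg\<close> vl by (simp add: mult.assoc alg_left_commute alg_intros)
      also have "\<dots> = 1" using c elim(1) by (simp add: inverse_pair_def)
      finally have "inv_mod l (- (cx (inverse l) * v l))"
        using vl ID(6) by (auto simp: inv_mod_def intro!: alg_intros)
      then have 1: "g l = \<phi> (- (cx (inverse l) * v l))" unfolding g_def by (rule uniq[OF Y])
      then have "l * g l = - \<phi> (v l)" using cfunD(3,6)[OF \<phi>(1)] elim(2) by simp
      with 1 show ?case by blast
    qed
    have "((\<lambda>l. \<phi> (- (cx (inverse l) * v l))) \<longlongrightarrow> \<phi> (- (0 * 1))) at_infinity"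
      by (intro bounded_linear.tendsto[OF cfun_bounded_linear[OF \<phi>(1)]] tendsto_intros v cx_inverse_tendsto)
    moreover have "eventually (\<lambda>l. \<phi> (- (cx (inverse l) * v l)) = g l) at_infinity"
      using gv by eventually_elim simp
    ultimately have "(g \<longlongrightarrow> 0) at_infinity" using cfunD(4)[OF \<phi>(1)] by (simp add: tendsto_cong)
    then have g0: "g l = 0" for l using Liouville_weak_0[OF hol] by blast
    \<comment> \<open>The leading term at infinity contradicts \<open>g = 0\<close>: the product
      \<open>l * g l\<close> tends to \<open>- \<phi> 1\<close>, which is not 0.\<close>
    have "eventually (\<lambda>l. - \<phi> (v l) = 0) at_infinity" using gv by eventually_elim (simp add: g0)
    then have "((\<lambda>l. - \<phi> (v l)) \<longlongrightarrow> 0) at_infinity" by (rule tendsto_eventually)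
    moreover have "((\<lambda>l. - \<phi> (v l)) \<longlongrightarrow> - \<phi> 1) at_infinity"
      by (intro tendsto_intros bounded_linear.tendsto[OF cfun_bounded_linear[OF \<phi>(1)]] v)
    ultimately have "- \<phi> 1 = 0" by (intro tendsto_unique[OF trivial_limit_at_infinity])
    with \<phi>(3) show ?thesis by simp
  qed
qed

section \<open>Real joint spectral points and the vanishing of the scalar integral\<close>

definition real_spectra :: bool where
  "real_spectra \<longleftrightarrow> (\<forall>c. Im c \<noteq> 0 \<longrightarrow> (\<forall>S\<in>{T0, T1, T2}. \<exists>v. inverse_pair (S - cx c) v))"

text \<open>The ideal is enlarged three times, once for each component. A nonreal value is excluded
  because \<open>S - cx l\<close> would then have an inverse, which lies in the bicommutant, and a
  proper ideal of \<open>alg\<close> contains no unit of \<open>alg\<close>.\<close>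

lemma joint_spectral_point:
  assumes I: "proper_ideal I" and real: real_spectra
  shows "\<exists>t0 t1 t2 I'. I \<subseteq> I' \<and> proper_ideal I' \<and> T0 - cx (of_real t0) \<in> I' \<and>
    T1 - cx (of_real t1) \<in> I' \<and> T2 - cx (of_real t2) \<in> I'"
proof -
  have re: "\<exists>t I'. I \<subseteq> I' \<and> proper_ideal I' \<and> S - cx (of_real t) \<in> I'"
    if I: "proper_ideal I" and S: "S \<in> {T0, T1, T2}" for I S
  proof -
    have Sal: "S \<in> alg" using S alg_generators by auto
    obtain l I' where I': "I \<subseteq> I'" "proper_ideal I'" "S - cx l \<in> I'"
      using proper_ideal_extend[OF I Sal] by blast
    have "Im l = 0"
    proof (rule ccontr)
      assume "Im l \<noteq> 0"
      then obtain v where v: "inverse_pair (S - cx l) v" using real S unfolding real_spectra_def by blast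
      have "v \<in> alg" using alg_inverse[OF _ v] Sal by (blast intro: alg_intros)
      then have "v * (S - cx l) \<in> I'" using proper_idealD(4)[OF I'(2)] I'(3) by blast
      with v proper_idealD(5)[OF I'(2)] show False by (simp add: inverse_pair_def)
    qed
    then have "l = of_real (Re l)" by (simp add: complex_eq_iff)
    with I' show ?thesis by metis
  qed
  obtain t0 I0 where 0: "I \<subseteq> I0" "proper_ideal I0" "T0 - cx (of_real t0) \<in> I0" using re[OF I, of T0] by blast
  obtain t1 I1 where 1: "I0 \<subseteq> I1" "proper_ideal I1" "T1 - cx (of_real t1) \<in> I1" using re[OF 0(2), of T1] by blast
  obtain t2 I2 where 2: "I1 \<subseteq> I2" "proper_ideal I2" "T2 - cx (of_real t2) \<in> I2" using re[OF 1(2), of T2] by blast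
  have "I \<subseteq> I2" "T0 - cx (of_real t0) \<in> I2" "T1 - cx (of_real t1) \<in> I2" using 0 1 2 by auto
  with 2(2,3) show ?thesis by metis
qed

text \<open>The zeros are \<open>p\<close> and \<open>cnj p\<close>. If they differ, the residues
  are opposite and the winding numbers around them are equal; if they coincide, the integrand has
  the primitive \<open>- 1 / (z - p)\<close>.\<close>

lemma scalar_pencil_cycle_integral:
  fixes t0 m :: real
  assumes \<Gamma>: "cycle \<Gamma>" and m: "m \<ge> 0"
    and nz: "\<And>z. z \<in> cycle_image \<Gamma> \<Longrightarrow> (z - of_real t0)\<^sup>2 + of_real m \<noteq> 0"
    and sym: "\<And>w. w \<notin> cycle_image \<Gamma> \<Longrightarrow> cycle_winding \<Gamma> (cnj w) = cycle_winding \<Gamma> w"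
  shows "(\<Sum>\<gamma>\<in>\<Gamma>. contour_integral \<gamma> (\<lambda>z. 1 / ((z - of_real t0)\<^sup>2 + of_real m))) = 0"
proof -
  define p where "p = Complex t0 (sqrt m)"
  have q: "(z - of_real t0)\<^sup>2 + of_real m = (z - p) * (z - cnj p)" for z
  proof -
    have "p + cnj p = 2 * of_real t0" "p * cnj p = of_real (t0\<^sup>2 + m)"
      using m by (simp_all add: p_def complex_eq_iff power2_eq_square)
    moreover have "(z - p) * (z - cnj p) = z * z - (p + cnj p) * z + p * cnj p" by (simp add: algebra_simps)
    ultimately show ?thesis by (simp add: algebra_simps power2_eq_square)
  qed
  have p: "p \<notin> cycle_image \<Gamma>" "cnj p \<notin> cycle_image \<Gamma>" using nz q by auto
  show ?thesis
  proof (cases "m = 0")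
    case True
    then have pp: "cnj p = p" by (simp add: p_def complex_eq_iff)
    have "contour_integral \<gamma> (\<lambda>z. 1 / ((z - p) * (z - cnj p))) = 0" if \<gamma>: "\<gamma> \<in> \<Gamma>" for \<gamma>
    proof (rule contour_integral_unique, rule Cauchy_theorem_primitive[where S = "- {p}" and f = "\<lambda>z. - 1 / (z - p)"])
      show "((\<lambda>z. - 1 / (z - p)) has_field_derivative 1 / ((z - p) * (z - cnj p))) (at z within - {p})"
        if "z \<in> - {p}" for z
        using that unfolding pp by (auto intro!: derivative_eq_intros simp: power2_eq_square)
    qed (use \<Gamma> \<gamma> p in \<open>auto simp: cycle_def cycle_image_def\<close>)
    then show ?thesis unfolding q by simp
  next
    case False
    then have pp: "p - cnj p \<noteq> 0" using m by (simp add: p_def complex_eq_iff)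
    have "contour_integral \<gamma> (\<lambda>z. 1 / ((z - p) * (z - cnj p))) =
        (2 * pi * \<i> / (p - cnj p)) * (winding_number \<gamma> p - winding_number \<gamma> (cnj p))" if \<gamma>: "\<gamma> \<in> \<Gamma>" for \<gamma>
    proof (rule contour_integral_unique)
      have vp: "valid_path \<gamma>" "p \<notin> path_image \<gamma>" "cnj p \<notin> path_image \<gamma>"
        using \<Gamma> \<gamma> p by (auto simp: cycle_def cycle_image_def)
      have "((\<lambda>z. (1 / (p - cnj p)) * (1 / (z - p) - 1 / (z - cnj p))) has_contour_integral
          (1 / (p - cnj p)) * (2 * pi * \<i> * winding_number \<gamma> p - 2 * pi * \<i> * winding_number \<gamma> (cnj p))) \<gamma>"
        by (intro has_contour_integral_lmul has_contour_integral_diff has_contour_integral_winding_number vp)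
      then have "((\<lambda>z. 1 / ((z - p) * (z - cnj p))) has_contour_integral
          (1 / (p - cnj p)) * (2 * pi * \<i> * winding_number \<gamma> p - 2 * pi * \<i> * winding_number \<gamma> (cnj p))) \<gamma>"
      proof (rule has_contour_integral_eq)
        fix z assume "z \<in> path_image \<gamma>"
        then have "z - p \<noteq> 0" "z - cnj p \<noteq> 0" using vp by auto
        then show "(1 / (p - cnj p)) * (1 / (z - p) - 1 / (z - cnj p)) = 1 / ((z - p) * (z - cnj p))"
          using pp by (simp add: divide_simps)
      qed
      then show "((\<lambda>z. 1 / ((z - p) * (z - cnj p))) has_contour_integral
          (2 * pi * \<i> / (p - cnj p)) * (winding_number \<gamma> p - winding_number \<gamma> (cnj p))) \<gamma>"
        by (simp add: right_diff_distrib)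
    qed
    then have "(\<Sum>\<gamma>\<in>\<Gamma>. contour_integral \<gamma> (\<lambda>z. 1 / ((z - p) * (z - cnj p)))) =
        (2 * pi * \<i> / (p - cnj p)) * (cycle_winding \<Gamma> p - cycle_winding \<Gamma> (cnj p))"
      by (simp add: cycle_winding_def sum_subtractf sum_divide_distrib sum_distrib_left
          right_diff_distrib diff_divide_distrib)
    then show ?thesis unfolding q using sym[OF p(1)] by simp
  qed
qed

text \<open>The only place where the reality of the spectra enters. If \<open>c0 \<Gamma> \<noteq> 0\<close>, then its annihilator
  is contained in an ideal modulo which \<open>T0\<close>, \<open>T1\<close>, \<open>T2\<close> are real scalars, so that the pencil is a
  scalar polynomial with a pair of conjugate zeros and \<open>c0 \<Gamma>\<close> vanishes modulo that ideal.\<close>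

lemma c0_eq_0:
  assumes \<Gamma>: "admissible \<Gamma>" and real: real_spectra
    and wind: "\<And>w. w \<notin> res \<Longrightarrow> cycle_winding \<Gamma> w \<in> {0, 1}"
    and sym: "\<And>w. w \<notin> cycle_image \<Gamma> \<Longrightarrow> cycle_winding \<Gamma> (cnj w) = cycle_winding \<Gamma> w"
  shows "c0 \<Gamma> = 0"
proof (rule ccontr)
  assume a0: "c0 \<Gamma> \<noteq> 0"
  define a where "a = c0 \<Gamma>"
  define e where "e = c1 \<Gamma>"
  have al: "a \<in> alg" "e \<in> alg" using \<Gamma> by (auto simp: a_def e_def alg_c0 alg_c1)
  define I where "I = {x \<in> alg. x * a = 0}"
  have "proper_ideal I"
    unfolding proper_ideal_def
  proof (intro conjI ballI)
    show "subspace I" by (auto simp: subspace_def I_def distrib_right intro: alg_intros)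
    have "closed {x. x * a = 0}" by (intro closed_Collect_eq continuous_intros)
    moreover have "I = alg \<inter> {x. x * a = 0}" by (auto simp: I_def)
    ultimately show "closed I" using closed_alg by auto
    show "I \<subseteq> alg" "1 \<notin> I" using a0 by (auto simp: I_def a_def)
    show "x * i \<in> I" if "x \<in> alg" "i \<in> I" for x i using that by (auto simp: I_def mult.assoc intro: alg_mult)
  qed
  then obtain t0 t1 t2 I' where I': "I \<subseteq> I'" "proper_ideal I'" and t: "T0 - cx (of_real t0) \<in> I'"
    "T1 - cx (of_real t1) \<in> I'" "T2 - cx (of_real t2) \<in> I'"
    using joint_spectral_point[OF _ real, of I] by blast
  note ID = proper_idealD[OF I'(2)]
  obtain \<phi> where \<phi>: "cfun \<phi>" "\<And>x. x \<in> I' \<Longrightarrow> \<phi> x = 0" "\<phi> 1 \<noteq> 0"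
    using proper_ideal_cfun[OF I'(2)] by blast
  define m where "m = t1\<^sup>2 + t2\<^sup>2"
  define q where "q z = (z - of_real t0)\<^sup>2 + of_real m" for z :: complex
  have sq: "S * S - cx (c * c) \<in> I'" if "S \<in> alg" "S - cx c \<in> I'" for S c
  proof -
    have "S * S - cx (c * c) = (S + cx c) * (S - cx c)"
      using that(1) by (simp add: cx_mult algebra_simps alg_commute alg_cx)
    also have "\<dots> \<in> I'" by (rule ID(4)[OF _ that(2)]) (use that(1) in \<open>blast intro: alg_intros\<close>)
    finally show ?thesis .
  qed
  have Qq: "Q z - cx (q z) \<in> I'" for z
  proof -
    have "W z - cx (z - of_real t0) = 0 - (T0 - cx (of_real t0))" by (simp add: W_def cx_diff)
    also have "\<dots> \<in> I'" by (rule ID(8)[OF ID(6) t(1)])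
    finally have "W z * W z - cx ((z - of_real t0) * (z - of_real t0)) \<in> I'" by (rule sq[OF alg_W])
    then have "(W z * W z - cx ((z - of_real t0) * (z - of_real t0))) +
        ((T1 * T1 - cx (of_real t1 * of_real t1)) + (T2 * T2 - cx (of_real t2 * of_real t2))) \<in> I'"
      by (intro ID(7)[OF _ ID(7)[OF sq[OF alg_generators(3) t(2)] sq[OF alg_generators(4) t(3)]]])
    moreover have "(W z * W z - cx ((z - of_real t0) * (z - of_real t0))) +
        ((T1 * T1 - cx (of_real t1 * of_real t1)) + (T2 * T2 - cx (of_real t2 * of_real t2))) = Q z - cx (q z)"
      by (simp add: Q_def M_def q_def m_def power2_eq_square cx_add)
    ultimately show ?thesis by simp
  qed
  \<comment> \<open>Modulo \<open>I'\<close> the pencil is the scalar \<open>q z\<close>, so under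
    \<open>\<phi>\<close> multiplication by \<open>qi z\<close> acts as division by
    \<open>q z\<close>. The case \<open>y = 1\<close> shows that \<open>q\<close> has no zero in
    \<open>res\<close>.\<close>
  have \<phi>q: "\<phi> y = q z * \<phi> (y * qi z)" if y: "y \<in> alg" and z: "z \<in> res" for y z
  proof -
    have "y = y * qi z * (Q z - cx (q z)) + cx (q z) * (y * qi z)"
      using y z Q_qi(2)[OF z]
      by (simp add: right_diff_distrib mult.assoc alg_commute[OF alg_cx] alg_intros)
    moreover have "y * qi z * (Q z - cx (q z)) \<in> I'" by (rule ID(4)[OF _ Qq]) (use y z in \<open>blast intro: alg_intros\<close>)
    ultimately have "\<phi> y = 0 + \<phi> (cx (q z) * (y * qi z))" using \<phi>(2) cfunD(1)[OF \<phi>(1)] by metis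
    then show ?thesis using cfunD(6)[OF \<phi>(1)] by simp
  qed
  have q0: "q z \<noteq> 0" if "z \<in> res" for z using \<phi>q[OF alg_1 that] \<phi>(3) by auto
  have cyc: "cycle \<Gamma>" "cycle_image \<Gamma> \<subseteq> res" using \<Gamma> by (auto simp: admissible_def)
  have van: "\<phi> (y * cycle_integral \<Gamma> qi) = 0" if y: "y \<in> alg" for y
  proof -
    have cf: "cfun (\<lambda>x. \<phi> (y * x))" using \<phi>(1) y by (intro cfun_mult_left alg_commute alg_generators)
    have "\<phi> (y * cycle_integral \<Gamma> qi) = (\<Sum>\<gamma>\<in>\<Gamma>. contour_integral \<gamma> (\<lambda>z. \<phi> (y * qi z)))"
      by (rule cfun_cycle_integral[OF cf \<Gamma> cderiv_on_qi])
    also have "\<dots> = (\<Sum>\<gamma>\<in>\<Gamma>. contour_integral \<gamma> (\<lambda>z. \<phi> y * (1 / q z)))"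
    proof (intro sum.cong refl contour_integral_cong)
      fix \<gamma> z assume "\<gamma> \<in> \<Gamma>" "z \<in> path_image \<gamma>"
      then have "z \<in> res" using cyc by (auto simp: cycle_image_def)
      then show "\<phi> (y * qi z) = \<phi> y * (1 / q z)" using \<phi>q[OF y] q0 by (simp add: field_simps)
    qed
    also have "\<dots> = (\<Sum>\<gamma>\<in>\<Gamma>. \<phi> y * contour_integral \<gamma> (\<lambda>z. 1 / q z))"
    proof (intro sum.cong refl contour_integral_lmul contour_integrable_holomorphic_simple[OF _ open_res])
      show "(\<lambda>z. 1 / q z) holomorphic_on res"
        using q0 unfolding q_def by (intro holomorphic_intros) auto
    qed (use cyc in \<open>auto simp: cycle_def cycle_image_def\<close>)
    also have "\<dots> = \<phi> y * (\<Sum>\<gamma>\<in>\<Gamma>. contour_integral \<gamma> (\<lambda>z. 1 / q z))" by (simp add: sum_distrib_left)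
    also have "(\<Sum>\<gamma>\<in>\<Gamma>. contour_integral \<gamma> (\<lambda>z. 1 / q z)) = 0"
      unfolding q_def
      by (rule scalar_pencil_cycle_integral[OF cyc(1)]) (use q0 cyc sym in \<open>auto simp: q_def m_def\<close>)
    finally show ?thesis by simp
  qed
  note idem = cycle_idempotent[OF \<Gamma> wind, folded a_def e_def]
  \<comment> \<open>By the first identity of \<open>cycle_idempotent\<close>, \<open>d\<close>
    annihilates \<open>a\<close> and so lies in \<open>I'\<close>. Thus \<open>\<phi>\<close> kills
    \<open>d * d\<close>, whereas the second identity evaluates it to
    \<open>\<phi> 1\<close>.\<close>
  define d where "d = 2 *\<^sub>R e - 1"
  have d: "d \<in> alg" unfolding d_def by (intro alg_intros al)
  have "d * a = 0" using idem(1) by (simp add: d_def left_diff_distrib)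
  with d have dI: "d \<in> I'" using I'(1) by (auto simp: I_def)
  have "\<phi> (d * d) = 0" by (rule \<phi>(2)[OF ID(4)[OF d dI]])
  moreover have "d * d = 1 + 4 *\<^sub>R (M * (a * a))"
  proof -
    have "d * d = 1 + 4 *\<^sub>R (e * e - e)" by (simp add: d_def algebra_simps flip: scaleR_add_left)
    with idem(2) show ?thesis by simp
  qed
  moreover have "\<phi> (M * (a * a)) = 0"
  proof -
    define k where "k = 1 / (2 * pi * \<i>)"
    have a: "a = cx k * cycle_integral \<Gamma> qi" by (simp only: a_def c0_def k_def)
    have "M * (a * a) = (M * a * cx k) * cycle_integral \<Gamma> qi" by (subst (2) a) (simp add: mult.assoc)
    then show ?thesis using van[of "M * a * cx k"] al by (simp add: alg_intros)
  qed
  ultimately show False using \<phi>(3) cfunD(1,5)[OF \<phi>(1)] by simp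
qed

end

section \<open>Conjugation and integration by parts\<close>

context commuting_operators
begin

text \<open>An element that anticommutes with \<open>j\<close> moves past a complex scalar by
  conjugating it, in particular past the velocity of the path.\<close>

lemma path_integral_cnj:
  assumes \<gamma>: "valid_path \<gamma>" and f: "path_integrable \<gamma> f" and f': "path_integrable (cnj \<circ> \<gamma>) f"
    and k: "k * j = - (j * k)" and kf: "\<And>z. z \<in> path_image \<gamma> \<Longrightarrow> k * f z = f (cnj z) * k"
  shows "k * path_integral \<gamma> f = path_integral (cnj \<circ> \<gamma>) f * k"
proof -
  let ?g = "\<lambda>t. cx (vector_derivative \<gamma> (at t within {0..1})) * f (\<gamma> t)"
  let ?h = "\<lambda>t. cx (vector_derivative (cnj \<circ> \<gamma>) (at t within {0..1})) * f ((cnj \<circ> \<gamma>) t)"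
  have kcx: "k * cx z = cx (cnj z) * k" for z
    using k by (simp add: cx_def algebra_simps)
  obtain K where K: "finite K" "\<And>t. t \<in> {0..1} - K \<Longrightarrow> \<gamma> differentiable (at t)"
    using \<gamma> by (auto simp: valid_path_def piecewise_C1_differentiable_on_def C1_differentiable_on_eq)
  have eq: "k * ?g t = ?h t * k" if t: "t \<in> {0..1} - K" for t
  proof -
    have D: "(\<gamma> has_vector_derivative vector_derivative \<gamma> (at t)) (at t within {0..1})"
      using K(2)[OF t] by (simp add: vector_derivative_works has_vector_derivative_at_within)
    have "vector_derivative \<gamma> (at t within {0..1}) = vector_derivative \<gamma> (at t)"
      using t D by (intro vector_derivative_within_closed_interval) auto
    moreover have "((cnj \<circ> \<gamma>) has_vector_derivative cnj (vector_derivative \<gamma> (at t))) (at t within {0..1})"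
      using bounded_linear.has_vector_derivative[OF bounded_linear_cnj D] by (simp add: o_def)
    then have "vector_derivative (cnj \<circ> \<gamma>) (at t within {0..1}) = cnj (vector_derivative \<gamma> (at t))"
      using t by (intro vector_derivative_within_closed_interval) auto
    ultimately have "k * ?g t = cx (vector_derivative (cnj \<circ> \<gamma>) (at t within {0..1})) * (k * f (\<gamma> t))"
      by (simp add: kcx flip: mult.assoc)
    also have "k * f (\<gamma> t) = f (cnj (\<gamma> t)) * k" using t by (intro kf) (auto simp: path_image_def)
    finally show ?thesis by (simp add: mult.assoc o_def)
  qed
  have "k * path_integral \<gamma> f = integral {0..1} (\<lambda>t. k * ?g t)"
    using integral_linear[OF f[unfolded path_integrable_def] bounded_linear_mult_right[of k]]
    by (simp add: path_integral_def o_def)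
  also have "\<dots> = integral {0..1} (\<lambda>t. ?h t * k)"
    by (rule integral_spike[OF negligible_finite[OF K(1)]]) (use eq in simp)
  also have "\<dots> = path_integral (cnj \<circ> \<gamma>) f * k"
    using integral_linear[OF f'[unfolded path_integrable_def] bounded_linear_mult_left[of k]]
    by (simp add: path_integral_def o_def)
  finally show ?thesis .
qed


text \<open>The conjugate cycle runs through the reflected curves with the opposite orientation.\<close>

lemma c1_commute_conjugation:
  assumes \<Gamma>: "admissible \<Gamma>" and cnj: "cnj ` cycle_image \<Gamma> \<subseteq> res"
    and wind: "\<And>w. w \<notin> res \<Longrightarrow> cycle_winding \<Gamma> w \<in> {0, 1}"
    and sym: "\<And>w. w \<notin> cycle_image \<Gamma> \<Longrightarrow> cycle_winding \<Gamma> (cnj w) = cycle_winding \<Gamma> w"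
    and k: "k * j = - (j * k)" "k * T0 = T0 * k" "k * T1 = T1 * k" "k * T2 = T2 * k"
  shows "k * c1 \<Gamma> = c1 \<Gamma> * k"
proof -
  define \<Delta> where "\<Delta> = (\<lambda>\<gamma>. cnj \<circ> \<gamma>) ` \<Gamma>"
  have inj: "inj_on (\<lambda>\<gamma>. cnj \<circ> \<gamma>) \<Gamma>"
    by (rule inj_onI) (auto simp: fun_eq_iff)
  have kcx: "k * cx z = cx (cnj z) * k" for z
    using k(1) by (simp add: cx_def algebra_simps)
  have kW: "k * W z = W (cnj z) * k" for z
    using k(2) kcx by (simp add: W_def algebra_simps)
  have kM: "k * M = M * k"
  proof -
    have "k * (T1 * T1) = (T1 * T1) * k" "k * (T2 * T2) = (T2 * T2) * k"
      using k(3,4) by (metis mult.assoc)+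
    then show ?thesis by (simp add: M_def distrib_left distrib_right)
  qed
  have kQ: "k * Q z = Q (cnj z) * k" for z
  proof -
    have "k * (W z * W z) = W (cnj z) * W (cnj z) * k" using kW by (metis mult.assoc)
    then show ?thesis using kM by (simp add: Q_def distrib_left distrib_right)
  qed
  have kqi: "k * qi z = qi (cnj z) * k" if "z \<in> res" "cnj z \<in> res" for z
  proof -
    have "k * qi z = qi (cnj z) * (Q (cnj z) * k) * qi z"
      using Q_qi(2)[OF that(2)] by (simp flip: mult.assoc)
    also have "\<dots> = qi (cnj z) * k * (Q z * qi z)" by (simp only: kQ[symmetric] mult.assoc)
    also have "\<dots> = qi (cnj z) * k" using Q_qi(1)[OF that(1)] by simp
    finally show ?thesis .
  qed
  have cyc: "cycle \<Gamma>" "cycle_image \<Gamma> \<subseteq> res" using \<Gamma> by (auto simp: admissible_def)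
  have im: "cycle_image \<Delta> = cnj ` cycle_image \<Gamma>"
    by (simp add: \<Delta>_def cycle_image_def path_image_compose image_UN)
  have \<Delta>: "admissible \<Delta>"
    unfolding admissible_def cycle_def
  proof (intro conjI ballI)
    show "finite \<Delta>" using cyc by (simp add: \<Delta>_def cycle_def)
    show "cycle_image \<Delta> \<subseteq> res" using im cnj by simp
    fix \<delta> assume "\<delta> \<in> \<Delta>"
    then obtain \<gamma> where \<gamma>: "\<gamma> \<in> \<Gamma>" "\<delta> = cnj \<circ> \<gamma>" by (auto simp: \<Delta>_def)
    with cyc show "valid_path \<delta>" "pathfinish \<delta> = pathstart \<delta>"
      by (auto simp: cycle_def valid_path_cnj pathfinish_compose pathstart_compose)
  qed
  \<comment> \<open>Reflection turns the winding number \<open>n\<close> of \<open>\<Gamma>\<close>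
    at \<open>cnj w\<close> into \<open>- cnj n\<close>. Symmetry moves the point back to
    \<open>w\<close>, and \<open>n\<close> is real because it is 0 or 1.\<close>
  have "cycle_winding \<Delta> w = of_real (-1) * cycle_winding \<Gamma> w" if w: "w \<notin> res" for w
  proof -
    have wi: "cnj w \<notin> cycle_image \<Gamma>" using w cnj by (metis complex_cnj_cnj imageI subsetD)
    have "cycle_winding \<Delta> w = (\<Sum>\<gamma>\<in>\<Gamma>. winding_number (cnj \<circ> \<gamma>) (cnj (cnj w)))"
      by (simp add: cycle_winding_def \<Delta>_def sum.reindex[OF inj])
    also have "\<dots> = (\<Sum>\<gamma>\<in>\<Gamma>. - cnj (winding_number \<gamma> (cnj w)))"
      using wi cyc
      by (intro sum.cong refl winding_number_cnj) (auto simp: cycle_def cycle_image_def valid_path_imp_path)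
    also have "\<dots> = - cnj (cycle_winding \<Gamma> (cnj w))" by (simp add: cycle_winding_def sum_negf)
    also have "\<dots> = - cnj (cycle_winding \<Gamma> w)" using sym w cyc by auto
    also have "\<dots> = - cycle_winding \<Gamma> w" using wind[OF w] by auto
    finally show ?thesis by simp
  qed
  then have c1: "c1 \<Delta> = - c1 \<Gamma>" using homologous_cycles(2)[OF \<Delta> \<Gamma>, of "-1"] by simp
  have "k * cycle_integral \<Gamma> (\<lambda>z. W z * qi z) = cycle_integral \<Delta> (\<lambda>z. W z * qi z) * k"
  proof -
    have "k * path_integral \<gamma> (\<lambda>z. W z * qi z) = path_integral (cnj \<circ> \<gamma>) (\<lambda>z. W z * qi z) * k"
      if \<gamma>: "\<gamma> \<in> \<Gamma>" for \<gamma>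
    proof (rule path_integral_cnj[OF _ _ _ k(1)])
      show "valid_path \<gamma>" using \<gamma> cyc by (simp add: cycle_def)
      show "path_integrable \<gamma> (\<lambda>z. W z * qi z)" by (rule cycle_path_integrable[OF \<Gamma> \<gamma> cderiv_on_W_qi])
      show "path_integrable (cnj \<circ> \<gamma>) (\<lambda>z. W z * qi z)"
        by (rule cycle_path_integrable[OF \<Delta> _ cderiv_on_W_qi]) (use \<gamma> in \<open>simp add: \<Delta>_def\<close>)
      fix z assume "z \<in> path_image \<gamma>"
      then have "z \<in> cycle_image \<Gamma>" using \<gamma> by (auto simp: cycle_image_def)
      then have z: "z \<in> res" "cnj z \<in> res" using cyc cnj by auto
      have "k * (W z * qi z) = W (cnj z) * (k * qi z)" by (simp add: kW flip: mult.assoc)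
      then show "k * (W z * qi z) = W (cnj z) * qi (cnj z) * k" by (simp add: kqi[OF z] mult.assoc)
    qed
    then show ?thesis
      by (simp add: cycle_integral_def \<Delta>_def sum.reindex[OF inj] sum_distrib_left sum_distrib_right)
  qed
  \<comment> \<open>The prefactor is purely imaginary, so it changes sign when \<open>k\<close>
    passes it. This cancels the sign in \<open>c1 \<Delta> = - c1 \<Gamma>\<close>.\<close>
  moreover have "k * cx (1 / (2 * pi * \<i>)) = - cx (1 / (2 * pi * \<i>)) * k"
    using kcx[of "1 / (2 * pi * \<i>)"] by (simp add: cx_minus[symmetric])
  ultimately have "k * c1 \<Gamma> = - c1 \<Delta> * k"
    unfolding c1_def by (simp only: mult.assoc[symmetric]) (simp only: mult.assoc mult_minus_left)
  with c1 show ?thesis by simp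
qed

section \<open>Integration by parts and the integrals of the theorem\<close>

lemma cycle_integral_derivative:
  assumes \<Gamma>: "admissible \<Gamma>" and f: "cderiv_on res f f'" and f': "cderiv_on res f' f''"
  shows "cycle_integral \<Gamma> f' = 0"
proof (rule cfun_eqI)
  fix \<phi> assume \<phi>: "cfun \<phi>"
  have "contour_integral \<gamma> (\<lambda>z. \<phi> (f' z)) = 0" if \<gamma>: "\<gamma> \<in> \<Gamma>" for \<gamma>
  proof (rule contour_integral_unique, rule Cauchy_theorem_primitive[where S = res and f = "\<lambda>z. \<phi> (f z)"])
    show "((\<lambda>z. \<phi> (f z)) has_field_derivative \<phi> (f' z)) (at z within res)" if "z \<in> res" for z
      using cfun_cderiv_on[OF \<phi> f that] by (rule has_field_derivative_at_within)
  qed (use \<Gamma> \<gamma> in \<open>auto simp: admissible_def cycle_def cycle_image_def\<close>)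
  then show "\<phi> (cycle_integral \<Gamma> f') = \<phi> 0"
    by (simp add: cfun_cycle_integral[OF \<phi> \<Gamma> f'] cfunD(4)[OF \<phi>])
qed

lemma path_integral_diff:
  assumes "path_integrable \<gamma> f" "path_integrable \<gamma> g"
  shows "path_integral \<gamma> (\<lambda>z. f z - g z) = path_integral \<gamma> f - path_integral \<gamma> g"
  using integral_diff[OF assms[unfolded path_integrable_def]]
  by (simp add: path_integral_def right_diff_distrib)

lemma path_integral_mult_left:
  assumes "path_integrable \<gamma> f" "y * j = j * y"
  shows "path_integral \<gamma> (\<lambda>z. y * f z) = y * path_integral \<gamma> f"
  using integral_linear[OF assms(1)[unfolded path_integrable_def] bounded_linear_mult_right[of y]]
  by (simp add: path_integral_def o_def cx_commute[OF assms(2)] flip: mult.assoc)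

lemma cycle_integral_diff:
  assumes "admissible \<Gamma>" "cderiv_on res f f'" "cderiv_on res g g'"
  shows "cycle_integral \<Gamma> (\<lambda>z. f z - g z) = cycle_integral \<Gamma> f - cycle_integral \<Gamma> g"
  unfolding cycle_integral_def sum_subtractf[symmetric]
  by (intro sum.cong refl path_integral_diff cycle_path_integrable[OF assms(1) _ assms(2)]
      cycle_path_integrable[OF assms(1) _ assms(3)])

lemma cycle_integral_mult_left:
  assumes "admissible \<Gamma>" "cderiv_on res f f'" "y * j = j * y"
  shows "cycle_integral \<Gamma> (\<lambda>z. y * f z) = y * cycle_integral \<Gamma> f"
  unfolding cycle_integral_def sum_distrib_left
  by (intro sum.cong refl path_integral_mult_left[OF _ assms(3)] cycle_path_integrable[OF assms(1) _ assms(2)])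

lemma cderiv_on_scaleR:
  assumes "cderiv_on S f f'"
  shows "cderiv_on S (\<lambda>z. r *\<^sub>R f z) (\<lambda>z. r *\<^sub>R f' z)"
proof -
  have "((\<lambda>z. r *\<^sub>R f z) has_derivative (\<lambda>h. r *\<^sub>R (cx h * f' z))) (at z)" if "z \<in> S" for z
    using assms that by (intro has_derivative_scaleR_right) (auto simp: cderiv_on_def)
  then show ?thesis using assms by (auto simp: cderiv_on_def intro!: continuous_intros)
qed

text \<open>The factor that \<open>P2_R\<close> and \<open>P2_L\<close> have in common: each of them
  is 4 times \<open>kernel z\<close> with \<open>z\<close> minus the conjugate of \<open>T\<close>
  attached on one side. It lies in \<open>alg\<close>, while that attached factor need not.\<close>

definition kernel :: "complex \<Rightarrow> 'b" where
  "kernel z = W z * qi z * qi z"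

lemma alg_kernel: "z \<in> res \<Longrightarrow> kernel z \<in> alg"
  unfolding kernel_def by (intro alg_intros)

lemma cderiv_on_mult_alg:
  assumes "cderiv_on res f f'" "cderiv_on res g g'" "\<And>z. z \<in> res \<Longrightarrow> f z \<in> alg"
  shows "\<exists>h. cderiv_on res (\<lambda>z. f z * g z) h"
  using cderiv_on_mult[OF assms(1,2)] alg_commute[OF assms(3) alg_generators(1)] by blast

lemma cderiv_on_kernel: "\<exists>h. cderiv_on res kernel h"
  unfolding kernel_def[abs_def]
  using cderiv_on_mult_alg[OF cderiv_on_W_qi cderiv_on_qi] by (auto intro: alg_intros)

lemma cderiv_on_cx_mult: "\<exists>h. cderiv_on res f h \<Longrightarrow> \<exists>h. cderiv_on res (\<lambda>z. cx z * f z) h"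
  using cderiv_on_mult_alg[OF cderiv_on_cx] alg_cx by blast

lemma cderiv_on_const_mult:
  "\<exists>h. cderiv_on res f h \<Longrightarrow> c \<in> alg \<Longrightarrow> \<exists>h. cderiv_on res (\<lambda>z. c * f z) h"
  using cderiv_on_mult_alg[OF cderiv_on_const] by blast

text \<open>Integration by parts, using that \<open>kernel\<close> is minus half of the derivative of \<open>qi\<close>.\<close>

lemma cycle_integral_kernel:
  assumes \<Gamma>: "admissible \<Gamma>"
  shows "cycle_integral \<Gamma> (\<lambda>z. cx z * kernel z) = (1/2) *\<^sub>R cycle_integral \<Gamma> qi"
    "cycle_integral \<Gamma> (\<lambda>z. cx z * (cx z * kernel z)) =
      cycle_integral \<Gamma> (\<lambda>z. W z * qi z) + T0 * cycle_integral \<Gamma> qi"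
proof -
  have half: "(1/2) *\<^sub>R (1::'b) \<in> alg" by (intro alg_intros)
  define u where "u z = cx z * qi z" for z
  \<comment> \<open>\<open>2 *\<^sub>R f1 z\<close> and \<open>2 *\<^sub>R f2 z\<close> are the
    derivatives of \<open>z * qi z\<close> and of \<open>z^2 * qi z\<close>, hence both integrate to
    0 over the cycle.\<close>
  define f1 where "f1 z = (1/2) *\<^sub>R 1 * qi z - cx z * kernel z" for z
  define f2 where "f2 z = u z - cx z * (cx z * kernel z)" for z
  obtain d1 where d1: "cderiv_on res (\<lambda>z. cx z * kernel z) d1"
    using cderiv_on_cx_mult[OF cderiv_on_kernel] by blast
  obtain d2 where d2: "cderiv_on res (\<lambda>z. cx z * (cx z * kernel z)) d2"
    using cderiv_on_cx_mult[OF cderiv_on_cx_mult[OF cderiv_on_kernel]] by blast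
  obtain du where du: "cderiv_on res u du"
    unfolding u_def[abs_def] using cderiv_on_cx_mult cderiv_on_qi by blast
  obtain dh where dh: "cderiv_on res (\<lambda>z. (1/2) *\<^sub>R 1 * qi z) dh"
    using cderiv_on_const_mult[OF _ half] cderiv_on_qi by blast
  have ker: "cx z * - (2 *\<^sub>R (qi z * W z * qi z)) = - (2 *\<^sub>R (cx z * kernel z))" if "z \<in> res" for z
    using that by (simp add: kernel_def alg_commute[OF alg_qi alg_W])
  have congD: "cderiv_on res f g'" if "cderiv_on res f g" "\<And>z. z \<in> res \<Longrightarrow> g z = g' z" for f g g'
    using that by (auto simp: cderiv_on_def cong: continuous_on_cong_simp)
  have u': "cderiv_on res u (\<lambda>z. 2 *\<^sub>R f1 z)"
  proof (rule congD)
    show "cderiv_on res u (\<lambda>z. cx z * - (2 *\<^sub>R (qi z * W z * qi z)) + 1 * qi z)"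
      unfolding u_def[abs_def]
      by (intro cderiv_on_mult cderiv_on_cx cderiv_on_qi) (simp add: alg_commute alg_intros)
    show "cx z * - (2 *\<^sub>R (qi z * W z * qi z)) + 1 * qi z = 2 *\<^sub>R f1 z" if "z \<in> res" for z
      unfolding ker[OF that] by (simp add: f1_def scaleR_diff_right)
  qed
  have f1': "cderiv_on res f1 (\<lambda>z. dh z - d1 z)"
    unfolding f1_def[abs_def] by (rule cderiv_on_diff[OF dh d1])
  have f1s: "cderiv_on res (\<lambda>z. 2 *\<^sub>R f1 z) (\<lambda>z. 2 *\<^sub>R (dh z - d1 z))"
    by (rule cderiv_on_scaleR[OF f1'])
  have two: "path_integral \<gamma> (\<lambda>z. 2 *\<^sub>R f1 z) = 2 *\<^sub>R path_integral \<gamma> f1" for \<gamma>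
    by (simp add: path_integral_def)
  have "2 *\<^sub>R cycle_integral \<Gamma> f1 = 0"
    using cycle_integral_derivative[OF \<Gamma> u' f1s] by (simp add: cycle_integral_def two scaleR_sum_right)
  then have "cycle_integral \<Gamma> f1 = 0" by simp
  moreover have "cycle_integral \<Gamma> f1 = (1/2) *\<^sub>R 1 * cycle_integral \<Gamma> qi - cycle_integral \<Gamma> (\<lambda>z. cx z * kernel z)"
    unfolding f1_def[abs_def] cycle_integral_diff[OF \<Gamma> dh d1]
    by (subst cycle_integral_mult_left[OF \<Gamma> cderiv_on_qi]) simp_all
  ultimately show "cycle_integral \<Gamma> (\<lambda>z. cx z * kernel z) = (1/2) *\<^sub>R cycle_integral \<Gamma> qi" by simp
  have f2': "cderiv_on res f2 (\<lambda>z. du z - d2 z)"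
    unfolding f2_def[abs_def] by (rule cderiv_on_diff[OF du d2])
  have f2s: "cderiv_on res (\<lambda>z. 2 *\<^sub>R f2 z) (\<lambda>z. 2 *\<^sub>R (du z - d2 z))"
    by (rule cderiv_on_scaleR[OF f2'])
  have v': "cderiv_on res (\<lambda>z. cx z * u z) (\<lambda>z. 2 *\<^sub>R f2 z)"
  proof (rule congD)
    show "cderiv_on res (\<lambda>z. cx z * u z) (\<lambda>z. cx z * (2 *\<^sub>R f1 z) + 1 * u z)"
      by (intro cderiv_on_mult cderiv_on_cx u') (simp add: alg_commute alg_intros)
    show "cx z * (2 *\<^sub>R f1 z) + 1 * u z = 2 *\<^sub>R f2 z" if "z \<in> res" for z
      by (simp add: f1_def f2_def u_def right_diff_distrib scaleR_diff_right scaleR_2 distrib_left)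
  qed
  have two: "path_integral \<gamma> (\<lambda>z. 2 *\<^sub>R f2 z) = 2 *\<^sub>R path_integral \<gamma> f2" for \<gamma>
    by (simp add: path_integral_def)
  have "2 *\<^sub>R cycle_integral \<Gamma> f2 = 0"
    using cycle_integral_derivative[OF \<Gamma> v' f2s] by (simp add: cycle_integral_def two scaleR_sum_right)
  then have "cycle_integral \<Gamma> (\<lambda>z. cx z * (cx z * kernel z)) = cycle_integral \<Gamma> u"
    unfolding f2_def[abs_def] cycle_integral_diff[OF \<Gamma> du d2] by simp
  moreover have "cycle_integral \<Gamma> (\<lambda>z. W z * qi z) = cycle_integral \<Gamma> u - T0 * cycle_integral \<Gamma> qi"
  proof -
    obtain dt where dt: "cderiv_on res (\<lambda>z. T0 * qi z) dt"
      using cderiv_on_const_mult[OF _ alg_generators(2)] cderiv_on_qi by blast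
    have "(\<lambda>z. W z * qi z) = (\<lambda>z. u z - T0 * qi z)" by (simp add: W_def u_def left_diff_distrib)
    then show ?thesis
      using cycle_integral_diff[OF \<Gamma> du dt] cycle_integral_mult_left[OF \<Gamma> cderiv_on_qi comm(1)] by simp
  qed
  ultimately show "cycle_integral \<Gamma> (\<lambda>z. cx z * (cx z * kernel z)) =
      cycle_integral \<Gamma> (\<lambda>z. W z * qi z) + T0 * cycle_integral \<Gamma> qi" by simp
qed

text \<open>The integral of \<open>z dz (- j) 4 kernel z (z - y)\<close> along one curve, expanded
  so that everything commuting with \<open>j\<close> is collected in front. In the application
  \<open>y\<close> is the conjugate of \<open>T\<close>; as it need not commute with
  \<open>j\<close>, it stays outside on its own side.\<close>

definition right_path_integral :: "'b \<Rightarrow> (real \<Rightarrow> complex) \<Rightarrow> 'b" where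
  "right_path_integral y \<gamma> = path_integral \<gamma> (\<lambda>z. - (4 *\<^sub>R j) * (cx z * (cx z * kernel z))) +
     path_integral \<gamma> (\<lambda>z. 4 *\<^sub>R j * (cx z * kernel z)) * y"

definition left_path_integral :: "'b \<Rightarrow> (real \<Rightarrow> complex) \<Rightarrow> 'b" where
  "left_path_integral y \<gamma> = path_integral \<gamma> (\<lambda>z. - (4 *\<^sub>R j) * (cx z * (cx z * kernel z))) +
     y * path_integral \<gamma> (\<lambda>z. 4 *\<^sub>R j * (cx z * kernel z))"

lemma has_integral_right_left:
  fixes \<gamma> :: "real \<Rightarrow> complex"
  assumes \<Gamma>: "admissible \<Gamma>" "\<gamma> \<in> \<Gamma>"
  defines "d \<equiv> \<lambda>t. cx (vector_derivative \<gamma> (at t within {0..1})) * - j"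
  shows "((\<lambda>t. cx (\<gamma> t) * d t * (4 *\<^sub>R (kernel (\<gamma> t) * (cx (\<gamma> t) - y)))) has_integral right_path_integral y \<gamma>) {0..1}"
    "((\<lambda>t. 4 *\<^sub>R ((cx (\<gamma> t) - y) * kernel (\<gamma> t)) * d t * cx (\<gamma> t)) has_integral left_path_integral y \<gamma>) {0..1}"
proof -
  let ?v = "\<lambda>t. cx (vector_derivative \<gamma> (at t within {0..1}))"
  let ?F = "\<lambda>z. - (4 *\<^sub>R j) * (cx z * (cx z * kernel z))"
  let ?G = "\<lambda>z. 4 *\<^sub>R j * (cx z * kernel z)"
  have j4: "- (4 *\<^sub>R j) \<in> alg" "4 *\<^sub>R j \<in> alg" by (intro alg_intros)+
  obtain dF dG where "cderiv_on res ?F dF" "cderiv_on res ?G dG"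
    using cderiv_on_const_mult[OF cderiv_on_cx_mult[OF cderiv_on_cx_mult[OF cderiv_on_kernel]] j4(1)]
      cderiv_on_const_mult[OF cderiv_on_cx_mult[OF cderiv_on_kernel] j4(2)] by blast
  then have "path_integrable \<gamma> ?F" "path_integrable \<gamma> ?G"
    using cycle_path_integrable[OF \<Gamma>] by blast+
  then have FG: "((\<lambda>t. ?v t * ?F (\<gamma> t)) has_integral path_integral \<gamma> ?F) {0..1}"
      "((\<lambda>t. ?v t * ?G (\<gamma> t)) has_integral path_integral \<gamma> ?G) {0..1}"
    by (simp_all only: path_integrable_def path_integral_def integrable_integral)
  have ker: "kernel (\<gamma> t) \<in> alg" if "t \<in> {0..1}" for t
  proof (rule alg_kernel)
    have "\<gamma> t \<in> cycle_image \<Gamma>" using \<Gamma>(2) that unfolding cycle_image_def path_image_def by blast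
    then show "\<gamma> t \<in> res" using \<Gamma>(1) by (auto simp: admissible_def)
  qed
  have "((\<lambda>t. ?v t * ?F (\<gamma> t) + ?v t * ?G (\<gamma> t) * y) has_integral right_path_integral y \<gamma>) {0..1}"
    unfolding right_path_integral_def
    using has_integral_linear[OF FG(2) bounded_linear_mult_left[of y]]
    by (intro has_integral_add FG(1)) (simp add: o_def)
  moreover have "?v t * ?F (\<gamma> t) + ?v t * ?G (\<gamma> t) * y = cx (\<gamma> t) * d t * (4 *\<^sub>R (kernel (\<gamma> t) * (cx (\<gamma> t) - y)))"
    if "t \<in> {0..1}" for t
  proof -
    have "?v t * ?F (\<gamma> t) + ?v t * ?G (\<gamma> t) * y = - (4 *\<^sub>R (?v t * j * cx (\<gamma> t) * kernel (\<gamma> t) * (cx (\<gamma> t) - y)))"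
      using ker[OF that]
      by (simp add: right_diff_distrib mult.assoc alg_commute alg_left_commute alg_intros scaleR_diff_right)
    also have "\<dots> = cx (\<gamma> t) * d t * (4 *\<^sub>R (kernel (\<gamma> t) * (cx (\<gamma> t) - y)))"
      by (simp add: d_def mult.assoc alg_left_commute alg_intros)
    finally show ?thesis .
  qed
  ultimately show "((\<lambda>t. cx (\<gamma> t) * d t * (4 *\<^sub>R (kernel (\<gamma> t) * (cx (\<gamma> t) - y)))) has_integral right_path_integral y \<gamma>) {0..1}"
    by (rule has_integral_eq[rotated])
  have "((\<lambda>t. ?v t * ?F (\<gamma> t) + y * (?v t * ?G (\<gamma> t))) has_integral left_path_integral y \<gamma>) {0..1}"
    unfolding left_path_integral_def
    using has_integral_linear[OF FG(2) bounded_linear_mult_right[of y]]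
    by (intro has_integral_add FG(1)) (simp add: o_def)
  moreover have "?v t * ?F (\<gamma> t) + y * (?v t * ?G (\<gamma> t)) = 4 *\<^sub>R ((cx (\<gamma> t) - y) * kernel (\<gamma> t)) * d t * cx (\<gamma> t)"
    if "t \<in> {0..1}" for t
  proof -
    define r where "r = kernel (\<gamma> t) * (?v t * (j * cx (\<gamma> t)))"
    have "?v t * ?F (\<gamma> t) = - (4 *\<^sub>R (cx (\<gamma> t) * r))" "?v t * ?G (\<gamma> t) = 4 *\<^sub>R r"
      unfolding r_def using ker[OF that]
      by (simp_all add: mult.assoc alg_commute alg_left_commute alg_intros)
    moreover have "4 *\<^sub>R ((cx (\<gamma> t) - y) * kernel (\<gamma> t)) * d t * cx (\<gamma> t) = - (4 *\<^sub>R ((cx (\<gamma> t) - y) * r))"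
      by (simp add: r_def d_def mult.assoc)
    ultimately show ?thesis by (simp add: left_diff_distrib scaleR_diff_right)
  qed
  ultimately show "((\<lambda>t. 4 *\<^sub>R ((cx (\<gamma> t) - y) * kernel (\<gamma> t)) * d t * cx (\<gamma> t)) has_integral left_path_integral y \<gamma>) {0..1}"
    by (rule has_integral_eq[rotated])
qed

text \<open>The coefficient of \<open>y\<close> is a multiple of \<open>c0 \<Gamma>\<close>, so
  nothing of \<open>y\<close> survives and left and right coincide. In the remaining term
  \<open>- 4 j\<close> meets the factor \<open>2 * pi * j\<close> of Cauchy's formula, which gives
  \<open>8 * pi\<close>.\<close>

lemma sum_right_left_path_integral:
  assumes \<Gamma>: "admissible \<Gamma>" and c0: "c0 \<Gamma> = 0"
  shows "(1 / (8 * pi)) *\<^sub>R (\<Sum>\<gamma>\<in>\<Gamma>. right_path_integral y \<gamma>) = c1 \<Gamma>"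
    "(1 / (8 * pi)) *\<^sub>R (\<Sum>\<gamma>\<in>\<Gamma>. left_path_integral y \<gamma>) = c1 \<Gamma>"
proof -
  have "cx (2 * pi * \<i>) * (cx (1 / (2 * pi * \<i>)) * x) = x" for x
    by (simp flip: mult.assoc cx_mult)
  then have inv: "cycle_integral \<Gamma> qi = 0" "cycle_integral \<Gamma> (\<lambda>z. W z * qi z) = cx (2 * pi * \<i>) * c1 \<Gamma>"
    using c0 unfolding c0_def c1_def by (metis mult_zero_right)+
  obtain d1 d2 where d: "cderiv_on res (\<lambda>z. cx z * kernel z) d1" "cderiv_on res (\<lambda>z. cx z * (cx z * kernel z)) d2"
    using cderiv_on_cx_mult[OF cderiv_on_kernel] cderiv_on_cx_mult[OF cderiv_on_cx_mult[OF cderiv_on_kernel]] by blast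
  have j4: "4 *\<^sub>R j * j = j * (4 *\<^sub>R j)" "- (4 *\<^sub>R j) * j = j * - (4 *\<^sub>R j)" by simp_all
  have "cycle_integral \<Gamma> (\<lambda>z. 4 *\<^sub>R j * (cx z * kernel z)) = 0"
    using cycle_integral_mult_left[OF \<Gamma> d(1) j4(1)]
    by (simp only: cycle_integral_kernel[OF \<Gamma>] inv scaleR_zero_right mult_zero_right)
  moreover have "cycle_integral \<Gamma> (\<lambda>z. - (4 *\<^sub>R j) * (cx z * (cx z * kernel z))) = (8 * pi) *\<^sub>R c1 \<Gamma>"
  proof -
    have "- (4 *\<^sub>R j) * cx (2 * pi * \<i>) = (8 * pi) *\<^sub>R 1"
      by (simp add: cx_def j_square)
    then have "- (4 *\<^sub>R j) * (cx (2 * pi * \<i>) * c1 \<Gamma>) = (8 * pi) *\<^sub>R c1 \<Gamma>"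
      by (simp only: mult.assoc[symmetric] mult_scaleR_left mult_1_left)
    then show ?thesis
      using cycle_integral_mult_left[OF \<Gamma> d(2) j4(2)]
      by (simp only: cycle_integral_kernel[OF \<Gamma>] inv mult_zero_right add_0_right)
  qed
  ultimately have "(\<Sum>\<gamma>\<in>\<Gamma>. path_integral \<gamma> (\<lambda>z. 4 *\<^sub>R j * (cx z * kernel z))) = 0"
    "(\<Sum>\<gamma>\<in>\<Gamma>. path_integral \<gamma> (\<lambda>z. - (4 *\<^sub>R j) * (cx z * (cx z * kernel z)))) = (8 * pi) *\<^sub>R c1 \<Gamma>"
    unfolding cycle_integral_def .
  then show "(1 / (8 * pi)) *\<^sub>R (\<Sum>\<gamma>\<in>\<Gamma>. right_path_integral y \<gamma>) = c1 \<Gamma>"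
    "(1 / (8 * pi)) *\<^sub>R (\<Sum>\<gamma>\<in>\<Gamma>. left_path_integral y \<gamma>) = c1 \<Gamma>"
    by (simp_all add: right_path_integral_def left_path_integral_def sum.distrib
        flip: sum_distrib_left sum_distrib_right)
qed

end

section \<open>The algebra of bounded operators\<close>

lemma inverse_pair_leftright:
  assumes "x * u = 1" "v * x = 1"
  shows "inverse_pair x u"
proof -
  have "v = v * (x * u)" using assms(1) by simp
  also have "\<dots> = u" using assms(2) by (simp flip: mult.assoc)
  finally show ?thesis using assms by (simp add: inverse_pair_def)
qed

lemma inverse_pair_factor:
  assumes "x * y = d" "y * x = d" "inverse_pair d e"
  shows "\<exists>v. inverse_pair x v"
proof -
  have "x * (y * e) = 1" "e * y * x = 1"
    using assms by (simp_all add: inverse_pair_def mult.assoc flip: mult.assoc[of x])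
  then show ?thesis using inverse_pair_leftright by blast
qed

text \<open>The two factors on the left are the quadratic polynomials of \<open>T\<close> and of its conjugate that define
  the S-spectrum, those on the right the pencil at conjugate points.\<close>

lemma pencil_factorization:
  fixes A V M j :: "'b::unital_banach_algebra" and y :: real
  assumes V: "V * V = - M" and com: "V * A = A * V" "M * A = A * M" "j * A = A * j" "j * M = M * j"
    and j: "j * j = - 1"
  shows "((A + V) * (A + V) + y\<^sup>2 *\<^sub>R 1) * ((A - V) * (A - V) + y\<^sup>2 *\<^sub>R 1) =
    ((y *\<^sub>R j - A) * (y *\<^sub>R j - A) + M) * ((- (y *\<^sub>R j) - A) * (- (y *\<^sub>R j) - A) + M)"
proof -
  have lc: "M * (A * x) = A * (M * x)" "V * (A * x) = A * (V * x)" "j * (A * x) = A * (j * x)" "j * (M * x) = M * (j * x)"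
      "V * (V * x) = - (M * x)" "j * (j * x) = - x" for x
    using com V j by (simp_all flip: mult.assoc)
  have VM: "V * M = M * V"
  proof -
    have "V * (V * V) = (V * V) * V" by (simp add: mult.assoc)
    then show ?thesis by (simp add: V)
  qed
  have VMx: "V * (M * x) = M * (V * x)" for x using VM by (simp flip: mult.assoc)
  show ?thesis
    by (simp add: algebra_simps V com j lc VM VMx power2_eq_square scaleR_2)
qed

text \<open>A copy of \<open>'a \<Rightarrow>\<^sub>L 'a\<close>, which is not itself a unary type constructor and so cannot be an instance
  of the algebra classes.\<close>

typedef (overloaded) 'a endo = "UNIV :: ('a::real_normed_vector \<Rightarrow>\<^sub>L 'a) set"
  morphisms endo_op Endo by simp

setup_lifting type_definition_endo

lemma endo_op_Endo [simp]: "endo_op (Endo f) = f" and Endo_endo_op [simp]: "Endo (endo_op x) = x"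
  by (simp_all add: Endo_inverse endo_op_inverse)

lemma endo_eqI: "endo_op x = endo_op y \<Longrightarrow> x = y"
  by (simp add: endo_op_inject)

instantiation endo :: (real_normed_vector) real_algebra
begin

lift_definition zero_endo :: "'a endo" is 0 .
lift_definition plus_endo :: "'a endo \<Rightarrow> 'a endo \<Rightarrow> 'a endo" is "(+)" .
lift_definition minus_endo :: "'a endo \<Rightarrow> 'a endo \<Rightarrow> 'a endo" is "(-)" .
lift_definition uminus_endo :: "'a endo \<Rightarrow> 'a endo" is uminus .
lift_definition scaleR_endo :: "real \<Rightarrow> 'a endo \<Rightarrow> 'a endo" is scaleR .
lift_definition times_endo :: "'a endo \<Rightarrow> 'a endo \<Rightarrow> 'a endo" is "(o\<^sub>L)" .

instance
  by standard
    (transfer; rule blinfun_eqI; simp add: blinfun.bilinear_simps algebra_simps)+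

end

instantiation endo :: (real_normed_vector) real_normed_algebra
begin

lift_definition norm_endo :: "'a endo \<Rightarrow> real" is norm .
definition sgn_endo :: "'a endo \<Rightarrow> 'a endo" where "sgn_endo x = x /\<^sub>R norm x"
definition dist_endo :: "'a endo \<Rightarrow> 'a endo \<Rightarrow> real" where "dist_endo x y = norm (x - y)"
definition uniformity_endo :: "('a endo \<times> 'a endo) filter" where
  "uniformity_endo = (INF e\<in>{0 <..}. principal {(x, y). dist x y < e})"
definition open_endo :: "'a endo set \<Rightarrow> bool" where
  "open_endo U \<longleftrightarrow> (\<forall>x\<in>U. eventually (\<lambda>(x', y). x' = x \<longrightarrow> y \<in> U) uniformity)"

instance
proof
  fix x y :: "'a endo" and a :: real
  show "norm (x * y) \<le> norm x * norm y" by transfer (rule norm_blinfun_compose)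
  show "norm (x + y) \<le> norm x + norm y" by transfer (rule norm_triangle_ineq)
  show "norm (a *\<^sub>R x) = \<bar>a\<bar> * norm x" by transfer simp
  show "(norm x = 0) = (x = 0)" by transfer simp
qed (simp_all add: sgn_endo_def dist_endo_def uniformity_endo_def open_endo_def)

end

lemma bounded_linear_endo_op: "bounded_linear endo_op"
  by (rule bounded_linear_intro[where K = 1])
     (simp_all add: plus_endo.rep_eq scaleR_endo.rep_eq norm_endo.rep_eq)

lemma dist_endo_op: "dist (endo_op x) (endo_op y) = dist x y"
  by (simp add: dist_norm minus_endo.rep_eq norm_endo.rep_eq)

instance endo :: (banach) banach
proof
  fix X :: "nat \<Rightarrow> 'a endo" assume "Cauchy X"
  then have "Cauchy (\<lambda>n. endo_op (X n))" by (simp add: Cauchy_def dist_endo_op)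
  then obtain l where "(\<lambda>n. endo_op (X n)) \<longlonglongrightarrow> l" using convergent_eq_Cauchy by blast
  then have "X \<longlonglongrightarrow> Endo l"
    using dist_endo_op[of _ "Endo l"] by (simp add: lim_sequentially)
  then show "convergent X" by (rule convergentI)
qed

instantiation endo :: (banach) unital_banach_algebra
begin

lift_definition one_endo :: "'a endo" is id_blinfun .

instance by standard (transfer; auto intro: blinfun_eqI)+

end

lemmas endo_op_simps = zero_endo.rep_eq plus_endo.rep_eq minus_endo.rep_eq uminus_endo.rep_eq
  scaleR_endo.rep_eq times_endo.rep_eq one_endo.rep_eq

section \<open>Operators on the quaternionic module\<close>

definition quat_endo :: "quat \<Rightarrow> 'a::real_normed_vector hmod endo" where
  "quat_endo a = Endo (qop a)"

definition real_endo :: "('a::real_normed_vector \<Rightarrow>\<^sub>L 'a) \<Rightarrow> 'a hmod endo" where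
  "real_endo A = Endo (real_op A)"

lemma hop_endo_eqI:
  fixes x y :: "'a::real_normed_vector hmod endo"
  assumes "\<And>x0 x1 x2 x3. blinfun_apply (endo_op x) (x0, x1, x2, x3) = blinfun_apply (endo_op y) (x0, x1, x2, x3)"
  shows "x = y"
  by (rule endo_eqI, rule blinfun_eqI) (metis assms prod_cases4)

lemma quat_endo_hom:
  "quat_endo (a * b) = quat_endo a * quat_endo b"
  "quat_endo (a + b) = quat_endo a + quat_endo b"
  "quat_endo (a - b) = quat_endo a - quat_endo b"
  "quat_endo (- a) = - quat_endo a"
  "quat_endo (r *\<^sub>R a) = r *\<^sub>R quat_endo a"
  by (rule hop_endo_eqI;
      simp add: quat_endo_def endo_op_simps qop.rep_eq blinfun.bilinear_simps algebra_simps)+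

lemma quat_endo_1: "quat_endo 1 = (1 :: 'a::banach hmod endo)"
  by (rule hop_endo_eqI) (simp add: quat_endo_def endo_op_simps qop.rep_eq)

lemma real_endo_hom:
  "real_endo (A o\<^sub>L B) = real_endo A * real_endo B"
  "real_endo (A + B) = real_endo A + real_endo B"
  "real_endo (A - B) = real_endo A - real_endo B"
  "real_endo (- A) = - real_endo A"
  "real_endo 0 = 0"
  "real_endo (r *\<^sub>R A) = r *\<^sub>R real_endo A"
  by (rule endo_eqI, rule blinfun_eqI,
      simp add: real_endo_def endo_op_simps real_op.rep_eq blinfun.bilinear_simps zero_prod_def)+

lemma real_endo_1: "real_endo id_blinfun = (1 :: 'a::banach hmod endo)"
  by (rule endo_eqI, rule blinfun_eqI) (simp add: real_endo_def endo_op_simps real_op.rep_eq)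

lemma real_endo_quat_endo: "real_endo A * quat_endo a = quat_endo a * real_endo A"
  by (rule hop_endo_eqI)
     (simp add: real_endo_def quat_endo_def endo_op_simps real_op.rep_eq qop.rep_eq blinfun.bilinear_simps)

lemma Endo_hop_of:
  "Endo (hop_of T0 T1 T2 T3) =
    real_endo T0 + real_endo T1 * quat_endo e1 + real_endo T2 * quat_endo e2 + real_endo T3 * quat_endo e3"
  by (rule endo_eqI) (simp add: hop_of_def real_endo_def quat_endo_def endo_op_simps)

section \<open>Right linear operators, their inverses and the real spectrum\<close>

lemma BX_D: "A \<in> BX \<Longrightarrow> blinfun_apply A (hmod_rmult x a) = hmod_rmult (blinfun_apply A x) a"
  unfolding BX_def by blast

lemma BX_I: "(\<And>x a. blinfun_apply A (hmod_rmult x a) = hmod_rmult (blinfun_apply A x) a) \<Longrightarrow> A \<in> BX"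
  unfolding BX_def by blast

lemma BX_compose: "A \<in> BX \<Longrightarrow> B \<in> BX \<Longrightarrow> A o\<^sub>L B \<in> BX"
  by (rule BX_I) (simp only: blinfun_apply_blinfun_compose BX_D)

lemma hmod_rmult_add:
  "hmod_rmult (x + y) a = hmod_rmult x a + hmod_rmult y a"
  "hmod_rmult (x - y) a = hmod_rmult x a - hmod_rmult y a"
  by (cases x; cases y; simp add: algebra_simps)+

lemma BX_add: "A \<in> BX \<Longrightarrow> B \<in> BX \<Longrightarrow> A + B \<in> BX"
  by (rule BX_I) (simp only: blinfun.add_left BX_D hmod_rmult_add)

lemma BX_diff: "A \<in> BX \<Longrightarrow> B \<in> BX \<Longrightarrow> A - B \<in> BX"
  by (rule BX_I) (simp only: blinfun.diff_left BX_D hmod_rmult_add)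

lemma qop_in_BX: "qop a \<in> BX"
  by (rule BX_I) (simp only: qop.rep_eq hmod_mult_laws(5))

text \<open>Right linearity passes to a two-sided inverse, so for right linear operators inverses in
  \<open>BX\<close> are the same as inverses in the algebra of bounded real linear maps, where the
  pencil lives.\<close>

lemma BX_inverse:
  assumes A: "A \<in> BX" and AB: "A o\<^sub>L B = id_blinfun" "B o\<^sub>L A = id_blinfun"
  shows "BX_inverse_of A B"
proof -
  have l: "blinfun_apply A (blinfun_apply B x) = x" and r: "blinfun_apply B (blinfun_apply A x) = x" for x
    using AB by (metis blinfun_apply_blinfun_compose id_blinfun.rep_eq)+
  have "blinfun_apply B (hmod_rmult x a) = hmod_rmult (blinfun_apply B x) a" for x a
  proof -
    have "hmod_rmult x a = blinfun_apply A (hmod_rmult (blinfun_apply B x) a)"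
      by (simp only: BX_D[OF A] l)
    then show ?thesis by (simp only: r)
  qed
  with AB show ?thesis unfolding BX_inverse_of_def by (blast intro: BX_I)
qed

lemma BX_inverse_of_iff:
  assumes "endo_op x \<in> BX"
  shows "BX_inverse_of (endo_op x) (endo_op y) \<longleftrightarrow> inverse_pair (x :: 'a::banach hmod endo) y"
proof
  assume "BX_inverse_of (endo_op x) (endo_op y)"
  then show "inverse_pair x y"
    unfolding BX_inverse_of_def inverse_pair_def by (auto intro!: endo_eqI simp: endo_op_simps)
next
  assume "inverse_pair x y"
  then show "BX_inverse_of (endo_op x) (endo_op y)"
    unfolding inverse_pair_def by (intro BX_inverse[OF assms]) (metis endo_op_simps(6,7))+
qed

text \<open>The product of \<open>A - c\<close> and \<open>A - cnj c\<close> has real coefficients,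
  hence acts on the two components of the complexification separately, and its inverse there
  compresses to an inverse on the real space. Being real, the result can be carried to the
  quaternionic module, where \<open>J\<close> takes the place of the complex unit.\<close>

lemma op_spectrum_inverse:
  fixes A :: "'a::banach \<Rightarrow>\<^sub>L 'a"
  assumes real: "op_spectrum A \<subseteq> \<real>" and c: "Im c \<noteq> 0"
  defines "D \<equiv> (A o\<^sub>L A) - (2 * Re c) *\<^sub>R A + (norm c)\<^sup>2 *\<^sub>R id_blinfun"
  shows "\<exists>E. D o\<^sub>L E = id_blinfun \<and> E o\<^sub>L D = id_blinfun"
proof -
  let ?R = "\<lambda>c. complexification A - complex_scalar c"
  have inv: "\<exists>B. ?R c o\<^sub>L B = id_blinfun \<and> B o\<^sub>L ?R c = id_blinfun" if "Im c \<noteq> 0" for c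
  proof -
    have "c \<notin> \<real>" using that by (auto simp: complex_is_Real_iff)
    then have "c \<notin> op_spectrum A" using real by blast
    then show ?thesis by (simp add: op_spectrum_def)
  qed
  obtain B1 where B1: "?R c o\<^sub>L B1 = id_blinfun" "B1 o\<^sub>L ?R c = id_blinfun" using inv[OF c] by blast
  have "Im (cnj c) \<noteq> 0" using c by simp
  from inv[OF this] obtain B2 where B2: "?R (cnj c) o\<^sub>L B2 = id_blinfun" "B2 o\<^sub>L ?R (cnj c) = id_blinfun" by blast
  have app: "blinfun_apply (?R c) (blinfun_apply B1 x) = x" "blinfun_apply B1 (blinfun_apply (?R c) x) = x"
    "blinfun_apply (?R (cnj c)) (blinfun_apply B2 x) = x" "blinfun_apply B2 (blinfun_apply (?R (cnj c)) x) = x" for x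
    using B1 B2 by (metis blinfun_apply_blinfun_compose id_blinfun.rep_eq)+
  have D: "D = (A o\<^sub>L A) - Re c *\<^sub>R A - Re c *\<^sub>R A + (Re c * Re c + Im c * Im c) *\<^sub>R id_blinfun"
    using cmod_power2[of c] scaleR_add_left[of "Re c" "Re c" A] by (simp add: D_def power2_eq_square)
  have cD: "(blinfun_apply D (fst z), blinfun_apply D (snd z)) =
      blinfun_apply (?R c) (blinfun_apply (?R (cnj c)) z)" for z
    by (cases z) (simp add: D complexification.rep_eq complex_scalar.rep_eq blinfun.bilinear_simps algebra_simps)
  define E where "E = Blinfun (\<lambda>x. fst (blinfun_apply B2 (blinfun_apply B1 (x, 0))))"
  have "bounded_linear (\<lambda>x. fst (blinfun_apply B2 (blinfun_apply B1 (x, 0))))"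
    by (intro bounded_linear_fst_comp blinfun.bounded_linear_right bounded_linear_compose[OF blinfun.bounded_linear_right]
        bounded_linear_Pair bounded_linear_ident bounded_linear_zero)
  then have E: "blinfun_apply E x = fst (blinfun_apply B2 (blinfun_apply B1 (x, 0)))" for x
    unfolding E_def by (simp add: bounded_linear_Blinfun_apply)
  have "blinfun_apply D (blinfun_apply E x) = x" for x
    using cD[of "blinfun_apply B2 (blinfun_apply B1 (x, 0))"] by (simp add: app E prod_eq_iff)
  moreover have "blinfun_apply E (blinfun_apply D x) = x" for x
  proof -
    have "(blinfun_apply D x, 0) = blinfun_apply (?R c) (blinfun_apply (?R (cnj c)) (x, 0))"
      using cD[of "(x, 0)"] by (simp add: blinfun.zero_right)
    then show ?thesis by (simp add: E app)
  qed
  ultimately show ?thesis by (intro exI[of _ E]) (auto intro!: blinfun_eqI)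
qed

section \<open>Slices, axial symmetry and boundary cycles\<close>

lemma imag_unit_components:
  assumes "J \<in> imag_units"
  shows "J * J = - 1" "qRe J = 0" "(qIm1 J)\<^sup>2 + (qIm2 J)\<^sup>2 + (qIm3 J)\<^sup>2 = 1"
proof -
  show JJ: "J * J = - 1" using assms by (simp add: imag_units_def power2_eq_square)
  have *: "qRe J * qRe J - qIm1 J * qIm1 J - qIm2 J * qIm2 J - qIm3 J * qIm3 J = - 1"
    "qRe J * qIm1 J = 0" "qRe J * qIm2 J = 0" "qRe J * qIm3 J = 0"
    using JJ by (auto simp: quat_eq_iff)
  show re: "qRe J = 0"
  proof (rule ccontr)
    assume "qRe J \<noteq> 0"
    with * have "qRe J * qRe J = - 1" by simp
    then show False using zero_le_square[of "qRe J"] by linarith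
  qed
  with * show "(qIm1 J)\<^sup>2 + (qIm2 J)\<^sup>2 + (qIm3 J)\<^sup>2 = 1" by (simp add: power2_eq_square)
qed

lemma quat_of_real: "of_real r = Quat r 0 0 0"
  by (simp add: of_real_def quat_eq_iff)

lemma slice_emb_components:
  assumes "J \<in> imag_units"
  shows "qRe (slice_emb J z) = Re z" "norm (slice_emb J z) = norm z"
proof -
  note J = imag_unit_components[OF assms]
  show re: "qRe (slice_emb J z) = Re z" by (simp add: slice_emb_def quat_of_real J)
  have "inner (slice_emb J z) (slice_emb J z) = (Re z)\<^sup>2 + (Im z)\<^sup>2 * ((qIm1 J)\<^sup>2 + (qIm2 J)\<^sup>2 + (qIm3 J)\<^sup>2)"
    by (simp add: inner_quat_def slice_emb_def quat_of_real J(2) power2_eq_square algebra_simps)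
  then show "norm (slice_emb J z) = norm z" by (simp add: norm_quat_def J(3) cmod_def)
qed

lemma continuous_on_slice_emb: "continuous_on S (slice_emb J)"
  unfolding slice_emb_def[abs_def] by (intro continuous_intros)

lemma open_slice: "open U \<Longrightarrow> open (slice J U)"
  using open_vimage[OF _ continuous_on_slice_emb, of U J] by (simp add: slice_def vimage_def)

lemma closure_slice: 
  assumes "z \<in> closure (slice J U)"
  shows "slice_emb J z \<in> closure U"
proof -
  have "slice_emb J ` closure (slice J U) \<subseteq> closure U"
    by (rule image_closure_subset[OF continuous_on_slice_emb closed_closure])
       (use closure_subset in \<open>auto simp: slice_def\<close>)
  with assms show ?thesis by blast
qed

lemma cnj_slice:
  assumes U: "axially_symmetric U" and J: "J \<in> imag_units" and z: "z \<in> slice J U"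
  shows "cnj z \<in> slice J U"
proof -
  have J': "- J \<in> imag_units" using J by (simp add: imag_units_def)
  have "of_real (Re z) + J * of_real (Im z) \<in> U" using z by (simp add: slice_def slice_emb_def)
  then have "of_real (Re z) + (- J) * of_real (Im z) \<in> U"
    using U J J' unfolding axially_symmetric_def by blast
  then show ?thesis by (simp add: slice_def slice_emb_def)
qed

lemma cnj_closure_slice:
  assumes U: "axially_symmetric U" and J: "J \<in> imag_units" and z: "z \<in> closure (slice J U)"
  shows "cnj z \<in> closure (slice J U)"
proof -
  have "cnj ` closure (slice J U) \<subseteq> closure (slice J U)"
    by (rule image_closure_subset[OF _ closed_closure])
       (use cnj_slice[OF U J] closure_subset in \<open>auto intro!: continuous_intros\<close>)
  with z show ?thesis by blast
qed

lemma cnj_iff: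
  assumes "\<And>z. z \<in> S \<Longrightarrow> cnj z \<in> S"
  shows "cnj z \<in> S \<longleftrightarrow> z \<in> S"
  using assms[of z] assms[of "cnj z"] by auto

text \<open>Conjugation in the slice exchanges \<open>J\<close> and \<open>- J\<close>, so axial
  symmetry makes the slice and its closure invariant. Off the boundary these two sets determine the
  winding number, which is therefore symmetric, whatever the curves are.\<close>

lemma slice_boundary_cycle:
  assumes U: "slice_Cauchy_domain U" and J: "J \<in> imag_units"
    and \<Gamma>: "positively_oriented_boundary \<Gamma> (slice J U)"
  shows "cycle \<Gamma>" "cycle_image \<Gamma> = closure (slice J U) - slice J U"
    "z \<in> slice J U \<Longrightarrow> cycle_winding \<Gamma> z = 1"
    "z \<notin> closure (slice J U) \<Longrightarrow> cycle_winding \<Gamma> z = 0"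
    "w \<notin> cycle_image \<Gamma> \<Longrightarrow> cycle_winding \<Gamma> (cnj w) = cycle_winding \<Gamma> w"
    "cnj ` cycle_image \<Gamma> = cycle_image \<Gamma>"
proof -
  have op: "open U" "axially_symmetric U" using U by (auto simp: slice_Cauchy_domain_def)
  show "cycle \<Gamma>"
    using \<Gamma> by (simp add: positively_oriented_boundary_def Jordan_boundary_def cycle_def)
  have "cycle_image \<Gamma> = frontier (slice J U)"
    using \<Gamma> by (simp add: positively_oriented_boundary_def Jordan_boundary_def cycle_image_def)
  then show im: "cycle_image \<Gamma> = closure (slice J U) - slice J U"
    by (simp add: frontier_def interior_open open_slice op)
  show 1: "z \<in> slice J U \<Longrightarrow> cycle_winding \<Gamma> z = 1"
    and 0: "z \<notin> closure (slice J U) \<Longrightarrow> cycle_winding \<Gamma> z = 0" for z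
    using \<Gamma> by (auto simp: positively_oriented_boundary_def cycle_winding_def)
  have c: "cnj z \<in> slice J U \<longleftrightarrow> z \<in> slice J U" "cnj z \<in> closure (slice J U) \<longleftrightarrow> z \<in> closure (slice J U)" for z
    using cnj_iff cnj_slice[OF op(2) J] cnj_closure_slice[OF op(2) J] by metis+
  show "w \<notin> cycle_image \<Gamma> \<Longrightarrow> cycle_winding \<Gamma> (cnj w) = cycle_winding \<Gamma> w"
    using 0[of w] 0[of "cnj w"] 1[of w] 1[of "cnj w"] c[of w] by (auto simp: im)
  show "cnj ` cycle_image \<Gamma> = cycle_image \<Gamma>"
  proof
    show "cnj ` cycle_image \<Gamma> \<subseteq> cycle_image \<Gamma>" using c by (auto simp: im)
    show "cycle_image \<Gamma> \<subseteq> cnj ` cycle_image \<Gamma>"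
    proof
      fix z assume "z \<in> cycle_image \<Gamma>"
      then have "cnj z \<in> cycle_image \<Gamma>" using c by (auto simp: im)
      then show "z \<in> cnj ` cycle_image \<Gamma>" by (metis complex_cnj_cnj imageI)
    qed
  qed
qed

section \<open>The projection\<close>

lemma Endo_hom:
  "Endo (A o\<^sub>L B) = Endo A * Endo B" "Endo (A + B) = Endo A + Endo B" "Endo (A - B) = Endo A - Endo B"
  "Endo (- A) = - Endo A" "Endo (r *\<^sub>R A) = r *\<^sub>R Endo A"
  by (rule endo_eqI, simp add: endo_op_simps)+

lemma Endo_id: "Endo id_blinfun = (1 :: 'a::banach endo)"
  by (rule endo_eqI) (simp add: endo_op_simps)

locale slice_operators =
  fixes T0 T1 T2 :: "'a::banach \<Rightarrow>\<^sub>L 'a" and J :: quat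
  assumes op_commute: "T1 o\<^sub>L T0 = T0 o\<^sub>L T1" "T2 o\<^sub>L T0 = T0 o\<^sub>L T2" "T2 o\<^sub>L T1 = T1 o\<^sub>L T2"
    and J: "J \<in> imag_units"
begin

sublocale commuting_operators "quat_endo J" "real_endo T0" "real_endo T1" "real_endo T2"
proof
  show "quat_endo J * quat_endo J = (- 1 :: 'a hmod endo)"
    by (simp add: imag_unit_components(1)[OF J] quat_endo_hom(4) quat_endo_1 flip: quat_endo_hom(1))
qed (simp_all add: real_endo_quat_endo op_commute flip: real_endo_hom(1))

definition T :: "'a hop" where "T = hop_of T0 T1 T2 0"

definition V :: "'a hmod endo" where
  "V = real_endo T1 * quat_endo e1 + real_endo T2 * quat_endo e2"

lemma Endo_T: "Endo T = real_endo T0 + V" and Endo_conj_T: "Endo (hop_conj T) = real_endo T0 - V"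
  by (simp_all add: T_def hop_conj_def Endo_hop_of V_def real_endo_hom(4,5))

lemma real_quat_left_commute:
  "quat_endo a * (real_endo A * x) = real_endo A * (quat_endo a * x)"
  by (simp add: real_endo_quat_endo flip: mult.assoc)

text \<open>The mixed terms cancel because \<open>e1\<close> and \<open>e2\<close> anticommute while
  \<open>T1\<close> and \<open>T2\<close> commute.\<close>

lemma V_square: "V * V = - M"
proof -
  have e: "quat_endo e1 * quat_endo e1 = (- 1 :: 'a hmod endo)" "quat_endo e2 * quat_endo e2 = (- 1 :: 'a hmod endo)"
    "quat_endo e2 * quat_endo e1 = (- (quat_endo e1 * quat_endo e2) :: 'a hmod endo)"
    by (simp_all add: e_mult_table quat_endo_hom(4) quat_endo_1 flip: quat_endo_hom(1))
  have "real_endo T2 * (real_endo T1 * x) = real_endo T1 * (real_endo T2 * x)" for x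
    using comm(6) by (simp flip: mult.assoc)
  then show ?thesis
    by (simp add: V_def M_def algebra_simps real_quat_left_commute e)
qed

lemma V_T0: "V * real_endo T0 = real_endo T0 * V"
proof -
  have "real_endo T1 * (real_endo T0 * x) = real_endo T0 * (real_endo T1 * x)"
    "real_endo T2 * (real_endo T0 * x) = real_endo T0 * (real_endo T2 * x)" for x
    using comm(4,5) by (simp_all flip: mult.assoc)
  then show ?thesis
    by (simp add: V_def algebra_simps real_endo_quat_endo[symmetric])
qed

lemma cx_eq: "cx z = quat_endo (slice_emb J z)"
proof -
  have "slice_emb J z = Re z *\<^sub>R 1 + Im z *\<^sub>R J" by (simp add: slice_emb_def of_real_def)
  then show ?thesis by (simp add: cx_def quat_endo_hom quat_endo_1)
qed

lemma Endo_qop: "Endo (qop (slice_emb J z)) = cx z"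
  by (simp add: cx_eq flip: quat_endo_def)

text \<open>The sum of \<open>T\<close> and its conjugate is \<open>2 T0\<close> and their product
  is \<open>T0^2 - V^2 = T0^2 + M\<close>; completing the square in \<open>z\<close> gives the
  pencil.\<close>

lemma Endo_Q_c: "Endo (Q_c (slice_emb J z) T) = Q z"
proof -
  have "Endo (Q_c (slice_emb J z) T) = cx z * cx z - cx z * (real_endo T0 + V + (real_endo T0 - V))
      + (real_endo T0 + V) * (real_endo T0 - V)"
    by (simp only: Q_c_def Endo_hom power2_eq_square Endo_T Endo_conj_T cx_eq quat_endo_def[symmetric] quat_endo_hom(1))
  also have "\<dots> = Q z"
    by (simp add: Q_def W_def algebra_simps V_square V_T0 alg_commute alg_intros)
  finally show ?thesis .
qed

lemma T_BX: "T \<in> BX" "hop_conj T \<in> BX"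
  by (simp_all add: T_def hop_conj_def hop_of_in_BX)

lemma Endo_BX_inv:
  assumes "z \<in> res"
  shows "Endo (BX_inv (Q_c (slice_emb J z) T)) = qi z"
proof -
  have Q: "Q_c (slice_emb J z) T = endo_op (Q z)" using Endo_Q_c[of z] by (metis endo_op_Endo)
  have "Q_c (slice_emb J z) T \<in> BX"
    unfolding Q_c_def by (intro BX_add BX_diff BX_compose qop_in_BX T_BX)
  then have "BX_inverse_of (Q_c (slice_emb J z) T) (endo_op (qi z))"
    using BX_inverse_of_iff inverse_pair_qi[OF assms] unfolding Q by blast
  then show ?thesis by (simp add: BX_inv_eqI)
qed

lemma Endo_P2_R:
  assumes z: "z \<in> res"
  shows "Endo (P2_R (slice_emb J z) T) = 4 *\<^sub>R (kernel z * (cx z - Endo (hop_conj T)))"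
proof -
  let ?b = "Endo (hop_conj T)"
  have T0: "Endo (real_op (comp0 T)) = real_endo T0" by (simp add: T_def real_endo_def)
  have F: "Endo (F_R (slice_emb J z) T) = (-4) *\<^sub>R (qi z * qi z * (cx z - ?b))"
    by (simp only: F_R_def Endo_hom Endo_BX_inv[OF z] Endo_qop)
  have "Endo (P2_R (slice_emb J z) T) = - (cx z * ((-4) *\<^sub>R (qi z * qi z * (cx z - ?b))))
      + real_endo T0 * ((-4) *\<^sub>R (qi z * qi z * (cx z - ?b)))"
    by (simp only: P2_R_def Endo_hom F T0 Endo_qop)
  also have "\<dots> = 4 *\<^sub>R ((cx z - real_endo T0) * (qi z * qi z * (cx z - ?b)))"
    by (simp add: left_diff_distrib scaleR_diff_right)
  finally show ?thesis by (simp add: kernel_def W_def mult.assoc)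
qed

lemma Endo_P2_L:
  assumes z: "z \<in> res"
  shows "Endo (P2_L (slice_emb J z) T) = 4 *\<^sub>R ((cx z - Endo (hop_conj T)) * kernel z)"
proof -
  let ?b = "Endo (hop_conj T)"
  have T0: "Endo (real_op (comp0 T)) = real_endo T0" by (simp add: T_def real_endo_def)
  have F: "Endo (F_L (slice_emb J z) T) = (-4) *\<^sub>R ((cx z - ?b) * (qi z * qi z))"
    by (simp only: F_L_def Endo_hom Endo_BX_inv[OF z] Endo_qop)
  \<comment> \<open>In \<open>P2_L\<close> the operator \<open>T0\<close> acts from the left but
    \<open>z\<close> from the right; they combine to \<open>W z\<close> only after \<open>T0\<close>
    has passed the factor with the conjugate of \<open>T\<close>.\<close>
  have com: "real_endo T0 * (cx z - ?b) = (cx z - ?b) * real_endo T0"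
    by (simp add: Endo_conj_T algebra_simps V_T0 alg_commute alg_intros)
  have "Endo (P2_L (slice_emb J z) T) = - ((-4) *\<^sub>R ((cx z - ?b) * (qi z * qi z)) * cx z)
      + real_endo T0 * ((-4) *\<^sub>R ((cx z - ?b) * (qi z * qi z)))"
    by (simp only: P2_L_def Endo_hom F T0 Endo_qop)
  also have "\<dots> = 4 *\<^sub>R ((cx z - ?b) * (qi z * qi z * cx z)) - 4 *\<^sub>R ((real_endo T0 * (cx z - ?b)) * (qi z * qi z))"
    by (simp add: mult.assoc)
  also have "\<dots> = 4 *\<^sub>R ((cx z - ?b) * (qi z * qi z * cx z - real_endo T0 * (qi z * qi z)))"
    by (simp only: com) (simp add: right_diff_distrib scaleR_diff_right mult.assoc)
  also have "qi z * qi z * cx z - real_endo T0 * (qi z * qi z) = kernel z"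
    by (simp add: kernel_def W_def left_diff_distrib mult.assoc alg_commute alg_left_commute alg_intros z)
  finally show ?thesis .
qed

text \<open>\<open>e3\<close> commutes with the components and anticommutes with \<open>V\<close>,
  so conjugation by it exchanges \<open>T\<close> and its conjugate, and with them their quadratic
  polynomials. Both are then invertible, hence so is their product \<open>Q z * Q (cnj z)\<close>,
  and its commuting factors are invertible too.\<close>

lemma rho_S_imp_res:
  assumes "slice_emb J z \<in> rho_S T"
  shows "z \<in> res"
proof -
  \<comment> \<open>After completing the square, \<open>dT\<close> is the polynomial of
    \<open>T\<close> and \<open>dT'\<close> that of its conjugate, with \<open>A + V\<close> and
    \<open>A - V\<close> standing for the two operators minus \<open>Re z\<close>.\<close>
  define A where "A = real_endo T0 - Re z *\<^sub>R 1"
  define y where "y = Im z"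
  define dT where "dT = (A + V) * (A + V) + y\<^sup>2 *\<^sub>R 1"
  define dT' where "dT' = (A - V) * (A - V) + y\<^sup>2 *\<^sub>R 1"
  define c :: "'a hmod endo" where "c = quat_endo e3"
  have nz: "(norm (slice_emb J z))\<^sup>2 = Re z * Re z + y\<^sup>2" and re: "qRe (slice_emb J z) = Re z"
    using slice_emb_components[OF J, of z] cmod_power2[of z] by (simp_all add: y_def power2_eq_square)
  have "Endo ((T o\<^sub>L T) - (2 * Re z) *\<^sub>R T + (Re z * Re z + y\<^sup>2) *\<^sub>R id_blinfun) = dT"
  proof -
    have AV: "A + V = Endo T - Re z *\<^sub>R 1" by (simp add: A_def Endo_T)
    have "(2 * Re z) *\<^sub>R x = Re z *\<^sub>R x + Re z *\<^sub>R x" for x :: "'a hmod endo"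
      by (simp flip: scaleR_add_left)
    then show ?thesis unfolding dT_def AV by (simp add: Endo_hom Endo_id algebra_simps)
  qed
  moreover obtain B where "BX_inverse_of ((T o\<^sub>L T) - (2 * Re z) *\<^sub>R T + (Re z * Re z + y\<^sup>2) *\<^sub>R id_blinfun) B"
    using assms by (auto simp: rho_S_def nz re)
  ultimately have B: "inverse_pair dT (Endo B)"
    unfolding BX_inverse_of_def inverse_pair_def by (metis Endo_hom(1) Endo_id)
  have cc: "c * c = - 1"
    by (simp add: c_def e_mult_table quat_endo_hom(4) quat_endo_1 flip: quat_endo_hom(1))
  have cT: "c * real_endo S = real_endo S * c" for S by (simp add: c_def real_endo_quat_endo)
  have cV: "c * V = - (V * c)"
  proof -
    have "c * quat_endo e1 = - (quat_endo e1 * c)" "c * quat_endo e2 = - (quat_endo e2 * c)"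
      by (simp_all add: c_def e_mult_table flip: quat_endo_hom(1,4))
    moreover have "c * (real_endo S * x) = real_endo S * (c * x)" for S x
      using cT by (simp flip: mult.assoc)
    ultimately show ?thesis by (simp add: V_def algebra_simps)
  qed
  have cAV: "c * (A + V) = (A - V) * c" using cT[of T0] cV by (simp add: A_def algebra_simps)
  have "c * dT = dT' * c"
  proof -
    have "c * ((A + V) * (A + V)) = (A - V) * (c * (A + V))"
      by (simp only: mult.assoc[of "A - V" c, symmetric] cAV[symmetric]) (simp only: mult.assoc)
    also have "\<dots> = (A - V) * (A - V) * c" by (simp only: cAV mult.assoc)
    finally have "c * ((A + V) * (A + V)) = (A - V) * (A - V) * c" .
    then show ?thesis by (simp add: dT_def dT'_def distrib_left distrib_right)
  qed
  then have dT': "dT' = - (c * dT * c)" using cc by (simp add: mult.assoc)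
  have cx: "c * (c * x) = - x" for x using cc by (simp flip: mult.assoc)
  have Bx: "dT * (Endo B * x) = x" "Endo B * (dT * x) = x" for x
    using B by (simp_all add: inverse_pair_def flip: mult.assoc)
  have "inverse_pair dT' (- (c * Endo B * c))"
    unfolding inverse_pair_def dT' by (simp add: mult.assoc cx Bx cc)
  from inverse_pair_mult[OF B this] obtain E where E: "inverse_pair (dT * dT') E" by blast
  have W: "W z = y *\<^sub>R quat_endo J - A" "W (cnj z) = - (y *\<^sub>R quat_endo J) - A"
    by (simp_all add: W_def A_def cx_def y_def)
  have "dT * dT' = Q z * Q (cnj z)"
    unfolding dT_def dT'_def Q_def W
  proof (rule pencil_factorization)
    show "V * V = - M" by (rule V_square)
    show "V * A = A * V" by (simp add: A_def algebra_simps V_T0)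
    have "A \<in> alg" unfolding A_def by (intro alg_intros)
    then show "M * A = A * M" "quat_endo J * A = A * quat_endo J" "quat_endo J * M = M * quat_endo J"
      by (auto intro: alg_commute alg_intros)
    show "quat_endo J * quat_endo J = (- 1 :: 'a hmod endo)" by (rule j_square)
  qed
  with E have "\<exists>v. inverse_pair (Q z) v"
    by (intro inverse_pair_factor[of _ "Q (cnj z)"]) (auto simp: alg_commute alg_Q)
  then show ?thesis by (simp add: res_def)
qed

lemma real_spectra:
  assumes "op_spectrum T0 \<subseteq> \<real>" "op_spectrum T1 \<subseteq> \<real>" "op_spectrum T2 \<subseteq> \<real>"
  shows real_spectra
  unfolding real_spectra_def
proof (intro allI impI ballI)
  fix c and S :: "'a hmod endo" assume c: "Im c \<noteq> 0" and "S \<in> {real_endo T0, real_endo T1, real_endo T2}"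
  then obtain A where A: "S = real_endo A" "op_spectrum A \<subseteq> \<real>" "S \<in> alg"
    using assms alg_generators by auto
  obtain E where E: "((A o\<^sub>L A) - (2 * Re c) *\<^sub>R A + (norm c)\<^sup>2 *\<^sub>R id_blinfun) o\<^sub>L E = id_blinfun"
      "E o\<^sub>L ((A o\<^sub>L A) - (2 * Re c) *\<^sub>R A + (norm c)\<^sup>2 *\<^sub>R id_blinfun) = id_blinfun"
    using op_spectrum_inverse[OF A(2) c] by blast
  define D where "D = S * S - (2 * Re c) *\<^sub>R S + (norm c)\<^sup>2 *\<^sub>R 1"
  have "inverse_pair D (real_endo E)"
    using E[THEN arg_cong[of _ _ real_endo]]
    by (simp only: inverse_pair_def D_def A(1) real_endo_hom real_endo_1)
  moreover have "(S - cx c) * (S - cx (cnj c)) = D"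
  proof -
    have "cx c + cx (cnj c) = (2 * Re c) *\<^sub>R 1" by (simp add: cx_def flip: scaleR_add_left)
    moreover have "cx c * cx (cnj c) = (norm c)\<^sup>2 *\<^sub>R 1"
      by (simp add: complex_mult_cnj cmod_power2 cx_of_real flip: cx_mult of_real_power of_real_add)
    moreover have "(S - cx c) * (S - cx (cnj c)) = S * S - (cx c + cx (cnj c)) * S + cx c * cx (cnj c)"
      by (simp add: algebra_simps alg_commute[OF A(3) alg_cx])
    ultimately show ?thesis by (simp add: D_def)
  qed
  moreover have "(S - cx (cnj c)) * (S - cx c) = (S - cx c) * (S - cx (cnj c))"
    using A(3) by (intro alg_commute alg_intros)
  ultimately show "\<exists>v. inverse_pair (S - cx c) v"
    by (intro inverse_pair_factor[of _ "S - cx (cnj c)"]) auto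
qed

lemma alg_commute_real: "x \<in> alg \<Longrightarrow> A \<in> {T0, T1, T2} \<Longrightarrow> x * real_endo A = real_endo A * x"
  using alg_generators by (auto intro: alg_commute)

text \<open>\<open>b\<close> is the component of the imaginary quaternion \<open>a\<close>
  orthogonal to \<open>J\<close>, and orthogonal imaginary quaternions anticommute.\<close>

lemma imag_part_anticommutes:
  fixes a :: quat
  defines "b \<equiv> a - (qIm1 a * qIm1 J + qIm2 a * qIm2 J + qIm3 a * qIm3 J) *\<^sub>R J"
  assumes a: "qRe a = 0"
  shows "b * J = - (J * b)"
proof -
  note Jc = imag_unit_components[OF J]
  let ?s = "qIm1 a * qIm1 J + qIm2 a * qIm2 J + qIm3 a * qIm3 J"
  have "a * J = - (J * a) - (2 * ?s) *\<^sub>R 1" by (simp add: quat_eq_iff Jc(2) a algebra_simps)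
  moreover have "(2 * ?s) *\<^sub>R (1 :: quat) = ?s *\<^sub>R 1 + ?s *\<^sub>R 1" by (simp flip: scaleR_add_left)
  ultimately show ?thesis by (simp add: b_def left_diff_distrib right_diff_distrib Jc(1))
qed

lemma slice_integral_eq:
  assumes \<Gamma>: "admissible \<Gamma>"
  shows "slice_integral J \<Gamma> qop (\<lambda>s. P2_R s T) = endo_op (\<Sum>\<gamma>\<in>\<Gamma>. right_path_integral (Endo (hop_conj T)) \<gamma>)"
    "slice_integral J \<Gamma> (\<lambda>p. P2_L p T) qop = endo_op (\<Sum>\<gamma>\<in>\<Gamma>. left_path_integral (Endo (hop_conj T)) \<gamma>)"
proof -
  interpret op: bounded_linear "endo_op :: 'a hmod endo \<Rightarrow> _" by (rule bounded_linear_endo_op)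
  have hi: "((\<lambda>t. f t) has_integral endo_op I) {0..1}"
    if "(g has_integral I) {0..1}" "\<And>t. t \<in> {0..1} \<Longrightarrow> Endo (f t) = g t"
    for f :: "real \<Rightarrow> 'a hop" and g I
  proof (rule has_integral_eq[rotated])
    show "((\<lambda>t. endo_op (g t)) has_integral endo_op I) {0..1}"
      using has_integral_linear[OF that(1) bounded_linear_endo_op] by (simp add: o_def)
    show "endo_op (g t) = f t" if "t \<in> {0..1}" for t
      using \<open>\<And>t. t \<in> {0..1} \<Longrightarrow> Endo (f t) = g t\<close>[OF that] by (metis endo_op_Endo)
  qed
  have res: "\<gamma> t \<in> res" if "\<gamma> \<in> \<Gamma>" "t \<in> {0..1}" for \<gamma> t
  proof -
    have "\<gamma> t \<in> cycle_image \<Gamma>" using that unfolding cycle_image_def path_image_def by blast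
    then show ?thesis using \<Gamma> by (auto simp: admissible_def)
  qed
  have q: "Endo (qop (slice_emb J z)) = cx z" "Endo (qop (slice_emb J z * - J)) = cx z * - quat_endo J" for z
    by (simp_all add: cx_eq quat_endo_hom flip: quat_endo_def)
  show "slice_integral J \<Gamma> qop (\<lambda>s. P2_R s T) = endo_op (\<Sum>\<gamma>\<in>\<Gamma>. right_path_integral (Endo (hop_conj T)) \<gamma>)"
    unfolding slice_integral_def op.sum
    by (intro sum.cong refl integral_unique hi[OF has_integral_right_left(1)[OF \<Gamma>]])
       (simp_all only: Endo_hom q Endo_P2_R res)
  show "slice_integral J \<Gamma> (\<lambda>p. P2_L p T) qop = endo_op (\<Sum>\<gamma>\<in>\<Gamma>. left_path_integral (Endo (hop_conj T)) \<gamma>)"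
    unfolding slice_integral_def op.sum
    by (intro sum.cong refl integral_unique hi[OF has_integral_right_left(2)[OF \<Gamma>]])
       (simp_all only: Endo_hom q Endo_P2_L res)
qed

text \<open>The second hypothesis has the form of what \<open>c1_commute_conjugation\<close>
  provides. An imaginary quaternion is a multiple of \<open>J\<close>, which commutes with
  \<open>alg\<close>, plus a part that anticommutes with \<open>J\<close>, to which the hypothesis
  applies; \<open>e1\<close> and \<open>e2\<close> are of this kind.\<close>

lemma commute_V:
  assumes x: "x \<in> alg" and k: "\<And>k. k * quat_endo J = - (quat_endo J * k) \<Longrightarrow>
      k * real_endo T0 = real_endo T0 * k \<Longrightarrow> k * real_endo T1 = real_endo T1 * k \<Longrightarrow>
      k * real_endo T2 = real_endo T2 * k \<Longrightarrow> k * x = x * k"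
  shows "V * x = x * V"
proof -
  have q: "quat_endo a * x = x * quat_endo a" if a: "qRe a = 0" for a
  proof -
    define s where "s = qIm1 a * qIm1 J + qIm2 a * qIm2 J + qIm3 a * qIm3 J"
    have "(a - s *\<^sub>R J) * J = - (J * (a - s *\<^sub>R J))" unfolding s_def by (rule imag_part_anticommutes[OF a])
    then have "quat_endo (a - s *\<^sub>R J) * x = x * quat_endo (a - s *\<^sub>R J)"
      by (intro k) (simp_all add: real_endo_quat_endo flip: quat_endo_hom(1,4))
    then show ?thesis
      using alg_commute[OF x alg_generators(1)] by (simp add: quat_endo_hom algebra_simps)
  qed
  have "quat_endo e1 * x = x * quat_endo e1" "quat_endo e2 * x = x * quat_endo e2"
    by (intro q; simp add: e1_def e2_def)+
  moreover have "x * (real_endo A * y) = real_endo A * (x * y)" if "A \<in> {T1, T2}" for A y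
    using alg_commute_real[OF x, of A] that by (auto simp flip: mult.assoc)
  ultimately show ?thesis by (simp add: V_def distrib_left distrib_right mult.assoc)
qed

end

theorem theorem5p6:
  fixes T P :: "'a::banach hop"
    and T0 T1 T2 :: "'a \<Rightarrow>\<^sub>L 'a"
    and \<sigma>1 \<sigma>2 G1 G2 :: "quat set"
    and J :: quat
    and \<Gamma>1 \<Gamma>2 :: "(real \<Rightarrow> complex) set"
  assumes "T \<in> BC" and "T = hop_of T0 T1 T2 0"
    and "op_spectrum T0 \<subseteq> \<real>" and "op_spectrum T1 \<subseteq> \<real>" and "op_spectrum T2 \<subseteq> \<real>"
    and "sigma_S T = \<sigma>1 \<union> \<sigma>2" and "set_distance \<sigma>1 \<sigma>2 > 0"
    and "slice_Cauchy_domain G1" and "bounded G1"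
    and "slice_Cauchy_domain G2" and "bounded G2"
    and "\<sigma>1 \<subseteq> G1" and "closure G1 \<subseteq> G2" and "set_distance G2 \<sigma>2 > 0"
    and "J \<in> imag_units"
    and "positively_oriented_boundary \<Gamma>1 (slice J G1)"
    and "positively_oriented_boundary \<Gamma>2 (slice J G2)"
    and P_def: "P = (1 / (8 * pi)) *\<^sub>R slice_integral J \<Gamma>2 qop (\<lambda>s. P2_R s T)"
  shows "P = (1 / (8 * pi)) *\<^sub>R slice_integral J \<Gamma>1 (\<lambda>p. P2_L p T) qop
    \<and> P o\<^sub>L P = P
    \<and> T o\<^sub>L P = P o\<^sub>L T"
proof -
  note J = assms(15)
  have TT: "T1 o\<^sub>L T0 = T0 o\<^sub>L T1" "T2 o\<^sub>L T0 = T0 o\<^sub>L T2" "T2 o\<^sub>L T1 = T1 o\<^sub>L T2"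
  proof -
    \<comment> \<open>\<open>BC\<close> only asserts that some commuting components exist;
      uniqueness of components identifies them with the given ones.\<close>
    obtain S0 S1 S2 S3 where S: "T = hop_of S0 S1 S2 S3"
      "\<forall>A\<in>{S0, S1, S2, S3}. \<forall>B\<in>{S0, S1, S2, S3}. A o\<^sub>L B = B o\<^sub>L A"
      using assms(1) by (auto simp: BC_def)
    have "T0 = S0" "T1 = S1" "T2 = S2" using S(1) assms(2) by (metis comp_hop_of)+
    with S(2) show "T1 o\<^sub>L T0 = T0 o\<^sub>L T1" "T2 o\<^sub>L T0 = T0 o\<^sub>L T2" "T2 o\<^sub>L T1 = T1 o\<^sub>L T2" by blast+
  qed
  interpret S: slice_operators T0 T1 T2 J using TT J by unfold_locales
  have T: "T = S.T" by (simp add: assms(2) S.T_def)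
  obtain d where d: "d > 0" "\<And>x y. x \<in> G2 \<Longrightarrow> y \<in> \<sigma>2 \<Longrightarrow> d \<le> dist x y"
    using assms(14) unfolding set_distance_pos_iff by blast
  have G12: "G1 \<subseteq> G2" using assms(13) closure_subset by blast
  \<comment> \<open>The positive distance keeps \<open>\<sigma>2\<close> off the closure of
    \<open>G2\<close>, and \<open>\<sigma>1\<close> lies inside \<open>G1\<close>. Hence neither
    boundary cycle meets a singular point of the pencil.\<close>
  have far: "y \<notin> closure G2" if "y \<in> \<sigma>2" for y
  proof
    assume "y \<in> closure G2"
    then obtain x where "x \<in> G2" "dist x y < d" using d(1) unfolding closure_approachable by blast
    with d(2)[of x y] that show False by simp
  qed
  have spec: "slice_emb J z \<in> \<sigma>1 \<or> slice_emb J z \<in> \<sigma>2" if "z \<notin> S.res" for z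
    using S.rho_S_imp_res[of z] that assms(6) by (auto simp: T sigma_S_def)
  note c1 = slice_boundary_cycle[OF assms(8) J assms(16)]
  note c2 = slice_boundary_cycle[OF assms(10) J assms(17)]
  have clos: "slice_emb J z \<in> closure G1 \<and> slice_emb J z \<in> closure G2" if "z \<in> closure (slice J G1)" for z
    using closure_slice[OF that] assms(13) closure_subset by blast
  have im1: "cycle_image \<Gamma>1 \<subseteq> S.res"
  proof (rule ccontr)
    assume "\<not> cycle_image \<Gamma>1 \<subseteq> S.res"
    then obtain z where z: "z \<in> closure (slice J G1)" "z \<notin> slice J G1" "z \<notin> S.res" by (auto simp: c1)
    with spec[OF z(3)] clos[OF z(1)] far assms(12) show False by (auto simp: slice_def)
  qed
  have im2: "cycle_image \<Gamma>2 \<subseteq> S.res"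
  proof (rule ccontr)
    assume "\<not> cycle_image \<Gamma>2 \<subseteq> S.res"
    then obtain z where z: "z \<in> closure (slice J G2)" "z \<notin> slice J G2" "z \<notin> S.res" by (auto simp: c2)
    with spec[OF z(3)] closure_slice[OF z(1)] far assms(12) G12 show False by (auto simp: slice_def)
  qed
  \<comment> \<open>The two cycles are homologous relative to the singular set: a singular point
    over \<open>\<sigma>1\<close> is inside both slices, and one over \<open>\<sigma>2\<close> is
    outside both closures.\<close>
  have wind: "cycle_winding \<Gamma>1 z = cycle_winding \<Gamma>2 z \<and> cycle_winding \<Gamma>2 z \<in> {0, 1}" if z: "z \<notin> S.res" for z
    using spec[OF z]
  proof
    assume "slice_emb J z \<in> \<sigma>1"
    then have "z \<in> slice J G1" "z \<in> slice J G2" using assms(12) G12 by (auto simp: slice_def)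
    then show ?thesis by (simp add: c1 c2)
  next
    assume "slice_emb J z \<in> \<sigma>2"
    then have "z \<notin> closure (slice J G1)" "z \<notin> closure (slice J G2)"
      using far clos closure_slice by blast+
    then show ?thesis by (simp add: c1 c2)
  qed
  have ad: "S.admissible \<Gamma>1" "S.admissible \<Gamma>2"
    using c1(1) c2(1) im1 im2 by (simp_all add: S.admissible_def)
  have real: S.real_spectra using S.real_spectra assms(3-5) by blast
  have w1: "cycle_winding \<Gamma>1 w \<in> {0, 1}" and w2: "cycle_winding \<Gamma>2 w \<in> {0, 1}" if "w \<notin> S.res" for w
    using wind[OF that] by auto
  have z1: "S.c0 \<Gamma>1 = 0" by (rule S.c0_eq_0[OF ad(1) real w1 c1(5)])
  have z2: "S.c0 \<Gamma>2 = 0" by (rule S.c0_eq_0[OF ad(2) real w2 c2(5)])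
  have hom: "S.c1 \<Gamma>1 = S.c1 \<Gamma>2"
    using S.homologous_cycles(2)[OF ad, of 1] wind by simp
  define e where "e = S.c1 \<Gamma>2"
  have PR: "P = endo_op e"
    using S.slice_integral_eq(1)[OF ad(2)] S.sum_right_left_path_integral(1)[OF ad(2) z2, of "Endo (hop_conj S.T)"]
    by (simp add: P_def T e_def flip: scaleR_endo.rep_eq)
  have PL: "(1 / (8 * pi)) *\<^sub>R slice_integral J \<Gamma>1 (\<lambda>p. P2_L p T) qop = endo_op e"
    using S.slice_integral_eq(2)[OF ad(1)] S.sum_right_left_path_integral(2)[OF ad(1) z1, of "Endo (hop_conj S.T)"]
    by (simp add: T e_def hom flip: scaleR_endo.rep_eq)
  have ealg: "e \<in> S.alg" using S.alg_c1[OF ad(2)] by (simp add: e_def)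
  \<comment> \<open>The term with \<open>M\<close> in the second identity of
    \<open>cycle_idempotent\<close> carries the factor \<open>c0 \<Gamma>2 * c0 \<Gamma>2\<close>,
    which is 0.\<close>
  have "e * e = e"
    using S.cycle_idempotent(2)[OF ad(2) w2] by (simp add: z2 e_def)
  moreover have "Endo T * e = e * Endo T"
  proof -
    have "S.V * e = e * S.V"
    proof (rule S.commute_V[OF ealg])
      fix k :: "'a hmod endo"
      assume "k * quat_endo J = - (quat_endo J * k)" "k * real_endo T0 = real_endo T0 * k"
        "k * real_endo T1 = real_endo T1 * k" "k * real_endo T2 = real_endo T2 * k"
      then show "k * e = e * k"
        unfolding e_def using ad(2) im2 c2(5,6) w2 by (intro S.c1_commute_conjugation) auto
    qed
    moreover have "e * real_endo T0 = real_endo T0 * e" using S.alg_commute_real[OF ealg, of T0] by simp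
    ultimately show ?thesis unfolding T S.Endo_T by (simp add: distrib_left distrib_right)
  qed
  ultimately have "P o\<^sub>L P = P" "T o\<^sub>L P = P o\<^sub>L T"
    unfolding PR by (metis times_endo.rep_eq endo_op_Endo)+
  with PR PL show ?thesis by simp
qed

end
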